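(* Let $\mathcal O\subset\mathfrak g_{\mathbb R}-\{0\}$ be a nilpotent $G_{\mathbb R}$-orbit, $\zeta\in C(\mathcal O)$, and $\Phi_0\in\mathrm{Mor}^{\mathbb R,\theta}(\mathfrak s,\mathfrak g)$ the morphism with $\Phi_0(e)=\zeta$; use $\Phi_0$ to identify $\mathfrak s$ with a subalgebra of $\mathfrak g$, so that $e=\zeta$. The map $\mathrm{Hom}(\mathfrak s,\mathfrak g)\ni\Phi\mapsto\Phi(\zeta)=\Phi(e)$ is injective on $$\mathfrak d(\Phi_0)=\bigoplus_{r\ge2}\mathrm{Hom}^\theta(\mathfrak s,\mathfrak g(r))(r-2).$$ The image $\mathfrak d(\Phi_0)(\zeta)$ of $\mathfrak d(\Phi_0)$ under this map is a $(K_{\mathbb R})_\zeta$-invariant linear complement to $[\zeta,\mathfrak k]$ in $[\zeta,\mathfrak g]$, and is defined over $\mathbb R$.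
   Context: $\mathfrak g_{\mathbb R}$ is a real semisimple Lie algebra, $G_{\mathbb R}=\mathrm{Aut}(\mathfrak g_{\mathbb R})^0$, $K_{\mathbb R}\subset G_{\mathbb R}$ a maximal compact subgroup with Lie algebra $\mathfrak k_{\mathbb R}$, $\mathfrak g_{\mathbb R}=\mathfrak k_{\mathbb R}\oplus\mathfrak p_{\mathbb R}$ the Cartan decomposition, $\theta$ the Cartan involution; $\mathfrak g=\mathfrak k\oplus\mathfrak p$ is the complexification with $\theta$ extended complex linearly. $(K_{\mathbb R})_\zeta$ is the isotropy subgroup of $K_{\mathbb R}$ at $\zeta$. $\mathfrak s=\mathfrak{sl}(2,\mathbb C)$ has real form $\mathfrak{sl}(2,\mathbb R)$, Cartan involution $\theta_{\mathfrak s}(\zeta)=-{}^t\zeta$, and $e=\begin{pmatrix}0&1\\0&0\end{pmatrix}$. $\mathrm{Hom}(\mathfrak s,\mathfrak g)$ is the space of $\mathbb C$-linear maps, $\mathrm{Hom}^\theta(\mathfrak s,\mathfrak g)$ the subspace of $\Phi$ with $\theta\circ\Phi=\Phi\circ\theta_{\mathfrak s}$; $\mathrm{Mor}^{\mathbb R,\theta}(\mathfrak s,\mathfrak g)$ is the set of non-zero Lie algebra homomorphisms in $\mathrm{Hom}^\theta(\mathfrak s,\mathfrak g)$ that are defined over $\mathbb R$. The core of $\mathcal O$ is $C(\mathcal O)=\{\Phi_0(e):\Phi_0\in\mathrm{Mor}^{\mathbb R,\theta}(\mathfrak s,\mathfrak g),\ \Phi_0(e)\in\mathcal O\}$, and $\Phi_0$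 is determined by $\Phi_0(e)$. (Equivalently, $C(\mathcal O)$ is the set of unit vectors in $\mathcal O$ critical for $\|m\|^2$, $m(\zeta)=-[\zeta,\theta\zeta]/\|\zeta\|^2$, for the suitably normalized inner product $-B(\cdot,\theta\cdot)$.) $\mathfrak g(r)$ is the $\mathfrak s$-isotypic subspace of $\mathfrak g$ of highest weight $r$ (for $\mathrm{ad}\circ\Phi_0$). $\mathfrak s$ acts diagonally on $\mathrm{Hom}(\mathfrak s,\mathfrak g(r))$ by $(x\Phi)(u)=[\Phi_0(x),\Phi(u)]-\Phi([x,u])$, and $\mathrm{Hom}(\mathfrak s,\mathfrak g(r))(r')$ denotes the isotypic subspace of highest weight $r'$ for this action; $\mathrm{Hom}^\theta(\mathfrak s,\mathfrak g(r))(r')$ is its intersection with $\mathrm{Hom}^\theta(\mathfrak s,\mathfrak g)$. A complex subspace of $\mathfrak g$ is defined over $\mathbb R$ if it is the complexification of its intersection with $\mathfrak g_{\mathbb R}$. *)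

theory Defs
  imports
    "HOL-Analysis.Analysis"
    "HOL-Algebra.Group"
    "HOL-Library.Function_Algebras"
begin

section \<open>Real Lie algebras\<close>

text \<open>
  A real Lie algebra is a bracket on a finite-dimensional real vector space, the latter rendered by
  a type of class \<^class>\<open>euclidean_space\<close>. The inner product of that class is unrelated to the
  bracket; it only supplies the (canonical) topology of the space and of its endomorphisms.
\<close>

definition lie_algebra :: "('a::euclidean_space \<Rightarrow> 'a \<Rightarrow> 'a) \<Rightarrow> bool" where
  "lie_algebra br \<longleftrightarrow> bilinear br \<and> (\<forall>x. br x x = 0) \<and>
     (\<forall>x y z. br x (br y z) + br y (br z x) + br z (br x y) = 0)"

definition lie_ideal :: "('a::euclidean_space \<Rightarrow> 'a \<Rightarrow> 'a) \<Rightarrow> 'a set \<Rightarrow> bool" where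
  "lie_ideal br I \<longleftrightarrow> subspace I \<and> (\<forall>x. \<forall>y\<in>I. br x y \<in> I)"

definition derived_algebra :: "('a::euclidean_space \<Rightarrow> 'a \<Rightarrow> 'a) \<Rightarrow> 'a set \<Rightarrow> 'a set" where
  "derived_algebra br I = span {br x y | x y. x \<in> I \<and> y \<in> I}"

definition solvable_subalgebra :: "('a::euclidean_space \<Rightarrow> 'a \<Rightarrow> 'a) \<Rightarrow> 'a set \<Rightarrow> bool" where
  "solvable_subalgebra br I \<longleftrightarrow> (\<exists>n. (derived_algebra br ^^ n) I = {0})"

definition semisimple_lie_algebra :: "('a::euclidean_space \<Rightarrow> 'a \<Rightarrow> 'a) \<Rightarrow> bool" where
  "semisimple_lie_algebra br \<longleftrightarrow> lie_algebra br \<and>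
     (\<forall>I. lie_ideal br I \<and> solvable_subalgebra br I \<longrightarrow> I = {0})"

text \<open>The trace of an endomorphism, read off from the diagonal entries in the basis \<open>Basis\<close>.\<close>

definition endo_trace :: "('a::euclidean_space \<Rightarrow> 'a) \<Rightarrow> real" where
  "endo_trace f = (\<Sum>b\<in>Basis. f b \<bullet> b)"

definition killing_form :: "('a::euclidean_space \<Rightarrow> 'a \<Rightarrow> 'a) \<Rightarrow> 'a \<Rightarrow> 'a \<Rightarrow> real" where
  "killing_form br x y = endo_trace (\<lambda>v. br x (br y v))"

definition cartan_involution ::
    "('a::euclidean_space \<Rightarrow> 'a \<Rightarrow> 'a) \<Rightarrow> ('a \<Rightarrow> 'a) \<Rightarrow> bool" where
  "cartan_involution br \<theta> \<longleftrightarrow> linear \<theta> \<and> (\<forall>x. \<theta> (\<theta> x) = x) \<and>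
     (\<forall>x y. \<theta> (br x y) = br (\<theta> x) (\<theta> y)) \<and>
     (\<forall>x. x \<noteq> 0 \<longrightarrow> - killing_form br x (\<theta> x) > 0)"


section \<open>The adjoint group and its maximal compact subgroups\<close>

definition lie_automorphisms ::
    "('a::euclidean_space \<Rightarrow> 'a \<Rightarrow> 'a) \<Rightarrow> ('a \<Rightarrow>\<^sub>L 'a) set" where
  "lie_automorphisms br = {F. bij (blinfun_apply F) \<and>
     (\<forall>x y. blinfun_apply F (br x y) = br (blinfun_apply F x) (blinfun_apply F y))}"

definition Aut_group :: "('a::euclidean_space \<Rightarrow> 'a \<Rightarrow> 'a) \<Rightarrow> ('a \<Rightarrow>\<^sub>L 'a) monoid" where
  "Aut_group br = \<lparr>carrier = lie_automorphisms br, mult = (o\<^sub>L), one = id_blinfun\<rparr>"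

definition adjoint_group :: "('a::euclidean_space \<Rightarrow> 'a \<Rightarrow> 'a) \<Rightarrow> ('a \<Rightarrow>\<^sub>L 'a) set" where
  "adjoint_group br = connected_component_set (lie_automorphisms br) id_blinfun"

definition compact_subgroup ::
    "('a::euclidean_space \<Rightarrow> 'a \<Rightarrow> 'a) \<Rightarrow> ('a \<Rightarrow>\<^sub>L 'a) set \<Rightarrow> bool" where
  "compact_subgroup br K \<longleftrightarrow>
     subgroup K (Aut_group br) \<and> K \<subseteq> adjoint_group br \<and> compact K"

definition maximal_compact_subgroup ::
    "('a::euclidean_space \<Rightarrow> 'a \<Rightarrow> 'a) \<Rightarrow> ('a \<Rightarrow>\<^sub>L 'a) set \<Rightarrow> bool" where
  "maximal_compact_subgroup br K \<longleftrightarrow> compact_subgroup br K \<and>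
     (\<forall>K'. compact_subgroup br K' \<and> K \<subseteq> K' \<longrightarrow> K' = K)"

definition endo_exp :: "('a::euclidean_space \<Rightarrow> 'a) \<Rightarrow> 'a \<Rightarrow> 'a" where
  "endo_exp f v = (\<Sum>n. (1 / fact n) *\<^sub>R (f ^^ n) v)"

text \<open>
  The Lie algebra of a closed group \<open>K\<close> of automorphisms of a semisimple Lie algebra, regarded as a
  subalgebra of the latter through the isomorphism \<open>ad\<close> onto the algebra of derivations.
\<close>

definition lie_algebra_of ::
    "('a::euclidean_space \<Rightarrow> 'a \<Rightarrow> 'a) \<Rightarrow> ('a \<Rightarrow>\<^sub>L 'a) set \<Rightarrow> 'a set" where
  "lie_algebra_of br K =
     {x. \<forall>t::real. \<exists>F\<in>K. blinfun_apply F = endo_exp (\<lambda>v. t *\<^sub>R br x v)}"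

definition isotropy :: "('a::euclidean_space \<Rightarrow>\<^sub>L 'a) set \<Rightarrow> 'a \<Rightarrow> ('a \<Rightarrow>\<^sub>L 'a) set" where
  "isotropy K z = {F \<in> K. blinfun_apply F z = z}"

definition nilpotent_element ::
    "('a::euclidean_space \<Rightarrow> 'a \<Rightarrow> 'a) \<Rightarrow> 'a \<Rightarrow> bool" where
  "nilpotent_element br x \<longleftrightarrow> (\<exists>n. \<forall>v. (br x ^^ n) v = 0)"

definition nonzero_nilpotent_orbit ::
    "('a::euclidean_space \<Rightarrow> 'a \<Rightarrow> 'a) \<Rightarrow> 'a set \<Rightarrow> bool" where
  "nonzero_nilpotent_orbit br Orb \<longleftrightarrow>
     (\<exists>x. x \<noteq> 0 \<and> nilpotent_element br x \<and> Orb = (\<lambda>F. blinfun_apply F x) ` adjoint_group br)"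


section \<open>Complexification\<close>

text \<open>The pair \<open>(x, y)\<close> stands for \<open>x + \<i> y\<close> in the complexification.\<close>

definition cscale :: "complex \<Rightarrow> 'a::real_vector \<times> 'a \<Rightarrow> 'a \<times> 'a" where
  "cscale c p = (Re c *\<^sub>R fst p - Im c *\<^sub>R snd p, Re c *\<^sub>R snd p + Im c *\<^sub>R fst p)"

definition cbracket ::
    "('a::real_vector \<Rightarrow> 'a \<Rightarrow> 'a) \<Rightarrow> 'a \<times> 'a \<Rightarrow> 'a \<times> 'a \<Rightarrow> 'a \<times> 'a" where
  "cbracket br p q = (br (fst p) (fst q) - br (snd p) (snd q),
                      br (fst p) (snd q) + br (snd p) (fst q))"

definition cextend :: "('a \<Rightarrow> 'a) \<Rightarrow> 'a \<times> 'a \<Rightarrow> 'a \<times> 'a" where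
  "cextend f = map_prod f f"

definition of_gR :: "'a::real_vector \<Rightarrow> 'a \<times> 'a" where
  "of_gR x = (x, 0)"

definition complexify :: "'a set \<Rightarrow> ('a \<times> 'a) set" where
  "complexify S = S \<times> S"

definition defined_over_R :: "('a::real_vector \<times> 'a) set \<Rightarrow> bool" where
  "defined_over_R U \<longleftrightarrow> U = complexify {x. of_gR x \<in> U}"

lemma vector_space_cscale: "vector_space cscale"
  by unfold_locales (simp_all add: cscale_def algebra_simps prod_eq_iff)


section \<open>The Lie algebra sl(2,C)\<close>

typedef sl2 = "{A :: complex^2^2. trace A = 0}"
  morphisms mat_of Abs_sl2
  by (rule exI[of _ 0]) (simp add: trace_def)

setup_lifting type_definition_sl2

instantiation sl2 :: ab_group_add
begin

lift_definition zero_sl2 :: sl2 is 0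
  by (simp add: trace_def)

lift_definition plus_sl2 :: "sl2 \<Rightarrow> sl2 \<Rightarrow> sl2" is "(+)"
  by (simp add: trace_add)

lift_definition minus_sl2 :: "sl2 \<Rightarrow> sl2 \<Rightarrow> sl2" is "(-)"
  by (simp add: trace_sub)

lift_definition uminus_sl2 :: "sl2 \<Rightarrow> sl2" is uminus
  by (simp add: trace_def sum_negf)

instance
  by standard (transfer; simp)+

end

lift_definition sl2_scale :: "complex \<Rightarrow> sl2 \<Rightarrow> sl2" is "\<lambda>c A. \<chi> i j. c * A $ i $ j"
  by (simp add: trace_def flip: sum_distrib_left)

lift_definition sl2_bracket :: "sl2 \<Rightarrow> sl2 \<Rightarrow> sl2" is "\<lambda>A B. A ** B - B ** A"
  by (metis trace_sub trace_mul_sym diff_self)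

lift_definition sl2_theta :: "sl2 \<Rightarrow> sl2" is "\<lambda>A. - transpose A"
  by (simp add: trace_def transpose_def sum_negf)

lift_definition sl2_e :: sl2 is "vector [vector [0, 1], vector [0, 0]]"
  by (simp add: trace_def sum_2)

lift_definition sl2_h :: sl2 is "vector [vector [1, 0], vector [0, -1]]"
  by (simp add: trace_def sum_2)

definition sl2_real :: "sl2 set" where
  "sl2_real = {A. \<forall>i j. mat_of A $ i $ j \<in> \<real>}"

lemma vector_space_sl2_scale: "vector_space sl2_scale"
  by unfold_locales (transfer; simp add: vec_eq_iff algebra_simps)+


section \<open>Representations of sl(2,C) and isotypic subspaces\<close>

text \<open>
  A representation is an action \<open>\<rho>\<close> on (a subspace of) a type carrying the complex scalar
  multiplication \<open>sc\<close>.
\<close>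

definition sl2_submodule ::
    "(complex \<Rightarrow> 'v::ab_group_add \<Rightarrow> 'v) \<Rightarrow> (sl2 \<Rightarrow> 'v \<Rightarrow> 'v) \<Rightarrow> 'v set \<Rightarrow> bool" where
  "sl2_submodule sc \<rho> U \<longleftrightarrow> module.subspace sc U \<and> (\<forall>x. \<forall>u\<in>U. \<rho> x u \<in> U)"

definition sl2_irreducible ::
    "(complex \<Rightarrow> 'v::ab_group_add \<Rightarrow> 'v) \<Rightarrow> (sl2 \<Rightarrow> 'v \<Rightarrow> 'v) \<Rightarrow> 'v set \<Rightarrow> bool" where
  "sl2_irreducible sc \<rho> U \<longleftrightarrow> sl2_submodule sc \<rho> U \<and> U \<noteq> {0} \<and>
     (\<forall>W. sl2_submodule sc \<rho> W \<and> W \<subseteq> U \<longrightarrow> W = {0} \<or> W = U)"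

definition has_highest_weight ::
    "(complex \<Rightarrow> 'v::ab_group_add \<Rightarrow> 'v) \<Rightarrow> (sl2 \<Rightarrow> 'v \<Rightarrow> 'v) \<Rightarrow> 'v set \<Rightarrow> nat \<Rightarrow> bool" where
  "has_highest_weight sc \<rho> U r \<longleftrightarrow>
     (\<exists>v\<in>U. v \<noteq> 0 \<and> \<rho> sl2_e v = 0 \<and> \<rho> sl2_h v = sc (of_nat r) v)"

text \<open>The isotypic subspace of highest weight \<open>r\<close> in the submodule \<open>V\<close>.\<close>

definition isotypic ::
    "(complex \<Rightarrow> 'v::ab_group_add \<Rightarrow> 'v) \<Rightarrow> (sl2 \<Rightarrow> 'v \<Rightarrow> 'v) \<Rightarrow> 'v set \<Rightarrow> nat \<Rightarrow> 'v set" where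
  "isotypic sc \<rho> V r = module.span sc
     (\<Union>{U. U \<subseteq> V \<and> sl2_irreducible sc \<rho> U \<and> has_highest_weight sc \<rho> U r})"


section \<open>Linear maps from sl(2,C) to the complexified Lie algebra\<close>

definition Hom_s :: "('a::euclidean_space \<times> 'a) set \<Rightarrow> (sl2 \<Rightarrow> 'a \<times> 'a) set" where
  "Hom_s W = {\<Phi>. Vector_Spaces.linear sl2_scale cscale \<Phi> \<and> range \<Phi> \<subseteq> W}"

definition hom_scale ::
    "complex \<Rightarrow> (sl2 \<Rightarrow> 'a::real_vector \<times> 'a) \<Rightarrow> sl2 \<Rightarrow> 'a \<times> 'a" where
  "hom_scale c \<Phi> = (\<lambda>u. cscale c (\<Phi> u))"

lemma vector_space_hom_scale: "vector_space hom_scale"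
proof
  fix c c' :: complex and \<Phi> \<Psi> :: "sl2 \<Rightarrow> 'a \<times> 'a"
  note module = vector_space_cscale[unfolded vector_space_def]
  show "hom_scale c (\<Phi> + \<Psi>) = hom_scale c \<Phi> + hom_scale c \<Psi>"
    unfolding hom_scale_def fun_eq_iff plus_fun_apply using module by blast
  show "hom_scale (c + c') \<Phi> = hom_scale c \<Phi> + hom_scale c' \<Phi>"
    unfolding hom_scale_def fun_eq_iff plus_fun_apply using module by blast
  show "hom_scale c (hom_scale c' \<Phi>) = hom_scale (c * c') \<Phi>"
    unfolding hom_scale_def fun_eq_iff using module by blast
  show "hom_scale 1 \<Phi> = \<Phi>"
    unfolding hom_scale_def fun_eq_iff using module by blast
qed

definition Hom_theta :: "('a::euclidean_space \<Rightarrow> 'a) \<Rightarrow> (sl2 \<Rightarrow> 'a \<times> 'a) set" where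
  "Hom_theta \<theta> = {\<Phi> \<in> Hom_s UNIV. cextend \<theta> \<circ> \<Phi> = \<Phi> \<circ> sl2_theta}"

definition Mor_real_theta ::
    "('a::euclidean_space \<Rightarrow> 'a \<Rightarrow> 'a) \<Rightarrow> ('a \<Rightarrow> 'a) \<Rightarrow> (sl2 \<Rightarrow> 'a \<times> 'a) set" where
  "Mor_real_theta br \<theta> = {\<Phi> \<in> Hom_theta \<theta>. \<Phi> \<noteq> 0 \<and>
     (\<forall>x y. \<Phi> (sl2_bracket x y) = cbracket br (\<Phi> x) (\<Phi> y)) \<and>
     \<Phi> ` sl2_real \<subseteq> range of_gR}"

definition core ::
    "('a::euclidean_space \<Rightarrow> 'a \<Rightarrow> 'a) \<Rightarrow> ('a \<Rightarrow> 'a) \<Rightarrow> 'a set \<Rightarrow> 'a set" where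
  "core br \<theta> Orb = {z \<in> Orb. \<exists>\<Phi>\<in>Mor_real_theta br \<theta>. \<Phi> sl2_e = of_gR z}"

definition g_isotypic ::
    "('a::euclidean_space \<Rightarrow> 'a \<Rightarrow> 'a) \<Rightarrow> (sl2 \<Rightarrow> 'a \<times> 'a) \<Rightarrow> nat \<Rightarrow> ('a \<times> 'a) set" where
  "g_isotypic br \<Phi>0 r = isotypic cscale (\<lambda>x. cbracket br (\<Phi>0 x)) UNIV r"

definition diagonal_action ::
    "('a::euclidean_space \<Rightarrow> 'a \<Rightarrow> 'a) \<Rightarrow> (sl2 \<Rightarrow> 'a \<times> 'a) \<Rightarrow>
     sl2 \<Rightarrow> (sl2 \<Rightarrow> 'a \<times> 'a) \<Rightarrow> sl2 \<Rightarrow> 'a \<times> 'a" where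
  "diagonal_action br \<Phi>0 x \<Phi> = (\<lambda>u. cbracket br (\<Phi>0 x) (\<Phi> u) - \<Phi> (sl2_bracket x u))"

text \<open>\<open>Hom_theta_isotypic br \<theta> \<Phi>0 r r'\<close> is the space written
  \<open>Hom\<^sup>\<theta>(\<s>, \<g>(r))(r')\<close>.\<close>

definition Hom_theta_isotypic ::
    "('a::euclidean_space \<Rightarrow> 'a \<Rightarrow> 'a) \<Rightarrow> ('a \<Rightarrow> 'a) \<Rightarrow> (sl2 \<Rightarrow> 'a \<times> 'a) \<Rightarrow>
     nat \<Rightarrow> nat \<Rightarrow> (sl2 \<Rightarrow> 'a \<times> 'a) set" where
  "Hom_theta_isotypic br \<theta> \<Phi>0 r r' =
     isotypic hom_scale (diagonal_action br \<Phi>0) (Hom_s (g_isotypic br \<Phi>0 r)) r' \<inter> Hom_theta \<theta>"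

text \<open>
  The space \<open>\<d>(\<Phi>0)\<close>, as a sum of subspaces of the space of linear maps. That this sum is direct
  is a separate assertion, expressed by \<open>independent_subspaces\<close> below.
\<close>

definition d_space ::
    "('a::euclidean_space \<Rightarrow> 'a \<Rightarrow> 'a) \<Rightarrow> ('a \<Rightarrow> 'a) \<Rightarrow> (sl2 \<Rightarrow> 'a \<times> 'a) \<Rightarrow>
     (sl2 \<Rightarrow> 'a \<times> 'a) set" where
  "d_space br \<theta> \<Phi>0 =
     module.span hom_scale (\<Union>r\<in>{2..}. Hom_theta_isotypic br \<theta> \<Phi>0 r (r - 2))"

definition independent_subspaces :: "'i set \<Rightarrow> ('i \<Rightarrow> 'v::ab_group_add set) \<Rightarrow> bool" where
  "independent_subspaces I H \<longleftrightarrow>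
     (\<forall>J v. finite J \<and> J \<subseteq> I \<and> (\<forall>i\<in>J. v i \<in> H i) \<and> (\<Sum>i\<in>J. v i) = 0 \<longrightarrow> (\<forall>i\<in>J. v i = 0))"

text \<open>\<open>D\<close> is a complex linear complement to \<open>U\<close> in \<open>W\<close>.\<close>

definition linear_complement ::
    "('a::real_vector \<times> 'a) set \<Rightarrow> ('a \<times> 'a) set \<Rightarrow> ('a \<times> 'a) set \<Rightarrow> bool" where
  "linear_complement D U W \<longleftrightarrow> module.subspace cscale D \<and> D \<inter> U = {0} \<and>
     W = {d + u | d u. d \<in> D \<and> u \<in> U}"

end

(*
The Casimir operator C = H^2 + 2H + 4FE acts on an irreducible representation of highest weight r by
r(r + 2), and on a representation that is spanned by weight vectors with bounded integral weights the
isotypic subspaces are exactly the eigenspaces of C.  For g the weight decomposition comes from the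
positive definite form -B(x, theta y): E is nilpotent on the orthogonal complement of the integral
weight vectors, and the last non-zero power of E would produce another such vector there.

Write a = Phi(e).  For theta-equivariant Phi in Hom(s, g(r)) one has Phi(f) = - theta a, the Casimir
equation for the highest weight r - 2 expresses Phi(h) through Phi(e) and Phi(f), and what remains is
(H - r - 2)(H - r - 4) a = 4 E E theta a.  This gives injectivity and describes the image D.
If y is in p and in g(r), then E(H + r)y solves this equation while Hy is in k, so
r E y = E(H + r)y - E(Hy) shows D + [e, k] = [e, g].  If a = E kappa with kappa in k solves it, then
E kappa has weight r + 4 and must vanish, so D meets [e, k] only in 0.

An element of K normalizes k and preserves the Killing form, hence commutes with theta; if it fixes e,
it fixes f and h too.  So it preserves D, and so does complex conjugation.
*)

theory Submission
  imports Defs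
begin

section \<open>Eigenvectors and representations of an sl(2)-triple\<close>

text \<open>Isotypic subspaces are defined through irreducible submodules, whereas an eigenvalue
  equation of the Casimir operator can be written out at e, h and f. Complete reducibility is not
  presupposed: if vectors of bounded integral weight span, then E is nilpotent, and induction on the
  exponent diagonalizes the Casimir operator. The constant r + 2 comes from comparing eigenvalues.
  The Casimir operator of the diagonal action on Hom(s, g(r)) is that of g(r), plus that of s, which
  is 8, plus a mixed term. The eigenvalue (r - 2) r therefore makes the mixed term (r - 2) r - r (r
  + 2) - 8 = - 4 (r + 2). That D lies in [e, g] needs an argument of its own: the factors H - r - 2
  and H - r - 4 can be divided out modulo the image of E, because g(r) has no weight above r. The
  sum may start at r = 2 because E = 0 on g(0) and E (H + 1) = 0 on g(1).\<close>

lemma (in vector_space) sum_eigenvectors_eq_zero: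
  assumes T: "Vector_Spaces.linear scale scale T" and "finite J" and "inj_on c J"
    and "\<And>i. i \<in> J \<Longrightarrow> T (v i) = scale (c i) (v i)" and "(\<Sum>i\<in>J. v i) = 0"
  shows "\<forall>i\<in>J. v i = 0"
  using assms(2-)
proof (induction J arbitrary: v rule: finite_induct)
  case (insert j J)
  interpret T: Vector_Spaces.linear scale scale T by (rule T)
  \<comment> \<open>Applying T - c j to the relation kills v j and turns every other v i into w i,
    which is again an eigenvector for c i.\<close>
  let ?w = "\<lambda>i. scale (c i - c j) (v i)"
  have s: "v j + (\<Sum>i\<in>J. v i) = 0"
    using insert.prems insert.hyps by simp
  have "T (v j + (\<Sum>i\<in>J. v i)) = 0"
    by (simp add: s T.zero)
  then have "scale (c j) (v j) + (\<Sum>i\<in>J. scale (c i) (v i)) = 0"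
    using insert.prems by (simp add: T.add T.sum)
  moreover have "scale (c j) (v j) + (\<Sum>i\<in>J. scale (c j) (v i)) = 0"
    using arg_cong[OF s, of "scale (c j)"] by (simp add: scale_right_distrib scale_sum_right)
  ultimately have "(\<Sum>i\<in>J. ?w i) = 0"
    by (simp add: scale_left_diff_distrib sum_subtractf) (metis add_left_cancel)
  moreover have "T (?w i) = scale (c i) (?w i)" if "i \<in> J" for i
    using insert.prems that by (simp add: T.scale mult.commute)
  ultimately have "\<forall>i\<in>J. ?w i = 0"
    using insert.IH[of ?w] insert.prems by (simp add: inj_on_insert)
  moreover have "c i \<noteq> c j" if "i \<in> J" for i
    using insert.prems(1) insert.hyps that by (auto simp: inj_on_def)
  ultimately have "\<forall>i\<in>J. v i = 0" by auto
  then show ?case using s by simp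
qed simp

text \<open>The family v has its values in S i on all of I and is 0 off J, so that decompositions
  with different finite supports can be compared over the union of the supports.\<close>

lemma (in vector_space) span_UN_subspacesE:
  assumes S: "\<And>i. i \<in> I \<Longrightarrow> subspace (S i)" and "x \<in> span (\<Union>i\<in>I. S i)"
  obtains J v where "finite J" "J \<subseteq> I" "\<And>i. i \<in> I \<Longrightarrow> v i \<in> S i"
    "\<And>i. i \<notin> J \<Longrightarrow> v i = 0" "x = (\<Sum>i\<in>J. v i)"
proof -
  let ?P = "\<lambda>x. \<exists>J v. finite J \<and> J \<subseteq> I \<and> (\<forall>i\<in>I. v i \<in> S i) \<and> (\<forall>i. i \<notin> J \<longrightarrow> v i = 0) \<and> x = (\<Sum>i\<in>J. v i)"
  have "?P x"
    using assms(2)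
  proof (induction rule: span_induct_alt)
    case base
    show ?case
      by (rule exI[of _ "{}"], rule exI[of _ "\<lambda>_. 0"]) (auto intro: subspace_0 S)
  next
    case (step c x y)
    then obtain i where i: "i \<in> I" "x \<in> S i" by auto
    from step.IH obtain J v where v: "finite J" "J \<subseteq> I" "\<forall>i\<in>I. v i \<in> S i"
      "\<forall>i. i \<notin> J \<longrightarrow> v i = 0" "y = (\<Sum>i\<in>J. v i)" by blast
    let ?w = "v(i := scale c x + v i)"
    have "(\<Sum>k\<in>insert i J. ?w k) = scale c x + (\<Sum>k\<in>insert i J. v k)"
      using v(1) by (simp add: sum.insert_remove add.assoc)
    also have "(\<Sum>k\<in>insert i J. v k) = (\<Sum>k\<in>J. v k)"
      using v by (intro sum.mono_neutral_right) auto
    finally have "scale c x + y = (\<Sum>k\<in>insert i J. ?w k)" using v by simp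
    moreover have "\<forall>k\<in>I. ?w k \<in> S k"
      using v i by (auto intro!: subspace_add[OF S] subspace_scale[OF S])
    ultimately show ?case
      using v i by (intro exI[of _ "insert i J"] exI[of _ ?w]) auto
  qed
  then show ?thesis using that by blast
qed

text \<open>The subspaces S i may be smaller than the full eigenspaces. Applying T - a to a
  decomposition of x shows that only a component with c i = a survives, so x lies in that S i itself
  and not merely in an eigenspace.\<close>

lemma (in vector_space) eigenvector_in_span_eigenvectors:
  assumes T: "Vector_Spaces.linear scale scale T" and c: "inj_on c I"
    and S: "\<And>i. i \<in> I \<Longrightarrow> subspace (S i)" "\<And>i x. i \<in> I \<Longrightarrow> x \<in> S i \<Longrightarrow> T x = scale (c i) x"
    and x: "x \<in> span (\<Union>i\<in>I. S i)" "T x = scale a x" "x \<noteq> 0"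
  obtains i where "i \<in> I" "c i = a" "x \<in> S i"
proof -
  interpret T: Vector_Spaces.linear scale scale T by (rule T)
  obtain J v where v: "finite J" "J \<subseteq> I" "\<And>i. i \<in> I \<Longrightarrow> v i \<in> S i" "x = (\<Sum>i\<in>J. v i)"
    using span_UN_subspacesE[OF S(1) x(1)] by metis
  let ?w = "\<lambda>i. scale (c i - a) (v i)"
  have Tv: "T (v i) = scale (c i) (v i)" if "i \<in> J" for i
    using S(2) v that by blast
  have "(\<Sum>i\<in>J. ?w i) = T x - scale a x"
    unfolding v(4) T.sum scale_sum_right sum_subtractf[symmetric]
    by (intro sum.cong) (auto simp: Tv scale_left_diff_distrib)
  then have "\<forall>i\<in>J. ?w i = 0"
    using v(2) inj_on_subset[OF c v(2)] x(2)
    by (intro sum_eigenvectors_eq_zero[OF T v(1)]) (auto simp: T.scale Tv mult.commute)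
  then have z: "\<forall>i\<in>J. c i \<noteq> a \<longrightarrow> v i = 0" by auto
  have "\<exists>i\<in>J. v i \<noteq> 0" using x(3) v(4) by (metis sum.neutral)
  then obtain i where i: "i \<in> J" "v i \<noteq> 0" by blast
  then have ci: "c i = a" using z by blast
  have "\<forall>k\<in>J - {i}. v k = 0"
    using z ci inj_on_subset[OF c v(2)] i(1) by (auto simp: inj_on_def)
  then have "x = v i"
    using v(1,4) i(1) by (simp add: sum.remove)
  then show ?thesis using that ci i v by blast
qed

text \<open>The bound M on the weights takes the place of finite dimension. The relations are
  demanded on V only: the diagonal action satisfies them on linear maps, but not on the arbitrary
  functions on s that make up the ambient type.\<close>

locale sl2_triple = vector_space sc +
  E: Vector_Spaces.linear sc sc E + F: Vector_Spaces.linear sc sc F + H: Vector_Spaces.linear sc sc H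
  for sc :: "complex \<Rightarrow> 'v::ab_group_add \<Rightarrow> 'v" and E F H +
  fixes V :: "'v set" and M :: nat
  assumes V: "subspace V"
    and E_V: "x \<in> V \<Longrightarrow> E x \<in> V" and F_V: "x \<in> V \<Longrightarrow> F x \<in> V" and H_V: "x \<in> V \<Longrightarrow> H x \<in> V"
    and HE: "x \<in> V \<Longrightarrow> H (E x) = E (H x) + sc 2 (E x)"
    and HF: "x \<in> V \<Longrightarrow> H (F x) = F (H x) - sc 2 (F x)"
    and EF: "x \<in> V \<Longrightarrow> E (F x) = F (E x) + H x"
    and weights: "V \<subseteq> span {x\<in>V. \<exists>m::int. \<bar>m\<bar> \<le> int M \<and> H x = sc (of_int m) x}"
begin

lemmas EFH_simps = E.add E.diff E.neg E.scale E.zero F.add F.diff F.neg F.scale F.zero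
  H.add H.diff H.neg H.scale H.zero

text \<open>The symmetry that reverses the sign of all weights. It turns statements about highest
  weights into statements about lowest weights.\<close>

lemma swap: "sl2_triple sc F E (\<lambda>x. - H x) V M"
proof -
  have "Vector_Spaces.linear sc sc (\<lambda>x. - H x)"
    by unfold_locales (simp_all add: EFH_simps)
  moreover have "{x\<in>V. \<exists>m::int. \<bar>m\<bar> \<le> int M \<and> H x = sc (of_int m) x} \<subseteq>
      {x\<in>V. \<exists>m::int. \<bar>m\<bar> \<le> int M \<and> - H x = sc (of_int m) x}"
    by (auto intro!: exI[of _ "- m" for m])
  then have "V \<subseteq> span {x\<in>V. \<exists>m::int. \<bar>m\<bar> \<le> int M \<and> - H x = sc (of_int m) x}"
    using weights span_mono by blast
  ultimately show ?thesis
    by (intro sl2_triple.intro sl2_triple_axioms.intro vector_space_axioms E.linear_axioms F.linear_axioms V E_V F_V)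
      (auto simp: HE HF EF H_V EFH_simps intro: subspace_neg[OF V])
qed

section \<open>The Casimir operator and weight spaces\<close>

definition casimir :: "'v \<Rightarrow> 'v" where
  "casimir x = H (H x) + sc 2 (H x) + sc 4 (F (E x))"

lemma linear_casimir: "Vector_Spaces.linear sc sc casimir"
  by unfold_locales (simp_all add: casimir_def EFH_simps algebra_simps scale_right_distrib)

sublocale C: Vector_Spaces.linear sc sc casimir by (rule linear_casimir)

lemmas V_closed = E_V F_V H_V subspace_add[OF V] subspace_diff[OF V] subspace_neg[OF V]
  subspace_scale[OF V] subspace_0[OF V]

lemma casimir_V: "x \<in> V \<Longrightarrow> casimir x \<in> V"
  by (simp add: casimir_def V_closed)

text \<open>EF = FE + H gives this form, suited to lowest weight vectors. Using one form on each
  side of \<open>casimir_E\<close> and \<open>casimir_F\<close> means that only H has to be commuted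
  past E or F.\<close>

lemma casimir_alt: "x \<in> V \<Longrightarrow> casimir x = H (H x) - sc 2 (H x) + sc 4 (E (F x))"
  using scale_left_diff_distrib[of 4 2 "H x"] by (simp add: casimir_def EF scale_right_distrib)

lemma casimir_H: "x \<in> V \<Longrightarrow> casimir (H x) = H (casimir x)"
  by (simp add: casimir_def EFH_simps HE HF V_closed)

lemma casimir_E: assumes "x \<in> V" shows "casimir (E x) = E (casimir x)"
proof -
  have "casimir (E x) = H (H (E x)) - sc 2 (H (E x)) + sc 4 (E (F (E x)))"
    using assms by (simp add: casimir_alt V_closed)
  also have "\<dots> = E (H (H x)) + sc 2 (E (H x)) + sc 4 (E (F (E x)))"
    using assms by (simp add: HE EFH_simps V_closed scale_right_distrib)
  finally show ?thesis by (simp add: casimir_def EFH_simps)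
qed

lemma casimir_F: assumes "x \<in> V" shows "casimir (F x) = F (casimir x)"
proof -
  have "casimir (F x) = H (H (F x)) + sc 2 (H (F x)) + sc 4 (F (E (F x)))"
    by (simp add: casimir_def)
  also have "\<dots> = F (H (H x)) - sc 2 (F (H x)) + sc 4 (F (E (F x)))"
    using assms by (simp add: HF EFH_simps V_closed scale_right_diff_distrib)
  finally show ?thesis using assms by (simp add: casimir_alt EFH_simps)
qed

definition weight_space :: "int \<Rightarrow> 'v set" where
  "weight_space m = {x \<in> V. H x = sc (of_int m) x}"

definition casimir_space :: "nat \<Rightarrow> 'v set" where
  "casimir_space s = {x \<in> V. casimir x = sc (of_nat (s * (s + 2))) x}"

lemma subspace_eigenspace:
  "Vector_Spaces.linear sc sc T \<Longrightarrow> subspace {x \<in> V. T x = sc a x}"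
  by (auto simp: subspace_def V_closed Vector_Spaces.linear_def module_hom_iff module_hom.zero
      scale_right_distrib mult.commute)

lemma subspace_weight_space: "subspace (weight_space m)"
  unfolding weight_space_def by (rule subspace_eigenspace) (rule H.linear_axioms)

lemma subspace_casimir_space: "subspace (casimir_space s)"
  unfolding casimir_space_def by (rule subspace_eigenspace) (rule linear_casimir)

lemma E_weight: "x \<in> weight_space m \<Longrightarrow> E x \<in> weight_space (m + 2)"
  by (simp add: weight_space_def HE E_V EFH_simps scale_left_distrib)

lemma F_weight: "x \<in> weight_space m \<Longrightarrow> F x \<in> weight_space (m - 2)"
  by (simp add: weight_space_def HF F_V EFH_simps scale_left_diff_distrib)

lemma E_pow_weight: "x \<in> weight_space m \<Longrightarrow> (E ^^ k) x \<in> weight_space (m + 2 * int k)"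
proof (induction k)
  case (Suc k)
  then show ?case using E_weight[OF Suc.IH] by (simp add: algebra_simps)
qed simp

lemma F_pow_weight: "x \<in> weight_space m \<Longrightarrow> (F ^^ k) x \<in> weight_space (m - 2 * int k)"
proof (induction k)
  case (Suc k)
  then show ?case using F_weight[OF Suc.IH] by (simp add: algebra_simps)
qed simp

lemma E_casimir: "x \<in> casimir_space s \<Longrightarrow> E x \<in> casimir_space s"
  by (simp add: casimir_space_def casimir_E E_V EFH_simps)

lemma F_casimir: "x \<in> casimir_space s \<Longrightarrow> F x \<in> casimir_space s"
  by (simp add: casimir_space_def casimir_F F_V EFH_simps)

lemma H_casimir: "x \<in> casimir_space s \<Longrightarrow> H x \<in> casimir_space s"
  by (simp add: casimir_space_def casimir_H H_V EFH_simps)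

lemma E_pow_casimir: "x \<in> casimir_space s \<Longrightarrow> (E ^^ k) x \<in> casimir_space s"
  by (induction k) (auto intro: E_casimir)

lemma F_pow_casimir: "x \<in> casimir_space s \<Longrightarrow> (F ^^ k) x \<in> casimir_space s"
  by (induction k) (auto intro: F_casimir)

text \<open>The hypothesis \<open>weights\<close> concerns a spanning set only; the independence of
  eigenvectors extends the bound to every weight that occurs.\<close>

lemma weight_space_bounded:
  assumes "x \<in> weight_space m" "x \<noteq> 0" shows "\<bar>m\<bar> \<le> int M"
proof -
  have "{x\<in>V. \<exists>m::int. \<bar>m\<bar> \<le> int M \<and> H x = sc (of_int m) x} = (\<Union>m\<in>{m. \<bar>m\<bar> \<le> int M}. weight_space m)"
    by (auto simp: weight_space_def)
  then have "x \<in> span (\<Union>m\<in>{m. \<bar>m\<bar> \<le> int M}. weight_space m)"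
    using weights assms by (auto simp: weight_space_def)
  moreover have "inj_on (of_int :: int \<Rightarrow> complex) {m. \<bar>m\<bar> \<le> int M}" by (simp add: inj_on_def)
  moreover have "H x = sc (of_int m) x" using assms by (simp add: weight_space_def)
  moreover have "H y = sc (of_int i) y" if "y \<in> weight_space i" for y i
    using that by (simp add: weight_space_def)
  ultimately obtain i where "\<bar>i\<bar> \<le> int M" "(of_int i :: complex) = of_int m"
    using eigenvector_in_span_eigenvectors[OF H.linear_axioms, of of_int "{m. \<bar>m\<bar> \<le> int M}" weight_space x "of_int m"]
      assms(2) subspace_weight_space by (metis mem_Collect_eq)
  then show ?thesis by simp
qed

lemma V_eq_span_weight_spaces: "V = span (\<Union>m. weight_space m)"
proof
  show "V \<subseteq> span (\<Union>m. weight_space m)"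
    by (rule order_trans[OF weights], rule span_mono) (auto simp: weight_space_def)
  show "span (\<Union>m. weight_space m) \<subseteq> V"
    by (rule span_minimal[OF _ V]) (auto simp: weight_space_def)
qed

lemma linear_funpow:
  "Vector_Spaces.linear sc sc T \<Longrightarrow> Vector_Spaces.linear sc sc (T ^^ k)"
proof (induction k)
  case 0
  show ?case using linear_id by (simp add: id_def)
next
  case (Suc k)
  then have "Vector_Spaces.linear sc sc (T \<circ> T ^^ k)" using Vector_Spaces.linear_compose[of sc sc "T ^^ k" sc T] by auto
  then show ?case by (simp only: funpow.simps)
qed

lemma E_nilpotent: assumes "x \<in> V" shows "(E ^^ Suc M) x = 0"
proof -
  interpret P: Vector_Spaces.linear sc sc "E ^^ Suc M"
    by (rule linear_funpow[OF E.linear_axioms])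
  have "(E ^^ Suc M) x = 0" if x: "x \<in> weight_space m" for x m
  proof (rule ccontr)
    assume nz: "(E ^^ Suc M) x \<noteq> 0"
    then have "x \<noteq> 0" using P.zero by auto
    then have "\<bar>m\<bar> \<le> int M" using weight_space_bounded x by blast
    \<comment> \<open>From any weight \<ge> - M, as many as M + 1 steps of size 2 lead beyond
      M.\<close>
    moreover have "\<bar>m + 2 * int (Suc M)\<bar> \<le> int M"
      using weight_space_bounded E_pow_weight[OF x] nz by blast
    ultimately show False by auto
  qed
  then have "(\<Union>m. weight_space m) \<subseteq> {x. (E ^^ Suc M) x = 0}" by blast
  then have "span (\<Union>m. weight_space m) \<subseteq> {x. (E ^^ Suc M) x = 0}"
    by (rule span_minimal) (auto simp: subspace_def P.zero P.add P.scale simp del: funpow.simps)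
  then show ?thesis using assms V_eq_span_weight_spaces by blast
qed

lemma highest_vector_power:
  assumes "x \<in> V" "x \<noteq> 0"
  obtains k where "(E ^^ k) x \<noteq> 0" "E ((E ^^ k) x) = 0"
proof -
  have ex: "\<exists>k. (E ^^ k) x = 0" using E_nilpotent assms by blast
  define n where "n = (LEAST k. (E ^^ k) x = 0)"
  have n: "(E ^^ n) x = 0" unfolding n_def using ex by (rule LeastI_ex)
  then obtain k where k: "n = Suc k" using assms by (cases n) auto
  then have "k < (LEAST k. (E ^^ k) x = 0)" by (simp flip: n_def)
  then have "(E ^^ k) x \<noteq> 0" by (rule not_less_Least)
  then show ?thesis using that n k by simp
qed

lemma casimir_highest:
  "x \<in> weight_space m \<Longrightarrow> E x = 0 \<Longrightarrow> casimir x = sc (of_int (m * (m + 2))) x"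
  by (simp add: casimir_def weight_space_def EFH_simps algebra_simps scale_left_distrib)

text \<open>Raise x until E kills it. The resulting weight n \<ge> m satisfies n (n + 2) = s (s +
  2), and t (t + 2) is strictly increasing for t \<ge> 0, so n > s is impossible.\<close>

lemma casimir_weight_bound:
  assumes x: "x \<in> weight_space m" "x \<in> casimir_space s" "x \<noteq> 0"
  shows "m \<le> int s"
proof (rule ccontr)
  assume "\<not> m \<le> int s"
  obtain k where k: "(E ^^ k) x \<noteq> 0" "E ((E ^^ k) x) = 0"
    using highest_vector_power x by (auto simp: weight_space_def)
  let ?n = "m + 2 * int k"
  have "casimir ((E ^^ k) x) = sc (of_int (?n * (?n + 2))) ((E ^^ k) x)"
    using casimir_highest E_pow_weight k x by blast
  moreover have "casimir ((E ^^ k) x) = sc (of_nat (s * (s + 2))) ((E ^^ k) x)"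
    using E_pow_casimir x unfolding casimir_space_def by blast
  ultimately have "(of_int (?n * (?n + 2)) :: complex) = of_nat (s * (s + 2))"
    using k scale_right_imp_eq by metis
  also have "(of_nat (s * (s + 2)) :: complex) = of_int (int s * (int s + 2))"
    by (simp add: algebra_simps)
  finally have "(of_int (?n * (?n + 2)) :: complex) = of_int (int s * (int s + 2))" .
  then have "?n * (?n + 2) = int s * (int s + 2)" by (simp only: of_int_eq_iff)
  moreover have "int s * (int s + 2) < ?n * (?n + 2)"
    using \<open>\<not> m \<le> int s\<close> by (intro mult_strict_mono) auto
  ultimately show False by simp
qed

section \<open>Diagonalization of the Casimir operator\<close>

text \<open>Induction on n. If E^(n+1) x = 0, then E^n x is zero or a highest weight vector of
  weight m + 2n, so E^n kills (C - c n) x, and the induction hypothesis splits this vector into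
  eigenvectors for c i with i < n. On their span C - c n is invertible; subtracting the preimage
  from x leaves an eigenvector for c n. The condition m \<ge> 0 makes the c i strictly
  increasing.\<close>

lemma weight_vector_in_span_nonneg:
  assumes "m \<ge> 0" "x \<in> weight_space m" "(E ^^ n) x = 0"
  shows "x \<in> span {y \<in> weight_space m. \<exists>i<n. casimir y = sc (of_int ((m + 2 * int i) * (m + 2 * int i + 2))) y}"
  using assms
proof (induction n arbitrary: x)
  case 0
  then show ?case by (simp add: span_zero)
next
  case (Suc n)
  define c :: "nat \<Rightarrow> int" where "c i = (m + 2 * int i) * (m + 2 * int i + 2)" for i
  let ?A = "\<lambda>n. {y \<in> weight_space m. \<exists>i<n. casimir y = sc (of_int (c i)) y}"
  have xV: "x \<in> V" using Suc.prems by (auto simp: weight_space_def)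
  interpret P: Vector_Spaces.linear sc sc "E ^^ n" by (rule linear_funpow[OF E.linear_axioms])
  let ?w = "casimir x - sc (of_int (c n)) x"
  have pow_C: "(E ^^ k) (casimir x) = casimir ((E ^^ k) x) \<and> (E ^^ k) x \<in> V" for k
    using xV by (induction k) (auto simp: casimir_E E_V)
  have w_wt: "?w \<in> weight_space m"
    using Suc.prems xV
    by (simp add: weight_space_def V_closed casimir_V EFH_simps scale_right_diff_distrib mult.commute
        C.scale flip: casimir_H)
  have "E ((E ^^ n) x) = 0" using Suc.prems by simp
  then have "casimir ((E ^^ n) x) = sc (of_int (c n)) ((E ^^ n) x)"
    using casimir_highest[OF E_pow_weight] Suc.prems unfolding c_def by blast
  then have "(E ^^ n) ?w = 0"
    using pow_C by (simp add: P.diff P.scale)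
  then have "?w \<in> span (?A n)" using Suc.IH[OF Suc.prems(1) w_wt] unfolding c_def by blast
  moreover have "\<exists>z \<in> span (?A n). casimir z - sc (of_int (c n)) z = y" if "y \<in> span (?A n)" for y
    using that
  proof (induction rule: span_induct_alt)
    case base
    show ?case by (intro bexI[of _ 0]) (auto simp: span_zero C.zero)
  next
    case (step a y y')
    then obtain i z where i: "i < n" "casimir y = sc (of_int (c i)) y"
      and z: "z \<in> span (?A n)" "casimir z - sc (of_int (c n)) z = y'" by auto
    have "c i < c n"
      unfolding c_def using Suc.prems(1) i(1) by (intro mult_strict_mono) auto
    then have ne: "of_int (c i) - of_int (c n) \<noteq> (0::complex)" by simp
    let ?b = "a / (of_int (c i) - of_int (c n))"
    have "sc ?b y + z \<in> span (?A n)"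
      using span_add[OF span_scale[OF span_base[OF step(1)]] z(1)] .
    moreover have "casimir (sc ?b y + z) - sc (of_int (c n)) (sc ?b y + z)
        = sc (?b * (of_int (c i) - of_int (c n))) y + y'"
      unfolding z(2)[symmetric] right_diff_distrib scale_left_diff_distrib
      using i by (simp add: C.add C.scale scale_right_distrib mult.commute)
    moreover have "?b * (of_int (c i) - of_int (c n)) = a" using ne by simp
    ultimately show ?case by (intro bexI[of _ "sc ?b y + z"]) (simp_all only:)
  qed
  ultimately obtain z where z: "z \<in> span (?A n)" "casimir z - sc (of_int (c n)) z = ?w" by blast
  have mono: "span (?A n) \<subseteq> span (?A (Suc n))" by (rule span_mono) (auto intro: less_SucI)
  have "span (?A n) \<subseteq> weight_space m"
    by (rule span_minimal) (auto simp: subspace_weight_space)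
  then have "x - z \<in> weight_space m"
    using z Suc.prems subspace_diff[OF subspace_weight_space] by blast
  moreover have "casimir (x - z) = sc (of_int (c n)) (x - z)"
    using z(2) by (simp add: C.diff scale_right_diff_distrib algebra_simps)
  ultimately have "x - z \<in> span (?A (Suc n))"
    by (intro span_base) auto
  then have "(x - z) + z \<in> span (?A (Suc n))" using z mono by (blast intro: span_add)
  then show ?case by (simp add: c_def)
qed

text \<open>The vectors whose weight \<open>m\<close> occurs in an irreducible representation of highest weight \<open>s\<close>.\<close>

definition string_vectors :: "'v set" where
  "string_vectors = {y. \<exists>m s k. y \<in> weight_space m \<and> y \<in> casimir_space s \<and>
     \<bar>m\<bar> \<le> int s \<and> int s = m + 2 * int k}"

lemma weight_vector_in_span_nonneg':
  assumes "m \<ge> 0" "x \<in> weight_space m"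
  shows "x \<in> span string_vectors"
proof -
  have "(E ^^ Suc M) x = 0" using assms E_nilpotent by (auto simp: weight_space_def)
  note weight_vector_in_span_nonneg[OF assms this]
  moreover have "{y \<in> weight_space m. \<exists>i<Suc M. casimir y = sc (of_int ((m + 2 * int i) * (m + 2 * int i + 2))) y}
    \<subseteq> string_vectors"
  proof clarify
    fix y i assume y: "y \<in> weight_space m" "casimir y = sc (of_int ((m + 2 * int i) * (m + 2 * int i + 2))) y"
    define s where "s = nat (m + 2 * int i)"
    have s: "int s = m + 2 * int i" using assms by (simp add: s_def)
    have "(of_nat (s * (s + 2)) :: complex) = of_int (int s * (int s + 2))"
      by (simp add: algebra_simps)
    then have "casimir y = sc (of_nat (s * (s + 2))) y"
      unfolding s by (simp only: y(2))
    moreover have "y \<in> V" using y(1) by (simp add: weight_space_def)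
    ultimately have "y \<in> casimir_space s" unfolding casimir_space_def by blast
    then show "y \<in> string_vectors"
      using y(1) s assms(1) unfolding string_vectors_def by (intro CollectI exI conjI) auto
  qed
  ultimately show ?thesis using span_mono[of _ string_vectors] by (meson subsetD)
qed

lemma swap_casimir: "x \<in> V \<Longrightarrow> sl2_triple.casimir sc F E (\<lambda>x. - H x) x = casimir x"
  by (simp add: sl2_triple.casimir_def[OF swap] casimir_alt EFH_simps)

lemma swap_casimir_space: "sl2_triple.casimir_space sc F E (\<lambda>x. - H x) V s = casimir_space s"
  by (auto simp: sl2_triple.casimir_space_def[OF swap] casimir_space_def swap_casimir)

lemma swap_weight_space: "sl2_triple.weight_space sc (\<lambda>x. - H x) V m = weight_space (- m)"
  by (simp add: sl2_triple.weight_space_def[OF swap] weight_space_def)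
    (metis minus_equation_iff)

lemma casimir_weight_abs_bound:
  assumes "x \<in> weight_space m" "x \<in> casimir_space s" "x \<noteq> 0"
  shows "\<bar>m\<bar> \<le> int s"
  using casimir_weight_bound[OF assms] sl2_triple.casimir_weight_bound[OF swap, of x "- m" s] assms
  by (simp add: swap_casimir_space swap_weight_space)

lemma swap_string_vectors:
  "sl2_triple.string_vectors sc F E (\<lambda>x. - H x) V = string_vectors"
proof -
  have *: "(\<exists>k. int s = m + 2 * int k) \<longleftrightarrow> (\<exists>k. int s = - m + 2 * int k)" if "\<bar>m\<bar> \<le> int s" for m s
  proof
    assume "\<exists>k. int s = m + 2 * int k"
    then obtain k where "int s = m + 2 * int k" ..
    \<comment> \<open>If m lies k steps below s, then - m lies s - k steps below s. The bound on m
      gives k \<le> s, so the natural subtraction is exact.\<close>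
    then have "int s = - m + 2 * int (s - k)" using that by (simp add: of_nat_diff)
    then show "\<exists>k. int s = - m + 2 * int k" ..
  next
    assume "\<exists>k. int s = - m + 2 * int k"
    then obtain k where "int s = - m + 2 * int k" ..
    then have "int s = m + 2 * int (s - k)" using that by (simp add: of_nat_diff)
    then show "\<exists>k. int s = m + 2 * int k" ..
  qed
  have "y \<in> sl2_triple.string_vectors sc F E (\<lambda>x. - H x) V \<longleftrightarrow>
      (\<exists>m s. y \<in> weight_space (- m) \<and> y \<in> casimir_space s \<and> \<bar>m\<bar> \<le> int s \<and> (\<exists>k. int s = m + 2 * int k))" for y
    by (simp add: sl2_triple.string_vectors_def[OF swap] swap_casimir_space swap_weight_space)
  also have "\<dots> y \<longleftrightarrow> (\<exists>m s. y \<in> weight_space (- m) \<and> y \<in> casimir_space s \<and> \<bar>- m\<bar> \<le> int s \<and>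
      (\<exists>k. int s = - m + 2 * int k))" for y
    using * by (intro ex_cong1) (simp only: abs_minus_cancel, blast)
  also have "\<dots> y \<longleftrightarrow> (\<exists>m s. y \<in> weight_space m \<and> y \<in> casimir_space s \<and> \<bar>m\<bar> \<le> int s \<and>
      (\<exists>k. int s = m + 2 * int k))" for y
    by (metis minus_minus)
  finally show ?thesis by (simp add: string_vectors_def set_eq_iff)
qed

lemma V_subset_span_string_vectors: "V \<subseteq> span string_vectors"
proof -
  have "weight_space m \<subseteq> span string_vectors" for m
  proof (cases "m \<ge> 0")
    case False
    then show ?thesis
      using sl2_triple.weight_vector_in_span_nonneg'[OF swap, of "- m"]
      by (auto simp: swap_weight_space swap_string_vectors)
  qed (auto intro: weight_vector_in_span_nonneg')
  then show ?thesis
    by (subst V_eq_span_weight_spaces) (intro span_minimal, auto)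
qed

lemma inj_casimir_eigenvalue: "inj (\<lambda>s::nat. of_nat (s * (s + 2)) :: complex)"
proof (rule injI)
  fix s t :: nat assume "(of_nat (s * (s + 2)) :: complex) = of_nat (t * (t + 2))"
  then have "s * (s + 2) = t * (t + 2)" by (simp only: of_nat_eq_iff)
  then have "\<not> s < t" "\<not> t < s"
    using mult_strict_mono[of s t "s + 2" "t + 2"] mult_strict_mono[of t s "t + 2" "s + 2"] by auto
  then show "s = t" by simp
qed

lemma V_eq_span_casimir_spaces: "V = span (\<Union>s. casimir_space s)"
proof
  show "V \<subseteq> span (\<Union>s. casimir_space s)"
    by (rule order_trans[OF V_subset_span_string_vectors], rule span_mono) (auto simp: string_vectors_def)
  show "span (\<Union>s. casimir_space s) \<subseteq> V"
    by (rule span_minimal[OF _ V]) (auto simp: casimir_space_def)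
qed

text \<open>The spans of the string vectors with a fixed Casimir eigenvalue together span V. Taking
  them as the subspaces in \<open>eigenvector_in_span_eigenvectors\<close> places x in the one that
  belongs to r.\<close>

lemma casimir_space_in_span:
  assumes "x \<in> casimir_space r"
  shows "x \<in> span (string_vectors \<inter> casimir_space r)"
proof (cases "x = 0")
  case False
  let ?S = "\<lambda>s. span (string_vectors \<inter> casimir_space s)"
  have S: "?S s \<subseteq> casimir_space s" for s
    by (rule span_minimal) (auto simp: subspace_casimir_space)
  have "string_vectors \<subseteq> (\<Union>s. ?S s)"
    unfolding string_vectors_def by (blast intro: span_base)
  moreover have "x \<in> V" using assms by (simp add: casimir_space_def)
  ultimately have "x \<in> span (\<Union>s. ?S s)"
    using V_subset_span_string_vectors span_mono by blast
  moreover have "casimir x = sc (of_nat (r * (r + 2))) x" using assms by (simp add: casimir_space_def)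
  moreover have "casimir y = sc (of_nat (s * (s + 2))) y" if "y \<in> ?S s" for y s
    using that S by (auto simp: casimir_space_def)
  ultimately obtain s where "(of_nat (s * (s + 2)) :: complex) = of_nat (r * (r + 2))" "x \<in> ?S s"
    using eigenvector_in_span_eigenvectors[OF linear_casimir inj_casimir_eigenvalue, of ?S x "of_nat (r * (r + 2))"]
      False subspace_span by metis
  then show ?thesis using injD[OF inj_casimir_eigenvalue] by blast
qed (simp add: span_zero)

lemma casimir_space_in_span_weights:
  assumes "x \<in> casimir_space r"
  shows "x \<in> span (\<Union>m\<in>{m. \<bar>m\<bar> \<le> int r}. weight_space m \<inter> casimir_space r)"
proof -
  have "string_vectors \<inter> casimir_space r \<subseteq>
      span (\<Union>m\<in>{m. \<bar>m\<bar> \<le> int r}. weight_space m \<inter> casimir_space r)"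
  proof
    fix y assume y: "y \<in> string_vectors \<inter> casimir_space r"
    show "y \<in> span (\<Union>m\<in>{m. \<bar>m\<bar> \<le> int r}. weight_space m \<inter> casimir_space r)"
    proof (cases "y = 0")
      case False
      with y obtain m where "y \<in> weight_space m" "y \<in> casimir_space r"
        by (auto simp: string_vectors_def)
      then show ?thesis using False casimir_weight_abs_bound by (blast intro: span_base)
    qed (simp add: span_zero)
  qed
  then have "span (string_vectors \<inter> casimir_space r) \<subseteq>
      span (\<Union>m\<in>{m. \<bar>m\<bar> \<le> int r}. weight_space m \<inter> casimir_space r)"
    by (rule span_minimal) simp
  then show ?thesis using casimir_space_in_span[OF assms] by blast
qed

text \<open>Each form of the Casimir operator can be solved for its product of E and F. For m = s -
  2i the scalar is (i + 1)(s - i), the usual structure constant of the string v, F v, ..., F^s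
  v.\<close>

lemma EF_scalar:
  assumes "x \<in> weight_space m" "x \<in> casimir_space s"
  shows "E (F x) = sc (of_int ((int s + m) * (int s + 2 - m)) / 4) x"
proof -
  have "sc 4 (E (F x)) = casimir x - H (H x) + sc 2 (H x)"
    using assms by (simp add: casimir_alt weight_space_def)
  also have "\<dots> = sc (of_int ((int s + m) * (int s + 2 - m))) x"
    using assms by (simp add: weight_space_def casimir_space_def EFH_simps algebra_simps
        scale_left_distrib scale_left_diff_distrib)
  finally have "sc (1 / 4) (sc 4 (E (F x))) = sc (1 / 4) (sc (of_int ((int s + m) * (int s + 2 - m))) x)"
    by simp
  then show ?thesis by simp
qed

lemma FE_scalar:
  assumes "x \<in> weight_space m" "x \<in> casimir_space s"
  shows "F (E x) = sc (of_int ((int s - m) * (int s + 2 + m)) / 4) x"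
proof -
  have "sc 4 (F (E x)) = casimir x - H (H x) - sc 2 (H x)"
    by (simp add: casimir_def)
  also have "\<dots> = sc (of_int ((int s - m) * (int s + 2 + m))) x"
    using assms by (simp add: weight_space_def casimir_space_def EFH_simps algebra_simps
        scale_left_distrib scale_left_diff_distrib)
  finally have "sc (1 / 4) (sc 4 (F (E x))) = sc (1 / 4) (sc (of_int ((int s - m) * (int s + 2 + m))) x)"
    by simp
  then show ?thesis by simp
qed

text \<open>On the way up every weight n that is left satisfies - s \<le> n < s, where the scalar of
  FE is nonzero. So going up and down again multiplies x by a nonzero number.\<close>

lemma F_pow_E_pow:
  assumes "x \<in> weight_space m" "x \<in> casimir_space s" "\<bar>m\<bar> \<le> int s" "m + 2 * int k \<le> int s"
  shows "\<exists>c. x = sc c ((F ^^ k) ((E ^^ k) x))"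
  using assms(4)
proof (induction k)
  case 0
  show ?case by (rule exI[of _ 1]) simp
next
  case (Suc k)
  then obtain c where c: "x = sc c ((F ^^ k) ((E ^^ k) x))" by auto
  interpret P: Vector_Spaces.linear sc sc "F ^^ k" by (rule linear_funpow[OF F.linear_axioms])
  let ?n = "m + 2 * int k"
  let ?d = "of_int ((int s - ?n) * (int s + 2 + ?n)) / (4 :: complex)"
  have "F (E ((E ^^ k) x)) = sc ?d ((E ^^ k) x)"
    using FE_scalar[OF E_pow_weight E_pow_casimir] assms by blast
  moreover have "?d \<noteq> 0"
    using Suc.prems assms(3) by (simp del: of_int_mult of_int_diff of_int_add)
  ultimately have "(E ^^ k) x = sc (1 / ?d) (F (E ((E ^^ k) x)))" by simp
  then have "(F ^^ k) ((E ^^ k) x) = sc (1 / ?d) ((F ^^ k) (F (E ((E ^^ k) x))))"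
    using P.scale by metis
  also have "(F ^^ k) (F (E ((E ^^ k) x))) = (F ^^ Suc k) ((E ^^ Suc k) x)"
    by (simp add: funpow_swap1)
  finally show ?case using c by (metis scale_scale)
qed

end

section \<open>Isotypic subspaces as Casimir eigenspaces\<close>

lift_definition sl2_f :: sl2 is "vector [vector [0, 0], vector [1, 0]]"
  by (simp add: trace_def sum_2)

text \<open>The entries 11, 12 and 21 of a traceless matrix are its coordinates along h, e and f.
  Thus \<open>rho\<close> expresses linearity in A, and submodules can be tested on E, F and
  H.\<close>

locale sl2_module = sl2_triple sc "\<rho> sl2_e" "\<rho> sl2_f" "\<rho> sl2_h" V M
  for sc :: "complex \<Rightarrow> 'v::ab_group_add \<Rightarrow> 'v" and \<rho> V M +
  assumes rho: "x \<in> V \<Longrightarrow> \<rho> A x = sc (mat_of A $ 1 $ 1) (\<rho> sl2_h x) +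
    sc (mat_of A $ 1 $ 2) (\<rho> sl2_e x) + sc (mat_of A $ 2 $ 1) (\<rho> sl2_f x)"
begin

abbreviation "E \<equiv> \<rho> sl2_e"
abbreviation "F \<equiv> \<rho> sl2_f"
abbreviation "H \<equiv> \<rho> sl2_h"

lemma sl2_submoduleI:
  assumes "subspace U" "U \<subseteq> V" "\<And>u. u \<in> U \<Longrightarrow> E u \<in> U" "\<And>u. u \<in> U \<Longrightarrow> F u \<in> U" "\<And>u. u \<in> U \<Longrightarrow> H u \<in> U"
  shows "sl2_submodule sc \<rho> U"
  unfolding sl2_submodule_def
proof (intro conjI allI ballI)
  fix A u assume u: "u \<in> U"
  then have "u \<in> V" using assms(2) by blast
  then show "\<rho> A u \<in> U"
    by (subst rho) (use u assms in \<open>auto intro!: subspace_add subspace_scale\<close>)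
qed (rule assms)

lemma sl2_submodule_casimir_space: "sl2_submodule sc \<rho> (casimir_space s)"
  by (rule sl2_submoduleI)
    (auto simp: subspace_casimir_space intro: E_casimir F_casimir H_casimir, simp add: casimir_space_def)

text \<open>U meets the Casimir eigenspace in a submodule that contains the highest weight vector,
  so irreducibility makes it all of U. This replaces an appeal to Schur's lemma.\<close>

lemma irreducible_subset_casimir_space:
  assumes U: "U \<subseteq> V" "sl2_irreducible sc \<rho> U" "has_highest_weight sc \<rho> U r"
  shows "U \<subseteq> casimir_space r"
proof -
  obtain v where v: "v \<in> U" "v \<noteq> 0" "E v = 0" "H v = sc (of_nat r) v"
    using U(3) unfolding has_highest_weight_def by blast
  have "v \<in> weight_space (int r)" using v U(1) by (auto simp: weight_space_def)
  then have "casimir v = sc (of_int (int r * (int r + 2))) v" using casimir_highest v by blast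
  moreover have "(of_nat (r * (r + 2)) :: complex) = of_int (int r * (int r + 2))"
    by (simp add: algebra_simps)
  ultimately have "v \<in> U \<inter> casimir_space r" using v U(1) unfolding casimir_space_def by auto
  moreover have "sl2_submodule sc \<rho> (U \<inter> casimir_space r)"
    using U(2) sl2_submodule_casimir_space[of r]
    unfolding sl2_irreducible_def sl2_submodule_def by (auto simp: subspace_inter)
  ultimately have "U \<inter> casimir_space r = U"
    using U(2) v(2) unfolding sl2_irreducible_def by (metis Int_lower1 singletonD)
  then show ?thesis by blast
qed

section \<open>Irreducible submodules generated by a highest weight vector\<close>

definition string_space :: "'v \<Rightarrow> nat \<Rightarrow> 'v set" where
  "string_space v s = span ((\<lambda>i. (F ^^ i) v) ` {..s})"

context
  fixes v s
  assumes v: "v \<in> weight_space (int s)" "v \<in> casimir_space s" "v \<noteq> 0"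
begin

lemma primitive_E: "E v = 0"
proof (rule ccontr)
  assume "E v \<noteq> 0"
  then have "int s + 2 \<le> int s"
    using casimir_weight_bound[OF E_weight[OF v(1)] E_casimir[OF v(2)]] by blast
  then show False by simp
qed

lemma primitive_F: "(F ^^ Suc s) v = 0"
proof (rule ccontr)
  assume "(F ^^ Suc s) v \<noteq> 0"
  then have "\<bar>int s - 2 * int (Suc s)\<bar> \<le> int s"
    using casimir_weight_abs_bound[OF F_pow_weight F_pow_casimir, OF v(1,2)] by blast
  then show False by auto
qed

text \<open>Passing from the generators to the lines they span allows a vector to be decomposed into
  weight components.\<close>

lemma string_space_weights: "(string_space v s) = span (\<Union>i\<in>{..s}. span {(F ^^ i) v})"
proof -
  have "(\<Union>i\<in>{..s}. span {(F ^^ i) v}) \<subseteq> (string_space v s)"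
    unfolding string_space_def by (intro UN_least span_mono) blast
  then show ?thesis unfolding string_space_def
    by (intro equalityI span_mono span_minimal) (auto intro: span_base)
qed

lemma string_space_subset: "(string_space v s) \<subseteq> casimir_space s"
  unfolding string_space_def
  by (rule span_minimal) (auto simp: subspace_casimir_space v intro: F_pow_casimir)

lemma string_space_closed:
  assumes "Vector_Spaces.linear sc sc T" "\<And>i. i \<le> s \<Longrightarrow> T ((F ^^ i) v) \<in> (string_space v s)" "u \<in> (string_space v s)"
  shows "T u \<in> (string_space v s)"
proof -
  interpret T: Vector_Spaces.linear sc sc T by fact
  have "(string_space v s) \<subseteq> {u. T u \<in> (string_space v s)}"
    unfolding string_space_def
  proof (rule span_minimal)
    show "(\<lambda>i. (F ^^ i) v) ` {..s} \<subseteq> {u. T u \<in> span ((\<lambda>i. (F ^^ i) v) ` {..s})}"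
      using assms(2) unfolding string_space_def by auto
    show "subspace {u. T u \<in> span ((\<lambda>i. (F ^^ i) v) ` {..s})}"
      by (auto simp: subspace_def T.zero T.add T.scale span_zero span_add span_scale)
  qed
  then show ?thesis using assms(3) by blast
qed

lemma F_pow_in_string_space: "(F ^^ i) v \<in> (string_space v s)"
proof (cases "i \<le> s")
  case False
  then obtain j where "i = j + Suc s" by (metis add.commute le_Suc_ex not_less_eq_eq)
  then have "(F ^^ i) v = (F ^^ j) 0" using primitive_F by (simp only: funpow_add comp_apply)
  also have "\<dots> = 0" by (induction j) (auto simp: F.zero)
  finally show ?thesis by (simp add: string_space_def span_zero)
qed (auto simp: string_space_def intro: span_base)

lemma sl2_submodule_string_space: "sl2_submodule sc \<rho> (string_space v s)"
proof (rule sl2_submoduleI)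
  show "subspace (string_space v s)" by (simp add: string_space_def)
  show "(string_space v s) \<subseteq> V" using string_space_subset by (auto simp: casimir_space_def)
  fix u assume u: "u \<in> (string_space v s)"
  show "F u \<in> (string_space v s)"
    using F_pow_in_string_space by (intro string_space_closed[OF F.linear_axioms _ u]) (metis comp_apply funpow.simps(2))
  have scale: "sc c ((F ^^ i) v) \<in> (string_space v s)" for c i
    using F_pow_in_string_space span_scale unfolding string_space_def by blast
  have wt: "(F ^^ i) v \<in> weight_space (int s - 2 * int i)" for i by (rule F_pow_weight[OF v(1)])
  show "H u \<in> (string_space v s)"
    using wt by (intro string_space_closed[OF H.linear_axioms _ u]) (auto simp: weight_space_def scale)
  show "E u \<in> (string_space v s)"
  proof (intro string_space_closed[OF E.linear_axioms _ u])
    fix i assume "i \<le> s"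
    show "E ((F ^^ i) v) \<in> (string_space v s)"
    proof (cases i)
      case 0
      then show ?thesis using primitive_E by (simp add: string_space_def span_zero)
    next
      case (Suc j)
      then show ?thesis
        using EF_scalar[OF wt F_pow_casimir[OF v(2)], of j] by (simp add: scale)
    qed
  qed
qed

lemma string_space_generated:
  assumes W: "sl2_submodule sc \<rho> W" "v \<in> W" shows "(string_space v s) \<subseteq> W"
proof -
  have "(F ^^ i) v \<in> W" for i
    using W by (induction i) (auto simp: sl2_submodule_def)
  then show ?thesis
    unfolding string_space_def using W by (intro span_minimal) (auto simp: sl2_submodule_def)
qed

text \<open>E sends the component of weight s - 2i to weight s - 2i + 2, so E x = 0 forces E to kill
  each component separately. But FE acts on it by i (s + 1 - i), which for 0 \<le> i \<le> s
  vanishes only at i = 0.\<close>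

lemma highest_vector_in_string_space:
  assumes x: "x \<in> (string_space v s)" "E x = 0" shows "x \<in> span {v}"
proof -
  obtain J c where J: "finite J" "J \<subseteq> {..s}" "\<And>i. i \<le> s \<Longrightarrow> c i \<in> span {(F ^^ i) v}"
    and xs: "x = (\<Sum>i\<in>J. c i)"
    using span_UN_subspacesE[of "{..s}" "\<lambda>i. span {(F ^^ i) v}" x] x
    unfolding string_space_weights by (metis atMost_iff subspace_span)
  have wt: "span {(F ^^ i) v} \<subseteq> weight_space (int s - 2 * int i) \<inter> casimir_space s" for i
    by (rule span_minimal)
      (use F_pow_weight[OF v(1)] F_pow_casimir[OF v(2)] in
        \<open>auto intro: subspace_inter subspace_weight_space subspace_casimir_space\<close>)
  have cwt: "c i \<in> weight_space (int s - 2 * int i)" "c i \<in> casimir_space s" if "i \<in> J" for i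
    using wt J that by blast+
  have "0 = E x" using x by simp
  also have "\<dots> = (\<Sum>i\<in>J. E (c i))" by (simp add: xs E.sum)
  finally have sum0: "(\<Sum>i\<in>J. E (c i)) = 0" by simp
  have "\<forall>i\<in>J. E (c i) = 0"
  proof (rule sum_eigenvectors_eq_zero[OF H.linear_axioms J(1) _ _ sum0])
    show "inj_on (\<lambda>i. of_int (int s - 2 * int i + 2) :: complex) J"
      by (auto simp: inj_on_def simp del: of_int_diff of_int_add)
    show "H (E (c i)) = sc (of_int (int s - 2 * int i + 2)) (E (c i))" if "i \<in> J" for i
      using E_weight[OF cwt(1)[OF that]] unfolding weight_space_def by blast
  qed
  have "c i = 0" if i: "i \<in> J" "i \<noteq> 0" for i
  proof -
    have "sc (of_int ((int s - (int s - 2 * int i)) * (int s + 2 + (int s - 2 * int i))) / 4) (c i) = 0"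
      using FE_scalar[OF cwt(1)[OF i(1)] cwt(2)[OF i(1)]] bspec[OF \<open>\<forall>i\<in>J. E (c i) = 0\<close> i(1)] F.zero
      by metis
    moreover have "(int s - (int s - 2 * int i)) * (int s + 2 + (int s - 2 * int i)) \<noteq> 0"
      using i J(2) by auto
    then have "(of_int ((int s - (int s - 2 * int i)) * (int s + 2 + (int s - 2 * int i))) / 4 :: complex) \<noteq> 0"
      by (simp del: of_int_mult of_int_diff of_int_add)
    ultimately show ?thesis by (simp only: scale_eq_0_iff) simp
  qed
  then have "(\<Sum>i\<in>J. c i) = (\<Sum>i\<in>J. if i = 0 then c 0 else 0)"
    by (intro sum.cong) auto
  then have "x = 0 \<or> x = c 0" using J(1) xs by (auto simp: sum.delta)
  then show ?thesis using J(3)[of 0] span_zero by auto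
qed

text \<open>Raising any nonzero vector of a submodule W ends at a highest weight vector in W. This
  is a multiple of v, and v generates the whole string.\<close>

lemma sl2_irreducible_string_space: "sl2_irreducible sc \<rho> (string_space v s)"
  unfolding sl2_irreducible_def
proof (intro conjI allI impI)
  show "sl2_submodule sc \<rho> (string_space v s)" by (rule sl2_submodule_string_space)
  show "(string_space v s) \<noteq> {0}" using F_pow_in_string_space[of 0] v(3) by auto
  fix W assume W: "sl2_submodule sc \<rho> W \<and> W \<subseteq> (string_space v s)"
  show "W = {0} \<or> W = (string_space v s)"
  proof (cases "W \<subseteq> {0}")
    case True
    moreover have "0 \<in> W" using W unfolding sl2_submodule_def by (blast intro: subspace_0)
    ultimately show ?thesis by blast
  next
    case False
    then obtain w where w: "w \<in> W" "w \<noteq> 0" by blast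
    then have "w \<in> V" using W string_space_subset by (auto simp: casimir_space_def)
    then obtain k where k: "(E ^^ k) w \<noteq> 0" "E ((E ^^ k) w) = 0"
      using highest_vector_power w by blast
    have Ew: "(E ^^ k) w \<in> W" for k using W w by (induction k) (auto simp: sl2_submodule_def)
    then have "(E ^^ k) w \<in> span {v}"
      using highest_vector_in_string_space k W by blast
    then obtain c where c: "(E ^^ k) w = sc c v" by (auto simp: span_singleton)
    then have "c \<noteq> 0" using k by auto
    then have "v = sc (1 / c) ((E ^^ k) w)" using c by simp
    then have "v \<in> W" using Ew W unfolding sl2_submodule_def by (metis subspace_scale)
    then show ?thesis using string_space_generated W by blast
  qed
qed

lemma string_space_subset_isotypic: "(string_space v s) \<subseteq> isotypic sc \<rho> V s"
proof -
  have "has_highest_weight sc \<rho> (string_space v s) s"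
    using F_pow_in_string_space[of 0] v primitive_E
    by (auto simp: has_highest_weight_def weight_space_def intro!: bexI[of _ v])
  moreover have "(string_space v s) \<subseteq> V" using string_space_subset by (auto simp: casimir_space_def)
  ultimately show ?thesis
    unfolding isotypic_def using sl2_irreducible_string_space by (blast intro: span_base)
qed

end

theorem isotypic_eq_casimir_space: "isotypic sc \<rho> V r = casimir_space r"
proof
  show "isotypic sc \<rho> V r \<subseteq> casimir_space r"
    unfolding isotypic_def
    by (rule span_minimal) (use irreducible_subset_casimir_space subspace_casimir_space in blast)+
  have "string_vectors \<inter> casimir_space r \<subseteq> isotypic sc \<rho> V r"
  proof
    fix y assume y: "y \<in> string_vectors \<inter> casimir_space r"
    have zero: "0 \<in> isotypic sc \<rho> V r" by (simp add: isotypic_def span_zero)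
    show "y \<in> isotypic sc \<rho> V r"
    proof (cases "y = 0")
      case False
      from y obtain m s k where m: "y \<in> weight_space m" "y \<in> casimir_space s" "\<bar>m\<bar> \<le> int s"
        "int s = m + 2 * int k" unfolding string_vectors_def by blast
      have "s = r"
      proof (rule injD[OF inj_casimir_eigenvalue])
        have "sc (of_nat (s * (s + 2))) y = sc (of_nat (r * (r + 2))) y"
          using m(2) y by (simp add: casimir_space_def del: of_nat_mult)
        then show "(of_nat (s * (s + 2)) :: complex) = of_nat (r * (r + 2))"
          using False by (simp only: scale_cancel_right) simp
      qed
      \<comment> \<open>Here k is the number of steps from the weight m to the top weight s.
        Lowering E^k y again recovers y, which puts y into the irreducible string generated by E^k
        y.\<close>
      let ?v = "(E ^^ k) y"
      obtain c where c: "y = sc c ((F ^^ k) ?v)" using F_pow_E_pow[OF m(1-3)] m(4) by auto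
      show ?thesis
      proof (cases "?v = 0")
        case True
        have "(F ^^ k) 0 = 0" by (induction k) (auto simp: F.zero)
        then show ?thesis using c True zero by simp
      next
        case False
        have v: "?v \<in> weight_space (int s)" "?v \<in> casimir_space s"
          using E_pow_weight[OF m(1), of k] E_pow_casimir[OF m(2)] m(4) by simp_all
        have "sc c ((F ^^ k) ?v) \<in> string_space ?v s"
          using F_pow_in_string_space[OF v False] span_scale unfolding string_space_def by blast
        then show ?thesis
          using c string_space_subset_isotypic[OF v False] \<open>s = r\<close> by auto
      qed
    qed (simp add: zero)
  qed
  then have "span (string_vectors \<inter> casimir_space r) \<subseteq> isotypic sc \<rho> V r"
    unfolding isotypic_def by (intro span_minimal) auto
  then show "casimir_space r \<subseteq> isotypic sc \<rho> V r"
    using casimir_space_in_span by blast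
qed

end

section \<open>The Killing form and integral weights\<close>

lemma endo_trace_comp_commute:
  fixes f g :: "'a::euclidean_space \<Rightarrow> 'a"
  assumes "linear f" "linear g"
  shows "endo_trace (\<lambda>v. f (g v)) = endo_trace (\<lambda>v. g (f v))"
proof -
  have expand: "endo_trace (\<lambda>v. f (g v)) = (\<Sum>b\<in>Basis. \<Sum>c\<in>Basis. (g b \<bullet> c) * (f c \<bullet> b))"
    if "linear f" for f g :: "'a \<Rightarrow> 'a"
  proof -
    have "f (g b) = (\<Sum>c\<in>Basis. (g b \<bullet> c) *\<^sub>R f c)" for b
      using linear_sum[OF that, of "\<lambda>c. (g b \<bullet> c) *\<^sub>R c" Basis]
      by (simp add: euclidean_representation linear_cmul[OF that])
    then show ?thesis by (simp add: endo_trace_def inner_sum_left)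
  qed
  have "endo_trace (\<lambda>v. g (f v)) = (\<Sum>c\<in>Basis. \<Sum>b\<in>Basis. (f c \<bullet> b) * (g b \<bullet> c))"
    by (rule expand) fact
  also have "\<dots> = (\<Sum>b\<in>Basis. \<Sum>c\<in>Basis. (f c \<bullet> b) * (g b \<bullet> c))" by (rule sum.swap)
  finally show ?thesis by (simp add: expand[OF assms(1)] mult.commute)
qed

lemma endo_trace_add: "endo_trace (\<lambda>v. f v + g v) = endo_trace f + endo_trace g"
  by (simp add: endo_trace_def inner_add_left sum.distrib)

lemma endo_trace_diff: "endo_trace (\<lambda>v. f v - g v) = endo_trace f - endo_trace g"
  by (simp add: endo_trace_def inner_diff_left sum_subtractf)

lemma endo_trace_scale: "endo_trace (\<lambda>v. c *\<^sub>R f v) = c * endo_trace f"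
  by (simp add: endo_trace_def sum_distrib_left)

locale real_lie_algebra =
  fixes br :: "'a::euclidean_space \<Rightarrow> 'a \<Rightarrow> 'a"
  assumes lie: "lie_algebra br"
begin

lemma bil: "bilinear br"
  using lie by (simp add: lie_algebra_def)

lemmas br_simps = bilinear_ladd[OF bil] bilinear_radd[OF bil] bilinear_lmul[OF bil] bilinear_rmul[OF bil]
  bilinear_lneg[OF bil] bilinear_rneg[OF bil] bilinear_lzero[OF bil] bilinear_rzero[OF bil]
  bilinear_lsub[OF bil] bilinear_rsub[OF bil]

lemma linear_br: "linear (br x)"
  using bil by (simp add: bilinear_def)

lemma br_self: "br x x = 0"
  using lie by (simp add: lie_algebra_def)

lemma br_antisym: "br y x = - br x y"
proof -
  have "br x y + br y x = br (x + y) (x + y)"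
    by (simp add: bilinear_ladd[OF bil] bilinear_radd[OF bil] br_self[of x] br_self[of y])
  then show ?thesis by (simp add: br_self eq_neg_iff_add_eq_0 add.commute)
qed

lemma jacobi: "br x (br y z) = br (br x y) z + br y (br x z)"
proof -
  have "br x (br y z) + br y (br z x) + br z (br x y) = 0"
    using lie by (simp add: lie_algebra_def)
  moreover have "br y (br z x) = - br y (br x z)" by (subst br_antisym) (simp add: br_simps)
  moreover have "br z (br x y) = - br (br x y) z" by (rule br_antisym)
  ultimately show ?thesis by (simp add: algebra_simps eq_neg_iff_add_eq_0)
qed

lemma linear_br_br: "linear (\<lambda>v. br x (br y v))"
  using linear_compose[OF linear_br linear_br] by (simp add: comp_def)

lemma killing_form_sym: "killing_form br x y = killing_form br y x"
  unfolding killing_form_def by (rule endo_trace_comp_commute) (rule linear_br)+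

lemma killing_form_add: "killing_form br (x + y) z = killing_form br x z + killing_form br y z"
  by (simp add: killing_form_def br_simps endo_trace_add)

lemma killing_form_scale: "killing_form br (c *\<^sub>R x) z = c * killing_form br x z"
  by (simp add: killing_form_def br_simps endo_trace_scale)

lemma linear_killing_form: "linear (\<lambda>x. killing_form br x z)"
  by (intro linearI) (simp_all add: killing_form_add killing_form_scale)

lemma linear_killing_form': "linear (\<lambda>z. killing_form br x z)"
  using linear_killing_form by (subst killing_form_sym)

lemma killing_form_invariant: "killing_form br (br z x) y = - killing_form br x (br z y)"
proof -
  have br2: "br (br u v) w = br u (br v w) - br v (br u w)" for u v w
    using jacobi[of u v w] by simp
  have "killing_form br (br z x) y =
      endo_trace (\<lambda>v. br z (br x (br y v))) - endo_trace (\<lambda>v. br x (br z (br y v)))"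
    unfolding killing_form_def br2 by (rule endo_trace_diff)
  also have "endo_trace (\<lambda>v. br z (br x (br y v))) = endo_trace (\<lambda>v. br x (br y (br z v)))"
    by (rule endo_trace_comp_commute[OF linear_br linear_br_br])
  also have "\<dots> - endo_trace (\<lambda>v. br x (br z (br y v))) = - killing_form br x (br z y)"
    unfolding killing_form_def br2 br_simps endo_trace_diff by simp
  finally show ?thesis .
qed

lemma killing_form_automorphism:
  assumes g: "linear g" "linear g'" "\<And>x. g (g' x) = x" "\<And>x. g' (g x) = x"
    and hom: "\<And>x y. g (br x y) = br (g x) (g y)"
  shows "killing_form br (g x) (g y) = killing_form br x y"
proof -
  have "br (g x) (br (g y) v) = g (br x (br y (g' v)))" for v by (simp add: hom g)
  then have "killing_form br (g x) (g y) = endo_trace (\<lambda>v. g (br x (br y (g' v))))"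
    by (simp add: killing_form_def)
  also have "\<dots> = endo_trace (\<lambda>v. br x (br y (g' (g v))))"
    using endo_trace_comp_commute[OF g(1) linear_compose[OF g(2) linear_br_br], of x y] by simp
  finally show ?thesis by (simp add: g killing_form_def)
qed

end

locale cartan_lie_algebra = real_lie_algebra br for br :: "'a::euclidean_space \<Rightarrow> 'a \<Rightarrow> 'a" +
  fixes \<theta> :: "'a \<Rightarrow> 'a"
  assumes cartan: "cartan_involution br \<theta>"
begin

lemma theta: "linear \<theta>" "\<theta> (\<theta> x) = x" "\<theta> (br x y) = br (\<theta> x) (\<theta> y)"
  using cartan by (auto simp: cartan_involution_def)

lemma theta_pos: "x \<noteq> 0 \<Longrightarrow> killing_form br x (\<theta> x) < 0"
  using cartan by (auto simp: cartan_involution_def)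

lemmas theta_simps = linear_add[OF theta(1)] linear_diff[OF theta(1)] linear_neg[OF theta(1)]
  linear_cmul[OF theta(1)] linear_0[OF theta(1)] theta(2)

text \<open>T represents the form B(x, \<theta> w) by the ambient inner product. Definiteness makes
  T injective, so the image of a proper subspace is again proper and has a nonzero orthogonal
  vector.\<close>

lemma orthogonal_complement_nontrivial:
  assumes "span S \<noteq> UNIV"
  obtains x where "x \<noteq> 0" "\<And>w. w \<in> span S \<Longrightarrow> killing_form br x (\<theta> w) = 0"
proof -
  define T where "T w = (\<Sum>b\<in>Basis. killing_form br b (\<theta> w) *\<^sub>R b)" for w
  have T: "x \<bullet> T w = killing_form br x (\<theta> w)" for x w
  proof -
    have "killing_form br x (\<theta> w) = killing_form br (\<Sum>b\<in>Basis. (x \<bullet> b) *\<^sub>R b) (\<theta> w)"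
      by (simp add: euclidean_representation)
    also have "\<dots> = (\<Sum>b\<in>Basis. (x \<bullet> b) * killing_form br b (\<theta> w))"
      using linear_sum[OF linear_killing_form[of "\<theta> w"], of "\<lambda>b. (x \<bullet> b) *\<^sub>R b" Basis]
      by (simp only: killing_form_scale)
    finally show ?thesis by (simp add: T_def inner_sum_right mult.commute)
  qed
  have lin: "linear T"
    by (rule linearI) (simp_all add: T_def theta_simps linear_add[OF linear_killing_form']
        linear_cmul[OF linear_killing_form'] scaleR_add_left sum.distrib scaleR_sum_right)
  have "w = 0" if "T w = 0" for w
    using T[of w w] theta_pos[of w] that by fastforce
  then have inj: "inj T" using lin by (simp add: linear_injective_0)
  have "dim (T ` span S) = dim (span S)"
    using lin inj by (intro dim_image_eq) (auto intro: inj_on_subset)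
  also have "\<dots> < DIM('a)"
    using assms dim_eq_full[of S] dim_subset_UNIV[of S] by (simp add: le_less)
  finally obtain x where x: "x \<noteq> 0" "\<And>y. y \<in> span (T ` span S) \<Longrightarrow> orthogonal x y"
    using orthogonal_to_subspace_exists by blast
  have "killing_form br x (\<theta> w) = 0" if "w \<in> span S" for w
    using x(2)[of "T w"] that T by (simp add: orthogonal_def span_base)
  then show ?thesis using that x(1) by blast
qed

end

section \<open>Integrality of the weights of a \<theta>-stable real triple\<close>

locale real_theta_triple = cartan_lie_algebra br \<theta> for br \<theta> +
  fixes e h :: "'a::euclidean_space"
  assumes he: "br h e = 2 *\<^sub>R e" and ef: "br e (\<theta> e) = - h" and theta_h: "\<theta> h = - h"
    and nil: "nilpotent_element br e"
begin

definition f :: 'a where "f = - \<theta> e"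

lemma theta_e: "\<theta> e = - f" by (simp add: f_def)

lemma theta_f: "\<theta> f = - e" by (simp add: f_def theta_simps)

lemma ef': "br e f = h" using ef by (simp add: f_def br_simps)

lemma hf: "br h f = - 2 *\<^sub>R f"
proof -
  have "\<theta> (br h e) = \<theta> (2 *\<^sub>R e)" by (simp only: he)
  then show ?thesis by (simp add: theta theta_h theta_simps br_simps f_def)
qed

lemma HE: "br h (br e x) = br e (br h x) + 2 *\<^sub>R br e x"
  using jacobi[of h e x] by (simp add: he br_simps)

lemma HF: "br h (br f x) = br f (br h x) - 2 *\<^sub>R br f x"
  using jacobi[of h f x] by (simp add: hf br_simps)

lemma EF: "br e (br f x) = br f (br e x) + br h x"
  using jacobi[of e f x] by (simp add: ef')

text \<open>The classical commutator of E^(k+1) and F, written with H to the left of E^k: if E^(k+1)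
  kills both x and F x, then E^k x has weight k.\<close>

lemma E_pow_F:
  "(br e ^^ Suc k) (br f x) =
    br f ((br e ^^ Suc k) x) + real (Suc k) *\<^sub>R (br h ((br e ^^ k) x) - real k *\<^sub>R (br e ^^ k) x)"
proof (induction k)
  case 0
  show ?case by (simp add: EF)
next
  case (Suc k)
  have "(br e ^^ Suc (Suc k)) (br f x) = br e ((br e ^^ Suc k) (br f x))" by simp
  also have "\<dots> = br e (br f ((br e ^^ Suc k) x)) +
      real (Suc k) *\<^sub>R (br e (br h ((br e ^^ k) x)) - real k *\<^sub>R (br e ^^ Suc k) x)"
    unfolding Suc.IH by (simp add: br_simps)
  also have "br e (br h ((br e ^^ k) x)) = br h ((br e ^^ Suc k) x) - 2 *\<^sub>R (br e ^^ Suc k) x"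
    using HE[of "(br e ^^ k) x"] by simp
  also have "br e (br f ((br e ^^ Suc k) x)) = br f ((br e ^^ Suc (Suc k)) x) + br h ((br e ^^ Suc k) x)"
    by (simp add: EF)
  finally have *: "(br e ^^ Suc (Suc k)) (br f x) =
      br f ((br e ^^ Suc (Suc k)) x) + br h ((br e ^^ Suc k) x) +
      real (Suc k) *\<^sub>R (br h ((br e ^^ Suc k) x) - 2 *\<^sub>R (br e ^^ Suc k) x - real k *\<^sub>R (br e ^^ Suc k) x)" .
  have "a + b + r *\<^sub>R (b - 2 *\<^sub>R c - s *\<^sub>R c) = a + (r + 1) *\<^sub>R (b - r *\<^sub>R c)" if "r = s + 1"
    for a b c :: 'a and r s :: real
  proof -
    have "a + b + r *\<^sub>R (b - 2 *\<^sub>R c - s *\<^sub>R c) = a + (r + 1) *\<^sub>R b - (r * (2 + s)) *\<^sub>R c"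
      by (simp add: algebra_simps)
    also have "r * (2 + s) = (r + 1) * r" using that by (simp add: algebra_simps)
    finally show ?thesis by (simp add: algebra_simps)
  qed
  from this[of "real (Suc k)" "real k"] show ?case unfolding * by simp
qed

definition weight_vectors :: "'a set" where
  "weight_vectors = {x. \<exists>m::int. br h x = of_int m *\<^sub>R x}"

lemma br_span_weight_vectors:
  assumes "x \<in> span weight_vectors"
  shows "br e x \<in> span weight_vectors" "br f x \<in> span weight_vectors"
proof -
  have "span weight_vectors \<subseteq> {x. br e x \<in> span weight_vectors \<and> br f x \<in> span weight_vectors}"
  proof (rule span_minimal)
    show "subspace {x. br e x \<in> span weight_vectors \<and> br f x \<in> span weight_vectors}"
      by (auto simp: subspace_def br_simps span_zero span_add span_scale)
    show "weight_vectors \<subseteq> {x. br e x \<in> span weight_vectors \<and> br f x \<in> span weight_vectors}"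
    proof clarify
      fix x assume "x \<in> weight_vectors"
      then obtain m :: int where m: "br h x = of_int m *\<^sub>R x" by (auto simp: weight_vectors_def)
      have "br h (br e x) = of_int (m + 2) *\<^sub>R br e x" "br h (br f x) = of_int (m - 2) *\<^sub>R br f x"
        by (simp_all add: HE HF m br_simps algebra_simps)
      then have "br e x \<in> weight_vectors" "br f x \<in> weight_vectors" unfolding weight_vectors_def by blast+
      then show "br e x \<in> span weight_vectors \<and> br f x \<in> span weight_vectors" by (blast intro: span_base)
    qed
  qed
  then show "br e x \<in> span weight_vectors" "br f x \<in> span weight_vectors" using assms by blast+
qed

text \<open>
  On the orthogonal complement of the integral weight vectors, the last non-vanishing power
  \<open>E\<^sup>k\<close> would have only weight vectors of weight \<open>k\<close> as values.
\<close>

lemma span_weight_vectors: "span weight_vectors = UNIV"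
proof (rule ccontr)
  assume "span weight_vectors \<noteq> UNIV"
  then obtain x0 where x0: "x0 \<noteq> 0" "\<And>w. w \<in> span weight_vectors \<Longrightarrow> killing_form br x0 (\<theta> w) = 0"
    using orthogonal_complement_nontrivial by blast
  define P where "P = {x. \<forall>w\<in>span weight_vectors. killing_form br x (\<theta> w) = 0}"
  \<comment> \<open>By invariance, the adjoint of ad z for the form B(x, \<theta> w) is - ad
    (\<theta> z). Since \<theta> e = - f, the operators of e and f are adjoint to each other, so
    both preserve the orthogonal complement P.\<close>
  have adj: "killing_form br (br z x) (\<theta> w) = - killing_form br x (\<theta> (br (\<theta> z) w))" for x z w
    by (simp add: killing_form_invariant theta)
  have P_E: "br e x \<in> P" and P_F: "br f x \<in> P" if "x \<in> P" for x
    using that by (auto simp: P_def adj theta_e theta_f br_simps theta_simps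
        br_span_weight_vectors linear_neg[OF linear_killing_form'])
  have P_pow: "(br e ^^ k) x \<in> P" if "x \<in> P" for k x
    using that P_E by (induction k) auto
  define N where "N = (LEAST n. \<forall>x\<in>P. (br e ^^ n) x = 0)"
  have "\<exists>n. \<forall>x\<in>P. (br e ^^ n) x = 0" using nil unfolding nilpotent_element_def by blast
  then have N: "\<forall>x\<in>P. (br e ^^ N) x = 0" unfolding N_def by (rule LeastI_ex)
  have "x0 \<in> P" using x0 by (simp add: P_def)
  then obtain k where k: "N = Suc k" using N x0(1) by (cases N) auto
  then have "k < (LEAST n. \<forall>x\<in>P. (br e ^^ n) x = 0)" by (simp flip: N_def)
  then obtain x where x: "x \<in> P" "(br e ^^ k) x \<noteq> 0" using not_less_Least by blast
  have "real (Suc k) *\<^sub>R (br h ((br e ^^ k) x) - real k *\<^sub>R (br e ^^ k) x) = 0"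
    using E_pow_F[of k x] N x(1) P_F[OF x(1)] unfolding k by (simp only: br_simps) simp
  then have "br h ((br e ^^ k) x) = of_int (int k) *\<^sub>R (br e ^^ k) x" by (simp del: of_nat_Suc)
  then have "(br e ^^ k) x \<in> span weight_vectors"
    unfolding weight_vectors_def by (blast intro: span_base)
  then have "killing_form br ((br e ^^ k) x) (\<theta> ((br e ^^ k) x)) = 0"
    using P_pow[OF x(1)] unfolding P_def by blast
  then show False using theta_pos[OF x(2)] by simp
qed

lemma bounded_weights:
  obtains M :: nat where "UNIV = span {x. \<exists>m::int. \<bar>m\<bar> \<le> int M \<and> br h x = of_int m *\<^sub>R x}"
proof -
  obtain B where B: "B \<subseteq> weight_vectors" "finite B" "span B = UNIV"
    using basis_exists[of weight_vectors] span_weight_vectors finiteI_independent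
    by (metis span_mono span_span top.extremum_uniqueI)
  have "\<forall>x\<in>B. \<exists>m::int. br h x = of_int m *\<^sub>R x" using B(1) by (auto simp: weight_vectors_def)
  then obtain m :: "'a \<Rightarrow> int" where m: "\<And>x. x \<in> B \<Longrightarrow> br h x = of_int (m x) *\<^sub>R x" by metis
  define M where "M = nat (\<Sum>x\<in>B. \<bar>m x\<bar>)"
  have "\<bar>m x\<bar> \<le> int M" if "x \<in> B" for x
    using member_le_sum[OF that, of "\<lambda>x. \<bar>m x\<bar>"] B(2) by (simp add: M_def)
  then have "B \<subseteq> {x. \<exists>m::int. \<bar>m\<bar> \<le> int M \<and> br h x = of_int m *\<^sub>R x}" using m by blast
  then have "span B \<subseteq> span {x. \<exists>m::int. \<bar>m\<bar> \<le> int M \<and> br h x = of_int m *\<^sub>R x}" by (rule span_mono)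
  then show ?thesis using that B(3) by blast
qed

end

section \<open>The maximal compact subgroup commutes with the Cartan involution\<close>

lemma linear_inv_blinfun:
  assumes "bij (blinfun_apply F)"
  shows "linear (inv_into UNIV (blinfun_apply F))"
proof (rule linearI)
  note inj = injD[OF bij_is_inj[OF assms]] and surj = surj_f_inv_f[OF bij_is_surj[OF assms]]
  show "inv_into UNIV (blinfun_apply F) (x + y) = inv_into UNIV (blinfun_apply F) x + inv_into UNIV (blinfun_apply F) y" for x y
    by (rule inj) (simp add: surj blinfun.add_right)
  show "inv_into UNIV (blinfun_apply F) (c *\<^sub>R x) = c *\<^sub>R inv_into UNIV (blinfun_apply F) x" for c x
    by (rule inj) (simp add: surj blinfun.scaleR_right)
qed

lemma group_Aut_group: "group (Aut_group br)"
proof (rule groupI)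
  fix F G H assume F: "F \<in> carrier (Aut_group br)" and G: "G \<in> carrier (Aut_group br)"
  then show "F \<otimes>\<^bsub>Aut_group br\<^esub> G \<in> carrier (Aut_group br)"
    by (auto simp: Aut_group_def lie_automorphisms_def blinfun_compose.rep_eq intro: bij_comp)
  show "F \<otimes>\<^bsub>Aut_group br\<^esub> G \<otimes>\<^bsub>Aut_group br\<^esub> H = F \<otimes>\<^bsub>Aut_group br\<^esub> (G \<otimes>\<^bsub>Aut_group br\<^esub> H)"
    by (simp add: Aut_group_def blinfun_eqI)
next
  show "\<one>\<^bsub>Aut_group br\<^esub> \<in> carrier (Aut_group br)"
    using bij_id by (simp add: Aut_group_def lie_automorphisms_def id_def)
next
  fix F assume "F \<in> carrier (Aut_group br)"
  then have F: "bij (blinfun_apply F)" "\<And>x y. F (br x y) = br (F x) (F y)"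
    by (auto simp: Aut_group_def lie_automorphisms_def)
  show "\<one>\<^bsub>Aut_group br\<^esub> \<otimes>\<^bsub>Aut_group br\<^esub> F = F"
    by (simp add: Aut_group_def blinfun_eqI)
  define G where "G = Blinfun (inv_into UNIV (blinfun_apply F))"
  have G: "blinfun_apply G = inv_into UNIV (blinfun_apply F)"
    unfolding G_def using linear_inv_blinfun[OF F(1)]
    by (intro bounded_linear_Blinfun_apply) (simp add: linear_conv_bounded_linear)
  have GF: "G (F x) = x" "F (G x) = x" for x
    using F(1) by (simp_all add: G inv_f_f bij_is_inj surj_f_inv_f bij_is_surj)
  have "G (br x y) = br (G x) (G y)" for x y
    by (rule injD[OF bij_is_inj[OF F(1)]]) (simp add: F(2) GF)
  moreover have "bij (blinfun_apply G)" using F(1) by (simp add: G bij_imp_bij_inv)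
  moreover have "G o\<^sub>L F = id_blinfun" by (rule blinfun_eqI) (simp add: GF)
  ultimately show "\<exists>G\<in>carrier (Aut_group br). G \<otimes>\<^bsub>Aut_group br\<^esub> F = \<one>\<^bsub>Aut_group br\<^esub>"
    by (auto simp: Aut_group_def lie_automorphisms_def)
qed

lemma summable_endo_exp:
  fixes A :: "'a::euclidean_space \<Rightarrow> 'a"
  assumes "linear A"
  shows "summable (\<lambda>n. (1 / fact n) *\<^sub>R (A ^^ n) v)"
proof -
  obtain C where C: "C > 0" "\<And>x. norm (A x) \<le> norm x * C"
    using bounded_linear.pos_bounded[of A] assms by (auto simp: linear_conv_bounded_linear)
  have bound: "norm ((A ^^ n) v) \<le> C ^ n * norm v" for n
  proof (induction n)
    case (Suc n)
    have "norm ((A ^^ Suc n) v) \<le> norm ((A ^^ n) v) * C" using C(2) by simp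
    also have "\<dots> \<le> C ^ n * norm v * C" using Suc C(1) by (intro mult_right_mono) auto
    finally show ?case by (simp add: mult_ac)
  qed simp
  show ?thesis
  proof (rule summable_comparison_test')
    show "summable (\<lambda>n. inverse (fact n) * C ^ n * norm v)"
      by (intro summable_mult2 summable_exp)
    show "norm ((1 / fact n) *\<^sub>R (A ^^ n) v) \<le> inverse (fact n) * C ^ n * norm v" for n
      using mult_left_mono[OF bound[of n], of "inverse (fact n)"] by (simp add: field_simps)
  qed
qed

lemma endo_exp_conjugate:
  fixes A :: "'a::euclidean_space \<Rightarrow> 'a" and F :: "'a \<Rightarrow>\<^sub>L 'a"
  assumes "linear A" and GF: "\<And>x. g (F x) = x"
  shows "endo_exp (\<lambda>v. F (A (g v))) (F v) = F (endo_exp A v)"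
proof -
  have "((\<lambda>v. F (A (g v))) ^^ n) (F v) = F ((A ^^ n) v)" for n
    by (induction n) (simp_all add: GF)
  then have "endo_exp (\<lambda>v. F (A (g v))) (F v) = (\<Sum>n. F ((1 / fact n) *\<^sub>R (A ^^ n) v))"
    by (simp add: endo_exp_def blinfun.scaleR_right)
  also have "\<dots> = F (endo_exp A v)"
    unfolding endo_exp_def
    by (rule bounded_linear.suminf[OF blinfun.bounded_linear_right summable_endo_exp[OF assms(1)], symmetric])
  finally show ?thesis .
qed

text \<open>Conjugating exp(t ad x) by F gives exp(t ad (F x)), which stays in K. The converse is
  the same argument for the inverse of F.\<close>

lemma (in real_lie_algebra) compact_group_preserves_lie_algebra:
  assumes K: "subgroup K (Aut_group br)" and F: "F \<in> K"
  shows "F x \<in> lie_algebra_of br K \<longleftrightarrow> x \<in> lie_algebra_of br K"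
proof -
  interpret G: group "Aut_group br" by (rule group_Aut_group)
  have sub: "F x \<in> lie_algebra_of br K" if F: "F \<in> K" and x: "x \<in> lie_algebra_of br K" for F x
    unfolding lie_algebra_of_def
  proof (intro CollectI allI)
    fix t :: real
    obtain A where A: "A \<in> K" "blinfun_apply A = endo_exp (\<lambda>v. t *\<^sub>R br x v)"
      using x unfolding lie_algebra_of_def by blast
    define F' where "F' = inv\<^bsub>Aut_group br\<^esub> F"
    have carr: "F \<in> carrier (Aut_group br)" using subgroup.subset[OF K] F by blast
    have F': "F' \<in> K" using subgroup.m_inv_closed[OF K F] by (simp add: F'_def)
    have "F' o\<^sub>L F = id_blinfun" "F o\<^sub>L F' = id_blinfun"
      using G.l_inv[OF carr] G.r_inv[OF carr] by (simp_all add: F'_def Aut_group_def)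
    then have FF': "F' (F v) = v" "F (F' v) = v" for v
      by (metis blinfun_apply_blinfun_compose id_blinfun.rep_eq id_apply)+
    have hom: "F (br x y) = br (F x) (F y)" for x y
      using carr by (auto simp: Aut_group_def lie_automorphisms_def)
    have "F o\<^sub>L (A o\<^sub>L F') \<in> K"
      using subgroup.m_closed[OF K F subgroup.m_closed[OF K A(1) F']] by (simp add: Aut_group_def)
    moreover have "blinfun_apply (F o\<^sub>L (A o\<^sub>L F')) = endo_exp (\<lambda>v. t *\<^sub>R br (F x) v)"
    proof
      fix v
      have "(\<lambda>v. t *\<^sub>R br (F x) v) = (\<lambda>v. F (t *\<^sub>R br x (F' v)))"
        by (simp add: hom FF' blinfun.scaleR_right)
      moreover have "linear (\<lambda>v. t *\<^sub>R br x v)"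
        by (rule linear_compose_scale_right[OF linear_br])
      ultimately have "endo_exp (\<lambda>v. t *\<^sub>R br (F x) v) (F (F' v)) = F (endo_exp (\<lambda>v. t *\<^sub>R br x v) (F' v))"
        using endo_exp_conjugate[of "\<lambda>v. t *\<^sub>R br x v" F' F "F' v"] FF' by simp
      then show "blinfun_apply (F o\<^sub>L (A o\<^sub>L F')) v = endo_exp (\<lambda>v. t *\<^sub>R br (F x) v) v"
        by (simp add: FF' A(2))
    qed
    ultimately show "\<exists>B\<in>K. blinfun_apply B = endo_exp (\<lambda>v. t *\<^sub>R br (F x) v)" by metis
  qed
  have carr: "F \<in> carrier (Aut_group br)" using subgroup.subset[OF K] F by blast
  have "inv\<^bsub>Aut_group br\<^esub> F o\<^sub>L F = id_blinfun"
    using G.l_inv[OF carr] by (simp add: Aut_group_def)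
  then have "(inv\<^bsub>Aut_group br\<^esub> F) (F x) = x"
    by (metis blinfun_apply_blinfun_compose id_blinfun.rep_eq id_apply)
  then show ?thesis
    using sub[OF F] sub[OF subgroup.m_inv_closed[OF K F], of "F x"] by auto
qed

lemma (in cartan_lie_algebra) compact_group_commutes_theta:
  assumes K: "subgroup K (Aut_group br)" and F: "F \<in> K"
    and k: "{x. \<theta> x = x} = lie_algebra_of br K"
  shows "\<theta> (F x) = F (\<theta> x)"
proof -
  have carr: "F \<in> carrier (Aut_group br)" using subgroup.subset[OF K] F by blast
  then have bij: "bij (blinfun_apply F)" and hom: "F (br x y) = br (F x) (F y)" for x y
    by (auto simp: Aut_group_def lie_automorphisms_def)
  have fix_iff: "\<theta> (F x) = F x \<longleftrightarrow> \<theta> x = x" for x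
    using compact_group_preserves_lie_algebra[OF K F, of x] k by blast
  note surj = surj_f_inv_f[OF bij_is_surj[OF bij]]
  have B_F: "killing_form br (F x) (F y) = killing_form br x y" for x y
    by (rule killing_form_automorphism[of _ "inv_into UNIV (blinfun_apply F)"])
      (simp_all add: hom linear_inv_blinfun bij surj inv_f_f[OF bij_is_inj[OF bij]]
        bounded_linear.linear blinfun.bounded_linear_right)
  have B_theta: "killing_form br (\<theta> x) (\<theta> y) = killing_form br x y" for x y
    by (rule killing_form_automorphism[of _ \<theta>]) (simp_all add: theta)
  have neg: "\<theta> (F x) = - F x" if x: "\<theta> x = - x" for x
  proof -
    have perp: "killing_form br (F x) a = 0" if a: "\<theta> a = a" for a
    proof -
      define b where "b = inv_into UNIV (blinfun_apply F) a"
      have b: "a = F b" by (simp add: b_def surj)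
      have "\<theta> b = b" using a fix_iff unfolding b by simp
      then have "killing_form br x b = - killing_form br x b"
        using B_theta[of x b] x linear_neg[OF linear_killing_form] by simp
      then show ?thesis unfolding b B_F by simp
    qed
    \<comment> \<open>This is twice the component of F x in the fixed space of \<theta>. It is
      orthogonal to itself for the Killing form, which is negative definite on fixed vectors, so it
      vanishes.\<close>
    define a where "a = F x + \<theta> (F x)"
    have a: "\<theta> a = a" by (simp add: a_def theta_simps)
    have "killing_form br a a = killing_form br (F x) a + killing_form br (\<theta> (F x)) (\<theta> a)"
      using killing_form_add[of "F x" "\<theta> (F x)" a] a by (simp add: a_def)
    also have "\<dots> = 0" using perp[OF a] by (simp add: B_theta)
    finally have "a = 0" using theta_pos[of a] a by fastforce
    then show ?thesis by (simp add: a_def eq_neg_iff_add_eq_0 add.commute)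
  qed
  have "\<theta> (F (x + \<theta> x)) = F (x + \<theta> x)" by (simp add: fix_iff theta_simps)
  moreover have "\<theta> (F (x - \<theta> x)) = - F (x - \<theta> x)" by (intro neg) (simp add: theta_simps)
  ultimately have "\<theta> (F ((x + \<theta> x) + (x - \<theta> x))) = F ((x + \<theta> x) - (x - \<theta> x))"
    unfolding blinfun.add_right[of F "x + \<theta> x"] blinfun.diff_right[of F "x + \<theta> x"]
      linear_add[OF theta(1)] by simp
  then have "\<theta> (F (2 *\<^sub>R x)) = F (2 *\<^sub>R \<theta> x)" by (simp add: scaleR_2)
  then show ?thesis by (simp add: blinfun.scaleR_right theta_simps)
qed

section \<open>The complexified Lie algebra as a representation\<close>

lemma linear_vector_spaces_iff:
  "Vector_Spaces.linear s1 s2 f \<longleftrightarrow> vector_space s1 \<and> vector_space s2 \<and>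
     (\<forall>x y. f (x + y) = f x + f y) \<and> (\<forall>c x. f (s1 c x) = s2 c (f x))"
  by (auto simp: Vector_Spaces.linear_def module_hom_iff module_iff_vector_space)

lemma sl2_brackets:
  "sl2_bracket sl2_h sl2_e = sl2_scale 2 sl2_e"
  "sl2_bracket sl2_h sl2_f = sl2_scale (- 2) sl2_f"
  "sl2_bracket sl2_e sl2_f = sl2_h"
  "sl2_bracket sl2_e sl2_h = sl2_scale (- 2) sl2_e"
  "sl2_bracket sl2_f sl2_h = sl2_scale 2 sl2_f"
  "sl2_bracket sl2_f sl2_e = - sl2_h"
  "sl2_bracket sl2_e sl2_e = 0" "sl2_bracket sl2_f sl2_f = 0" "sl2_bracket sl2_h sl2_h = 0"
  by (transfer; simp add: vec_eq_iff forall_2 matrix_matrix_mult_def sum_2 vector_2)+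

lemma sl2_theta_triple:
  "sl2_theta sl2_e = - sl2_f" "sl2_theta sl2_f = - sl2_e" "sl2_theta sl2_h = - sl2_h"
  by (transfer; simp add: vec_eq_iff forall_2 transpose_def vector_2)+

lemma sl2_decomposition:
  "A = sl2_scale (mat_of A $ 1 $ 1) sl2_h + sl2_scale (mat_of A $ 1 $ 2) sl2_e + sl2_scale (mat_of A $ 2 $ 1) sl2_f"
  by (transfer, simp add: vec_eq_iff forall_2 vector_2 trace_def sum_2) (metis add_eq_0_iff)

lemma mat_of_bracket:
  "mat_of (sl2_bracket sl2_h u) $ 1 $ 1 = 0" "mat_of (sl2_bracket sl2_h u) $ 1 $ 2 = 2 * mat_of u $ 1 $ 2"
  "mat_of (sl2_bracket sl2_h u) $ 2 $ 1 = - 2 * mat_of u $ 2 $ 1"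
  by (transfer; simp add: matrix_matrix_mult_def sum_2 vector_2)+

lemma sl2_bracket_triple_jacobi:
  "sl2_bracket sl2_h (sl2_bracket sl2_e u) = sl2_bracket sl2_e (sl2_bracket sl2_h u) + sl2_scale 2 (sl2_bracket sl2_e u)"
  "sl2_bracket sl2_h (sl2_bracket sl2_f u) = sl2_bracket sl2_f (sl2_bracket sl2_h u) - sl2_scale 2 (sl2_bracket sl2_f u)"
  "sl2_bracket sl2_e (sl2_bracket sl2_f u) = sl2_bracket sl2_f (sl2_bracket sl2_e u) + sl2_bracket sl2_h u"
  by (transfer; simp add: vec_eq_iff forall_2 matrix_matrix_mult_def sum_2 vector_2 trace_def algebra_simps)+

lemma sl2_bracket_linear:
  "sl2_bracket x (u + v) = sl2_bracket x u + sl2_bracket x v"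
  "sl2_bracket x (sl2_scale c u) = sl2_scale c (sl2_bracket x u)"
  "sl2_bracket (x + y) u = sl2_bracket x u + sl2_bracket y u"
  "sl2_bracket (sl2_scale c x) u = sl2_scale c (sl2_bracket x u)"
  by (transfer; simp add: vec_eq_iff forall_2 matrix_matrix_mult_def sum_2 algebra_simps)+

lemma sl2_triple_real: "sl2_e \<in> sl2_real" "sl2_f \<in> sl2_real" "sl2_h \<in> sl2_real"
  by (simp_all add: sl2_real_def sl2_e.rep_eq sl2_f.rep_eq sl2_h.rep_eq forall_2)

lemma mat_of_triple:
  "mat_of sl2_e $ 1 $ 1 = 0" "mat_of sl2_e $ 1 $ 2 = 1" "mat_of sl2_e $ 2 $ 1 = 0"
  "mat_of sl2_f $ 1 $ 1 = 0" "mat_of sl2_f $ 1 $ 2 = 0" "mat_of sl2_f $ 2 $ 1 = 1"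
  "mat_of sl2_h $ 1 $ 1 = 1" "mat_of sl2_h $ 1 $ 2 = 0" "mat_of sl2_h $ 2 $ 1 = 0"
  by (simp_all add: sl2_e.rep_eq sl2_f.rep_eq sl2_h.rep_eq)

lemma mat_of_add: "mat_of (u + v) $ i $ j = mat_of u $ i $ j + mat_of v $ i $ j"
  and mat_of_scale: "mat_of (sl2_scale c u) $ i $ j = c * mat_of u $ i $ j"
  and mat_of_theta: "mat_of (sl2_theta u) $ i $ j = - mat_of u $ j $ i"
  by (simp_all add: plus_sl2.rep_eq sl2_scale.rep_eq sl2_theta.rep_eq transpose_def)

lemma cscale_of_real: "cscale (of_real c) p = c *\<^sub>R p"
  by (simp add: cscale_def prod_eq_iff)

lemma (in real_lie_algebra) linear_cbracket: "Vector_Spaces.linear cscale cscale (cbracket br x)"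
  by (simp add: linear_vector_spaces_iff vector_space_cscale cbracket_def cscale_def br_simps algebra_simps prod_eq_iff)

lemma (in real_lie_algebra) cbracket_left:
  "cbracket br (x + y) p = cbracket br x p + cbracket br y p"
  "cbracket br (cscale c x) p = cscale c (cbracket br x p)"
  by (simp_all add: cbracket_def cscale_def br_simps algebra_simps prod_eq_iff)

lemma (in real_lie_algebra) cbracket_of_gR: "cbracket br (of_gR x) = cextend (br x)"
  by (simp add: fun_eq_iff cbracket_def of_gR_def cextend_def br_simps)

locale real_sl2_morphism = cartan_lie_algebra br \<theta> for br :: "'a::euclidean_space \<Rightarrow> 'a \<Rightarrow> 'a" and \<theta> +
  fixes \<Phi>0 :: "sl2 \<Rightarrow> 'a \<times> 'a" and \<zeta> :: 'a
  assumes Phi0: "\<Phi>0 \<in> Mor_real_theta br \<theta>" and Phi0_e: "\<Phi>0 sl2_e = of_gR \<zeta>"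
    and nilp: "nilpotent_element br \<zeta>"
begin

definition h :: 'a where "h = fst (\<Phi>0 sl2_h)"

lemma Phi0_linear: "Vector_Spaces.linear sl2_scale cscale \<Phi>0"
  using Phi0 by (simp add: Mor_real_theta_def Hom_theta_def Hom_s_def)

lemma Phi0_hom: "\<Phi>0 (sl2_bracket x y) = cbracket br (\<Phi>0 x) (\<Phi>0 y)"
  using Phi0 by (simp add: Mor_real_theta_def)

lemma Phi0_theta: "cextend \<theta> (\<Phi>0 x) = \<Phi>0 (sl2_theta x)"
  using Phi0 by (simp add: Mor_real_theta_def Hom_theta_def fun_eq_iff)

lemma Phi0_h: "\<Phi>0 sl2_h = of_gR h"
proof -
  have "\<Phi>0 sl2_h \<in> range of_gR" using Phi0 sl2_triple_real by (auto simp: Mor_real_theta_def)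
  then show ?thesis by (auto simp: h_def of_gR_def)
qed

lemma Phi0_f: "\<Phi>0 sl2_f = of_gR (- \<theta> \<zeta>)"
proof -
  interpret P: Vector_Spaces.linear sl2_scale cscale \<Phi>0 by (rule Phi0_linear)
  show ?thesis
    using Phi0_theta[of sl2_e]
    by (simp add: sl2_theta_triple P.neg Phi0_e cextend_def of_gR_def theta_simps prod_eq_iff minus_equation_iff)
qed

sublocale T: real_theta_triple br \<theta> \<zeta> h
proof
  interpret P: Vector_Spaces.linear sl2_scale cscale \<Phi>0 by (rule Phi0_linear)
  show "br h \<zeta> = 2 *\<^sub>R \<zeta>"
    using Phi0_hom[of sl2_h sl2_e]
    unfolding sl2_brackets P.scale Phi0_h Phi0_e cbracket_of_gR
    by (simp add: cextend_def of_gR_def cscale_def)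
  show "br \<zeta> (\<theta> \<zeta>) = - h"
    using Phi0_hom[of sl2_e sl2_f]
    unfolding sl2_brackets Phi0_h Phi0_e Phi0_f cbracket_of_gR
    by (simp add: cextend_def of_gR_def br_simps)
  show "\<theta> h = - h"
    using Phi0_theta[of sl2_h] unfolding sl2_theta_triple P.neg Phi0_h
    by (simp add: cextend_def of_gR_def theta_simps)
qed (rule nilp)

lemma Phi0_f': "\<Phi>0 sl2_f = of_gR T.f"
  by (simp add: Phi0_f T.f_def)

text \<open>The bound must be available as a term before the triple can be instantiated, hence the
  choice.\<close>

definition M :: nat where
  "M = (SOME M. UNIV = span {x. \<exists>m::int. \<bar>m\<bar> \<le> int M \<and> br h x = of_int m *\<^sub>R x})"

lemma M: "UNIV = span {x. \<exists>m::int. \<bar>m\<bar> \<le> int M \<and> br h x = of_int m *\<^sub>R x}"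
proof -
  have "\<exists>M::nat. UNIV = span {x. \<exists>m::int. \<bar>m\<bar> \<le> int M \<and> br h x = of_int m *\<^sub>R x}"
    by (rule T.bounded_weights) (rule exI)
  then show ?thesis unfolding M_def by (rule someI_ex)
qed

text \<open>Integral weight vectors of ad h span the real Lie algebra over the reals. Since p = x +
  \<i> y, they span the complexification over the complex numbers, with the same weights.\<close>

sublocale G: sl2_module cscale "\<lambda>A. cbracket br (\<Phi>0 A)" UNIV M
proof -
  interpret CS: vector_space cscale by (rule vector_space_cscale)
  let ?W = "{p. \<exists>m::int. \<bar>m\<bar> \<le> int M \<and> cbracket br (\<Phi>0 sl2_h) p = cscale (of_int m) p}"
  have of_gR: "of_gR x \<in> CS.span ?W" for x
  proof -
    have "{x. \<exists>m::int. \<bar>m\<bar> \<le> int M \<and> br h x = of_int m *\<^sub>R x} \<subseteq> {x. of_gR x \<in> CS.span ?W}"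
    proof clarify
      fix x and m :: int assume m: "\<bar>m\<bar> \<le> int M" "br h x = of_int m *\<^sub>R x"
      then have "cbracket br (\<Phi>0 sl2_h) (of_gR x) = cscale (of_int m) (of_gR x)"
        unfolding Phi0_h cbracket_of_gR by (simp add: cextend_def of_gR_def cscale_def br_simps)
      then show "of_gR x \<in> CS.span ?W" using m by (intro CS.span_base) blast
    qed
    moreover have "of_gR (x + y) = of_gR x + of_gR y" "of_gR (c *\<^sub>R x) = cscale (of_real c) (of_gR x)"
      for x y :: 'a and c by (simp_all add: of_gR_def cscale_def)
    then have "subspace {x. of_gR x \<in> CS.span ?W}"
      using CS.span_zero[unfolded zero_prod_def]
      by (auto simp only: subspace_def mem_Collect_eq intro: CS.span_add CS.span_scale) (simp add: of_gR_def)
    ultimately have "span {x. \<exists>m::int. \<bar>m\<bar> \<le> int M \<and> br h x = of_int m *\<^sub>R x} \<subseteq> {x. of_gR x \<in> CS.span ?W}"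
      by (rule span_minimal)
    then show ?thesis using M by blast
  qed
  have p_eq: "p = of_gR (fst p) + cscale \<i> (of_gR (snd p))" for p :: "'a \<times> 'a"
    by (simp add: of_gR_def cscale_def)
  have "p \<in> CS.span ?W" for p
    by (subst p_eq) (intro CS.span_add CS.span_scale of_gR)
  then have weights: "UNIV \<subseteq> CS.span {x \<in> UNIV. \<exists>m::int. \<bar>m\<bar> \<le> int M \<and> cbracket br (\<Phi>0 sl2_h) x = cscale (of_int m) x}"
    by auto
  show "sl2_module cscale (\<lambda>A. cbracket br (\<Phi>0 A)) UNIV M"
  proof (intro sl2_module.intro sl2_triple.intro sl2_triple_axioms.intro sl2_module_axioms.intro weights
      vector_space_cscale linear_cbracket)
    show "CS.subspace UNIV" by (rule CS.subspace_UNIV)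
    fix A p
    interpret P: Vector_Spaces.linear sl2_scale cscale \<Phi>0 by (rule Phi0_linear)
    show "cbracket br (\<Phi>0 A) p = cscale (mat_of A $ 1 $ 1) (cbracket br (\<Phi>0 sl2_h) p) +
        cscale (mat_of A $ 1 $ 2) (cbracket br (\<Phi>0 sl2_e) p) + cscale (mat_of A $ 2 $ 1) (cbracket br (\<Phi>0 sl2_f) p)"
      by (subst sl2_decomposition) (simp only: P.add P.scale cbracket_left)
  qed (simp_all add: Phi0_h Phi0_e Phi0_f' cbracket_of_gR cextend_def cscale_def T.HE T.HF T.EF
      prod_eq_iff)
qed

lemma g_isotypic_eq: "g_isotypic br \<Phi>0 r = G.casimir_space r"
  unfolding g_isotypic_def by (rule G.isotypic_eq_casimir_space)

end

section \<open>The diagonal action on linear maps\<close>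

lemma Hom_s_iff:
  "\<Phi> \<in> Hom_s W \<longleftrightarrow> (\<forall>x y. \<Phi> (x + y) = \<Phi> x + \<Phi> y) \<and>
     (\<forall>c x. \<Phi> (sl2_scale c x) = cscale c (\<Phi> x)) \<and> (\<forall>u. \<Phi> u \<in> W)"
  by (auto simp: Hom_s_def linear_vector_spaces_iff vector_space_cscale vector_space_sl2_scale)

text \<open>The arguments a, b, c are the values at e, h, f in this order, whereas the entries 11,
  12, 21 of u are its coordinates along h, e, f.\<close>

definition hom_of_values :: "'a::real_vector \<times> 'a \<Rightarrow> 'a \<times> 'a \<Rightarrow> 'a \<times> 'a \<Rightarrow> sl2 \<Rightarrow> 'a \<times> 'a" where
  "hom_of_values a b c u =
     cscale (mat_of u $ 1 $ 1) b + cscale (mat_of u $ 1 $ 2) a + cscale (mat_of u $ 2 $ 1) c"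

lemma hom_of_values_triple:
  "hom_of_values a b c sl2_e = a" "hom_of_values a b c sl2_h = b" "hom_of_values a b c sl2_f = c"
  by (simp_all add: hom_of_values_def mat_of_triple cscale_def zero_prod_def)

lemma Hom_s_eq_hom_of_values:
  assumes "\<Phi> \<in> Hom_s W"
  shows "\<Phi> = hom_of_values (\<Phi> sl2_e) (\<Phi> sl2_h) (\<Phi> sl2_f)"
proof
  fix u
  show "\<Phi> u = hom_of_values (\<Phi> sl2_e) (\<Phi> sl2_h) (\<Phi> sl2_f) u"
    using assms by (subst sl2_decomposition) (simp add: Hom_s_iff hom_of_values_def)
qed

lemma Hom_s_eqI:
  assumes "\<Phi> \<in> Hom_s W" "\<Psi> \<in> Hom_s W'"
    and "\<Phi> sl2_e = \<Psi> sl2_e" "\<Phi> sl2_h = \<Psi> sl2_h" "\<Phi> sl2_f = \<Psi> sl2_f"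
  shows "\<Phi> = \<Psi>"
  using Hom_s_eq_hom_of_values[OF assms(1)] Hom_s_eq_hom_of_values[OF assms(2)] assms(3-) by simp

lemma hom_of_values_in_Hom_s:
  assumes "module.subspace cscale W" "a \<in> W" "b \<in> W" "c \<in> W"
  shows "hom_of_values a b c \<in> Hom_s W"
proof -
  interpret CS: vector_space cscale by (rule vector_space_cscale)
  have "hom_of_values a b c u \<in> W" for u
    unfolding hom_of_values_def using assms by (intro CS.subspace_add CS.subspace_scale) auto
  then show ?thesis
    by (simp add: Hom_s_iff hom_of_values_def mat_of_add mat_of_scale algebra_simps
        CS.scale_left_distrib CS.scale_right_distrib)
qed

lemma subspace_Hom_s:
  fixes W :: "('a::euclidean_space \<times> 'a) set"
  assumes "module.subspace cscale W" shows "module.subspace hom_scale (Hom_s W)"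
proof -
  interpret CS: vector_space "cscale :: complex \<Rightarrow> 'a \<times> 'a \<Rightarrow> _" by (rule vector_space_cscale)
  interpret HS: vector_space "hom_scale :: complex \<Rightarrow> (sl2 \<Rightarrow> 'a \<times> 'a) \<Rightarrow> _" by (rule vector_space_hom_scale)
  show ?thesis
    unfolding HS.subspace_def hom_scale_def
    using assms by (auto simp: Hom_s_iff CS.subspace_def CS.scale_right_distrib mult.commute algebra_simps)
qed

lemma cscale_of_nat: "cscale (of_nat n) p = real n *\<^sub>R p"
  by (simp add: cscale_def prod_eq_iff)

lemma cscale_of_int: "cscale (of_int n) p = real_of_int n *\<^sub>R p"
  by (simp add: cscale_def prod_eq_iff)

lemma cscale_numeral: "cscale (numeral n) p = numeral n *\<^sub>R p" "cscale (- numeral n) p = - (numeral n *\<^sub>R p)"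
  by (simp_all add: cscale_def prod_eq_iff)

section \<open>Weights of the diagonal action on Hom(s, g(r))\<close>

context real_sl2_morphism
begin

interpretation HS: vector_space "hom_scale :: complex \<Rightarrow> (sl2 \<Rightarrow> 'a \<times> 'a) \<Rightarrow> _"
  by (rule vector_space_hom_scale)

lemma cbracket_linear:
  "cbracket br x (p + q) = cbracket br x p + cbracket br x q"
  "cbracket br x (p - q) = cbracket br x p - cbracket br x q"
  "cbracket br x (cscale c p) = cscale c (cbracket br x p)"
  by (simp_all add: cbracket_def cscale_def br_simps algebra_simps prod_eq_iff)

lemma linear_diagonal_action:
  "Vector_Spaces.linear hom_scale hom_scale (diagonal_action br \<Phi>0 A)"
  by (simp add: linear_vector_spaces_iff vector_space_hom_scale diagonal_action_def hom_scale_def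
      fun_eq_iff cbracket_linear G.scale_right_diff_distrib)

lemma diagonal_action_in_Hom_s:
  assumes "\<Phi> \<in> Hom_s (G.casimir_space r)"
  shows "diagonal_action br \<Phi>0 A \<Phi> \<in> Hom_s (G.casimir_space r)"
proof -
  have sub: "sl2_submodule cscale (\<lambda>A. cbracket br (\<Phi>0 A)) (G.casimir_space r)"
    by (rule G.sl2_submodule_casimir_space)
  then have "cbracket br (\<Phi>0 A) (\<Phi> u) - \<Phi> (sl2_bracket A u) \<in> G.casimir_space r" for u
    using assms G.subspace_casimir_space
    by (intro G.subspace_diff) (auto simp: sl2_submodule_def Hom_s_iff)
  then show ?thesis
    using assms by (simp add: Hom_s_iff diagonal_action_def cbracket_linear sl2_bracket_linear
        G.scale_right_diff_distrib)
qed

text \<open>The term \<Phi> ([h, u]) subtracts the weight of the argument u, which is 2 for e, 0 for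
  h and - 2 for f. So the bound r for the weights of g(r) becomes r + 2 for the linear maps.\<close>

lemma diagonal_H_hom_of_values:
  assumes "a \<in> G.weight_space m" "b \<in> G.weight_space m" "c \<in> G.weight_space m"
  shows "diagonal_action br \<Phi>0 sl2_h (hom_of_values a 0 0) = hom_scale (of_int (m - 2)) (hom_of_values a 0 0)"
    "diagonal_action br \<Phi>0 sl2_h (hom_of_values 0 b 0) = hom_scale (of_int m) (hom_of_values 0 b 0)"
    "diagonal_action br \<Phi>0 sl2_h (hom_of_values 0 0 c) = hom_scale (of_int (m + 2)) (hom_of_values 0 0 c)"
  using assms
  by (simp_all add: fun_eq_iff diagonal_action_def hom_of_values_def hom_scale_def mat_of_bracket
      cbracket_linear G.weight_space_def mult.commute
      left_diff_distrib right_diff_distrib distrib_left distrib_right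
      G.scale_left_distrib G.scale_left_diff_distrib)

lemma hom_of_values_sum:
  "hom_of_values (a :: 'a \<times> 'a) b c = hom_of_values a 0 0 + hom_of_values 0 b 0 + hom_of_values 0 0 c"
  by (simp add: fun_eq_iff hom_of_values_def)

lemma linear_hom_of_values:
  "Vector_Spaces.linear cscale hom_scale (\<lambda>a :: 'a \<times> 'a. hom_of_values a 0 0)"
  "Vector_Spaces.linear cscale hom_scale (\<lambda>a :: 'a \<times> 'a. hom_of_values 0 a 0)"
  "Vector_Spaces.linear cscale hom_scale (\<lambda>a :: 'a \<times> 'a. hom_of_values 0 0 a)"
  by (simp_all add: linear_vector_spaces_iff vector_space_hom_scale vector_space_cscale hom_of_values_def
      hom_scale_def fun_eq_iff G.scale_right_distrib mult.commute)

lemma Hom_s_weights: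
  "Hom_s (G.casimir_space r) \<subseteq> HS.span {\<Phi> \<in> Hom_s (G.casimir_space r).
     \<exists>m::int. \<bar>m\<bar> \<le> int (r + 2) \<and> diagonal_action br \<Phi>0 sl2_h \<Phi> = hom_scale (of_int m) \<Phi>}"
proof
  fix \<Phi> assume \<Phi>: "\<Phi> \<in> Hom_s (G.casimir_space r)"
  let ?W = "{\<Phi> \<in> Hom_s (G.casimir_space r).
     \<exists>m::int. \<bar>m\<bar> \<le> int (r + 2) \<and> diagonal_action br \<Phi>0 sl2_h \<Phi> = hom_scale (of_int m) \<Phi>}"
  have span: "T a \<in> HS.span ?W"
    if T: "Vector_Spaces.linear cscale hom_scale T" and a: "a \<in> G.casimir_space r"
      and *: "\<And>m x. \<bar>m\<bar> \<le> int r \<Longrightarrow> x \<in> G.weight_space m \<Longrightarrow> x \<in> G.casimir_space r \<Longrightarrow> T x \<in> ?W" for T a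
  proof -
    interpret T: Vector_Spaces.linear cscale hom_scale T by (rule T)
    have "G.span (\<Union>m\<in>{m. \<bar>m\<bar> \<le> int r}. G.weight_space m \<inter> G.casimir_space r) \<subseteq> {x. T x \<in> HS.span ?W}"
      using * by (intro G.span_minimal)
        (auto simp: G.subspace_def T.zero T.add T.scale HS.span_zero HS.span_scale intro: HS.span_add HS.span_base)
    then show ?thesis using G.casimir_space_in_span_weights[OF a] by blast
  qed
  have z: "0 \<in> G.casimir_space r" by (rule G.subspace_0[OF G.subspace_casimir_space])
  have v: "\<Phi> u \<in> G.casimir_space r" for u using \<Phi> by (simp add: Hom_s_iff)
  have mem: "hom_of_values a b c \<in> Hom_s (G.casimir_space r)"
    if "a \<in> G.casimir_space r" "b \<in> G.casimir_space r" "c \<in> G.casimir_space r" for a b c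
    using hom_of_values_in_Hom_s[OF G.subspace_casimir_space that] .
  have "hom_of_values (\<Phi> sl2_e) 0 0 \<in> HS.span ?W"
  proof (rule span[OF linear_hom_of_values(1) v])
    fix m x assume m: "\<bar>m\<bar> \<le> int r" "x \<in> G.weight_space m" "x \<in> G.casimir_space r"
    then have "\<bar>m - 2\<bar> \<le> int (r + 2)" by simp
    then show "hom_of_values x 0 0 \<in> ?W"
      using diagonal_H_hom_of_values(1)[OF m(2,2,2)] mem[OF m(3) z z] by blast
  qed
  moreover have "hom_of_values 0 (\<Phi> sl2_h) 0 \<in> HS.span ?W"
  proof (rule span[OF linear_hom_of_values(2) v])
    fix m x assume m: "\<bar>m\<bar> \<le> int r" "x \<in> G.weight_space m" "x \<in> G.casimir_space r"
    then have "\<bar>m\<bar> \<le> int (r + 2)" by simp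
    then show "hom_of_values 0 x 0 \<in> ?W"
      using diagonal_H_hom_of_values(2)[OF m(2,2,2)] mem[OF z m(3) z] by blast
  qed
  moreover have "hom_of_values 0 0 (\<Phi> sl2_f) \<in> HS.span ?W"
  proof (rule span[OF linear_hom_of_values(3) v])
    fix m x assume m: "\<bar>m\<bar> \<le> int r" "x \<in> G.weight_space m" "x \<in> G.casimir_space r"
    then have "\<bar>m + 2\<bar> \<le> int (r + 2)" by simp
    then show "hom_of_values 0 0 x \<in> ?W"
      using diagonal_H_hom_of_values(3)[OF m(2,2,2)] mem[OF z z m(3)] by blast
  qed
  ultimately have "hom_of_values (\<Phi> sl2_e) (\<Phi> sl2_h) (\<Phi> sl2_f) \<in> HS.span ?W"
    by (subst hom_of_values_sum) (intro HS.span_add)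
  then show "\<Phi> \<in> HS.span ?W" using Hom_s_eq_hom_of_values[OF \<Phi>] by simp
qed

lemma Hom_s_diff:
  "\<Phi> \<in> Hom_s W \<Longrightarrow> \<Phi> (u - v) = \<Phi> u - \<Phi> v"
  by (simp add: Hom_s_iff) (metis add_diff_cancel_right' diff_add_cancel)

lemma sl2_module_Hom_s:
  "sl2_module hom_scale (diagonal_action br \<Phi>0) (Hom_s (G.casimir_space r)) (r + 2)"
proof (intro sl2_module.intro sl2_triple.intro sl2_triple_axioms.intro sl2_module_axioms.intro
      vector_space_hom_scale linear_diagonal_action Hom_s_weights subspace_Hom_s
      G.subspace_casimir_space diagonal_action_in_Hom_s)
  fix \<Phi> A assume \<Phi>: "\<Phi> \<in> Hom_s (G.casimir_space r)"
  have lin: "\<Phi> (x + y) = \<Phi> x + \<Phi> y" "\<Phi> (x - y) = \<Phi> x - \<Phi> y" "\<Phi> (sl2_scale c x) = cscale c (\<Phi> x)" for x y c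
    using \<Phi> Hom_s_diff[OF \<Phi>] by (simp_all add: Hom_s_iff)
  interpret P: Vector_Spaces.linear sl2_scale cscale \<Phi>0 by (rule Phi0_linear)
  show "diagonal_action br \<Phi>0 A \<Phi> = hom_scale (mat_of A $ 1 $ 1) (diagonal_action br \<Phi>0 sl2_h \<Phi>) +
        hom_scale (mat_of A $ 1 $ 2) (diagonal_action br \<Phi>0 sl2_e \<Phi>) +
        hom_scale (mat_of A $ 2 $ 1) (diagonal_action br \<Phi>0 sl2_f \<Phi>)"
  proof
    fix u
    have "sl2_bracket A u = sl2_scale (mat_of A $ 1 $ 1) (sl2_bracket sl2_h u) +
        sl2_scale (mat_of A $ 1 $ 2) (sl2_bracket sl2_e u) + sl2_scale (mat_of A $ 2 $ 1) (sl2_bracket sl2_f u)"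
      by (subst sl2_decomposition[of A]) (simp only: sl2_bracket_linear)
    then have "\<Phi> (sl2_bracket A u) = cscale (mat_of A $ 1 $ 1) (\<Phi> (sl2_bracket sl2_h u)) +
        cscale (mat_of A $ 1 $ 2) (\<Phi> (sl2_bracket sl2_e u)) + cscale (mat_of A $ 2 $ 1) (\<Phi> (sl2_bracket sl2_f u))"
      by (simp only: lin)
    moreover note G.rho[of "\<Phi> u" A]
    ultimately show "diagonal_action br \<Phi>0 A \<Phi> u = (hom_scale (mat_of A $ 1 $ 1) (diagonal_action br \<Phi>0 sl2_h \<Phi>) +
        hom_scale (mat_of A $ 1 $ 2) (diagonal_action br \<Phi>0 sl2_e \<Phi>) +
        hom_scale (mat_of A $ 2 $ 1) (diagonal_action br \<Phi>0 sl2_f \<Phi>)) u"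
      by (simp add: diagonal_action_def hom_scale_def G.scale_right_diff_distrib)
  qed
  show "diagonal_action br \<Phi>0 sl2_h (diagonal_action br \<Phi>0 sl2_e \<Phi>) =
      diagonal_action br \<Phi>0 sl2_e (diagonal_action br \<Phi>0 sl2_h \<Phi>) + hom_scale 2 (diagonal_action br \<Phi>0 sl2_e \<Phi>)"
    by (simp add: fun_eq_iff diagonal_action_def hom_scale_def cbracket_linear lin
        sl2_bracket_triple_jacobi G.HE G.scale_right_diff_distrib)
  show "diagonal_action br \<Phi>0 sl2_h (diagonal_action br \<Phi>0 sl2_f \<Phi>) =
      diagonal_action br \<Phi>0 sl2_f (diagonal_action br \<Phi>0 sl2_h \<Phi>) - hom_scale 2 (diagonal_action br \<Phi>0 sl2_f \<Phi>)"
    by (simp add: fun_eq_iff diagonal_action_def hom_scale_def cbracket_linear lin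
        sl2_bracket_triple_jacobi G.HF G.scale_right_diff_distrib)
  show "diagonal_action br \<Phi>0 sl2_e (diagonal_action br \<Phi>0 sl2_f \<Phi>) =
      diagonal_action br \<Phi>0 sl2_f (diagonal_action br \<Phi>0 sl2_e \<Phi>) + diagonal_action br \<Phi>0 sl2_h \<Phi>"
    by (simp add: fun_eq_iff diagonal_action_def hom_scale_def cbracket_linear lin
        sl2_bracket_triple_jacobi G.EF G.scale_right_diff_distrib)
qed

section \<open>The equation for the values at e\<close>

abbreviation "adE \<equiv> cbracket br (\<Phi>0 sl2_e)"
abbreviation "adF \<equiv> cbracket br (\<Phi>0 sl2_f)"
abbreviation "adH \<equiv> cbracket br (\<Phi>0 sl2_h)"
abbreviation "\<Theta> \<equiv> cextend \<theta>"

lemma cbracket_real_linear: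
  "cbracket br x (p + q) = cbracket br x p + cbracket br x q"
  "cbracket br x (p - q) = cbracket br x p - cbracket br x q"
  "cbracket br x (- p) = - cbracket br x p"
  "cbracket br x (c *\<^sub>R p) = c *\<^sub>R cbracket br x p"
  "cbracket br x 0 = 0"
  by (simp_all add: cbracket_def br_simps algebra_simps prod_eq_iff)

lemma Theta_linear:
  "\<Theta> (p + q) = \<Theta> p + \<Theta> q" "\<Theta> (p - q) = \<Theta> p - \<Theta> q" "\<Theta> (- p) = - \<Theta> p"
  "\<Theta> (c *\<^sub>R p) = c *\<^sub>R \<Theta> p" "\<Theta> (\<Theta> p) = p" "\<Theta> 0 = 0" "\<Theta> (cscale a p) = cscale a (\<Theta> p)"
  by (simp_all add: cextend_def theta_simps prod_eq_iff cscale_def)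

lemma Theta_ad:
  "\<Theta> (adE p) = - adF (\<Theta> p)" "\<Theta> (adF p) = - adE (\<Theta> p)" "\<Theta> (adH p) = - adH (\<Theta> p)"
  unfolding Phi0_e Phi0_f' Phi0_h cbracket_of_gR
  by (simp_all add: cextend_def theta T.theta_e T.theta_f T.theta_h br_simps prod_eq_iff)

lemma ad_H_commute:
  "adH (adE p) = adE (adH p) + 2 *\<^sub>R adE p" "adH (adF p) = adF (adH p) - 2 *\<^sub>R adF p"
  using G.HE[of p] G.HF[of p] by (simp_all add: cscale_numeral)

lemma casimir_real: "G.casimir p = adH (adH p) + 2 *\<^sub>R adH p + 4 *\<^sub>R adF (adE p)"
  by (simp add: G.casimir_def cscale_numeral)

lemma casimir_space_iff: "p \<in> G.casimir_space r \<longleftrightarrow> G.casimir p = (real r * (real r + 2)) *\<^sub>R p"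
proof -
  have "real (r * (r + 2)) = real r * (real r + 2)" by (simp add: algebra_simps)
  then show ?thesis
    unfolding G.casimir_space_def cscale_of_nat by (simp only: mem_Collect_eq UNIV_I simp_thms)
qed

lemma casimir_space_EF:
  "p \<in> G.casimir_space r \<Longrightarrow> 4 *\<^sub>R adE (adF p) = (real r * (real r + 2)) *\<^sub>R p - adH (adH p) + 2 *\<^sub>R adH p"
  using G.casimir_alt[of p] unfolding casimir_space_iff by (simp add: cscale_numeral algebra_simps)

lemma Theta_casimir_space: "p \<in> G.casimir_space r \<Longrightarrow> \<Theta> p \<in> G.casimir_space r"
proof -
  assume p: "p \<in> G.casimir_space r"
  have "G.casimir (\<Theta> p) = adH (adH (\<Theta> p)) - 2 *\<^sub>R adH (\<Theta> p) + 4 *\<^sub>R adE (adF (\<Theta> p))"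
    using G.casimir_alt[of "\<Theta> p"] by (simp add: cscale_numeral)
  also have "\<dots> = \<Theta> (G.casimir p)"
    by (simp add: casimir_real Theta_linear Theta_ad cbracket_real_linear)
  finally show ?thesis using p by (simp add: casimir_space_iff Theta_linear)
qed

lemma casimir_space_closed:
  "p \<in> G.casimir_space r \<Longrightarrow> adE p \<in> G.casimir_space r"
  "p \<in> G.casimir_space r \<Longrightarrow> adF p \<in> G.casimir_space r"
  "p \<in> G.casimir_space r \<Longrightarrow> adH p \<in> G.casimir_space r"
  "p \<in> G.casimir_space r \<Longrightarrow> c *\<^sub>R p \<in> G.casimir_space r"
  "p \<in> G.casimir_space r \<Longrightarrow> q \<in> G.casimir_space r \<Longrightarrow> p + q \<in> G.casimir_space r"
  "p \<in> G.casimir_space r \<Longrightarrow> q \<in> G.casimir_space r \<Longrightarrow> p - q \<in> G.casimir_space r"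
  "p \<in> G.casimir_space r \<Longrightarrow> - p \<in> G.casimir_space r"
  "0 \<in> G.casimir_space r"
  using G.E_casimir G.F_casimir G.H_casimir G.subspace_casimir_space
  by (auto intro: G.subspace_add G.subspace_diff G.subspace_neg G.subspace_0
      simp flip: cscale_of_real simp: G.subspace_scale)

lemma high_weight_zero:
  assumes "p \<in> G.casimir_space r" "adH p = c *\<^sub>R p" "c = real_of_int m" "m > int r"
  shows "p = 0"
  using G.casimir_weight_bound[of p m r] assms by (force simp: G.weight_space_def cscale_of_int)

lemma casimir_space_weight_induct:
  assumes y: "y \<in> G.casimir_space r" and S: "G.subspace S"
    and *: "\<And>m x. \<bar>m\<bar> \<le> int r \<Longrightarrow> x \<in> G.casimir_space r \<Longrightarrow> adH x = real_of_int m *\<^sub>R x \<Longrightarrow> x \<in> S"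
  shows "y \<in> S"
proof -
  have "G.span (\<Union>m\<in>{m. \<bar>m\<bar> \<le> int r}. G.weight_space m \<inter> G.casimir_space r) \<subseteq> S"
    by (rule G.span_minimal[OF _ S]) (auto simp: G.weight_space_def cscale_of_int intro: *)
  then show ?thesis using G.casimir_space_in_span_weights[OF y] by blast
qed

text \<open>The values at \<open>e\<close> of the \<open>\<theta>\<close>-equivariant maps in \<open>Hom(\<s>, \<g>(r))(r - 2)\<close>.\<close>

definition core_values :: "nat \<Rightarrow> ('a \<times> 'a) set" where
  "core_values r = {a \<in> G.casimir_space r.
     adH (adH a) - (2 * real r + 6) *\<^sub>R adH a + ((real r + 2) * (real r + 4)) *\<^sub>R a = 4 *\<^sub>R adE (adE (\<Theta> a))}"

text \<open>The defining equation is complex linear in a because \<Theta> is the complex linear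
  extension of \<theta>.\<close>

lemma subspace_core_values: "G.subspace (core_values r)"
proof -
  define L where "L a = adH (adH a) - (2 * real r + 6) *\<^sub>R adH a + ((real r + 2) * (real r + 4)) *\<^sub>R a
    - 4 *\<^sub>R adE (adE (\<Theta> a))" for a
  have "L (a + b) = L a + L b" for a b
    unfolding L_def cbracket_real_linear Theta_linear scaleR_right_distrib by (simp only: diff_conv_add_uminus minus_add_distrib ac_simps)
  moreover have "L (cscale c a) = cscale c (L a)" for c a
  proof -
    have sc: "x *\<^sub>R cscale c p = cscale c (x *\<^sub>R p)" for x and p :: "'a \<times> 'a"
      by (simp add: cscale_def algebra_simps)
    show ?thesis
      by (simp only: L_def cbracket_linear(3) Theta_linear(7) sc G.scale_right_distrib G.scale_right_diff_distrib)
  qed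
  moreover have "L 0 = 0" by (simp add: L_def cbracket_real_linear Theta_linear)
  moreover have "core_values r = {a \<in> G.casimir_space r. L a = 0}" by (simp add: core_values_def L_def)
  ultimately show ?thesis
    using G.subspace_casimir_space by (auto simp: G.subspace_def)
qed

text \<open>Testing against an arbitrary b turns identities between real combinations of vectors
  into identities between real numbers, where terms can be collected by arithmetic.\<close>

lemma vector_eqI: "(\<And>b. x \<bullet> b = y \<bullet> b) \<Longrightarrow> x = (y :: 'b::real_inner)"
  by (metis inner_commute vector_eq_rdot)

section \<open>Solutions of the equation and the image of ad e\<close>

lemma core_values_inter:
  assumes k: "\<kappa> \<in> G.casimir_space r" "\<Theta> \<kappa> = \<kappa>" and r: "r \<noteq> 0" and a: "adE \<kappa> \<in> core_values r"
  shows "adE \<kappa> = 0"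
proof -
  \<comment> \<open>Both sides of the equation are combinations of E applied to \<kappa>, H \<kappa>
    and H H \<kappa>, and z has coefficient 1 on either side.\<close>
  define x y z where "x = adE \<kappa>" and "y = adE (adH \<kappa>)" and "z = adE (adH (adH \<kappa>))"
  have "4 *\<^sub>R adE (adE (\<Theta> (adE \<kappa>))) = - adE (4 *\<^sub>R adE (adF \<kappa>))"
    by (simp add: Theta_ad k cbracket_real_linear)
  also have "\<dots> = - ((real r * (real r + 2)) *\<^sub>R x - z + 2 *\<^sub>R y)"
    by (simp only: casimir_space_EF[OF k(1)] cbracket_real_linear x_def y_def z_def)
  finally have rhs: "4 *\<^sub>R adE (adE (\<Theta> x)) = - ((real r * (real r + 2)) *\<^sub>R x - z + 2 *\<^sub>R y)"
    by (simp only: x_def)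
  have Hx: "adH x = y + 2 *\<^sub>R x" and Hy: "adH y = z + 2 *\<^sub>R y"
    by (simp_all only: x_def y_def z_def ad_H_commute)
  have "adH (adH x) - (2 * real r + 6) *\<^sub>R adH x + ((real r + 2) * (real r + 4)) *\<^sub>R x = 4 *\<^sub>R adE (adE (\<Theta> x))"
    using a unfolding core_values_def x_def by blast
  then have *: "(z + 2 *\<^sub>R y + 2 *\<^sub>R (y + 2 *\<^sub>R x)) - (2 * real r + 6) *\<^sub>R (y + 2 *\<^sub>R x) + ((real r + 2) * (real r + 4)) *\<^sub>R x
     = - ((real r * (real r + 2)) *\<^sub>R x - z + 2 *\<^sub>R y)"
    unfolding rhs Hx cbracket_real_linear Hy .
  \<comment> \<open>After z cancels, what remains is 2r (y - (r + 2) x) = 0; here r \<noteq> 0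
    enters.\<close>
  have eq: "(2 * real r) * (y \<bullet> b) = (2 * real r) * ((real r + 2) * (x \<bullet> b))" for b
    using arg_cong[OF *, of "\<lambda>p. p \<bullet> b"]
    by (simp add: inner_left_distrib inner_diff_left algebra_simps)
  have "y = (real r + 2) *\<^sub>R x"
    by (rule vector_eqI) (use eq r in simp)
  then have "adH x = (real r + 4) *\<^sub>R x" by (simp add: Hx algebra_simps flip: scaleR_left_distrib)
  then have "x = 0"
    by (rule high_weight_zero[OF casimir_space_closed(1)[OF k(1), folded x_def], of _ "int r + 4"]) simp_all
  then show ?thesis by (simp only: x_def)
qed

text \<open>\<Theta> anticommutes with H, so for anti-fixed y it maps u = (H + r) y to v = (H - r)
  y. On g(r) one has - 4 EF = (H + r)(H - r - 2), and with HE = E (H + 2) both sides of the equation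
  become E (H - r)(H - r - 2)(H + r) y.\<close>

lemma core_values_surj:
  assumes y: "y \<in> G.casimir_space r" "\<Theta> y = - y"
  shows "adE (adH y + real r *\<^sub>R y) \<in> core_values r"
proof -
  define u v where "u = adH y + real r *\<^sub>R y" and "v = adH y - real r *\<^sub>R y"
  have uv: "u \<in> G.casimir_space r" "v \<in> G.casimir_space r"
    using y by (simp_all add: u_def v_def casimir_space_closed)
  have "\<Theta> u = v" by (simp add: u_def v_def Theta_linear Theta_ad y cbracket_real_linear)
  then have "4 *\<^sub>R adE (adE (\<Theta> (adE u))) = - adE (4 *\<^sub>R adE (adF v))"
    by (simp add: Theta_ad cbracket_real_linear)
  also have "\<dots> = - adE ((real r * (real r + 2)) *\<^sub>R v - adH (adH v) + 2 *\<^sub>R adH v)"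
    by (simp only: casimir_space_EF[OF uv(2)])
  also have "\<dots> = adH (adH (adE u)) - (2 * real r + 6) *\<^sub>R adH (adE u) + ((real r + 2) * (real r + 4)) *\<^sub>R adE u"
    unfolding u_def v_def ad_H_commute cbracket_real_linear
    by (rule vector_eqI) (simp add: inner_left_distrib inner_diff_left algebra_simps)
  finally show ?thesis
    using uv by (simp add: core_values_def casimir_space_closed flip: u_def)
qed

text \<open>Division by H - c modulo the image of E. As (H - c) E w = E (H - (c - 2)) w, it suffices
  to solve for w; then a - E w would have weight c > r and is therefore 0.\<close>

lemma image_adE_divide:
  assumes a: "a \<in> G.casimir_space r" and z: "z \<in> G.casimir_space r"
    and c: "c \<ge> int r + 2" and eq: "adH a - real_of_int c *\<^sub>R a = adE z"
  obtains w where "w \<in> G.casimir_space r" "a = adE w"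
proof -
  \<comment> \<open>E stands on both sides since H - (c - 2) need not be onto g(r): it vanishes on
    weight c - 2. This weight can occur only as the top weight r, whose vectors are killed by
    E.\<close>
  let ?S = "{z. \<exists>w\<in>G.casimir_space r. adE z = adE (adH w - (real_of_int c - 2) *\<^sub>R w)}"
  have "z \<in> ?S"
  proof (rule casimir_space_weight_induct[OF z])
    show "G.subspace ?S"
    proof (rule G.subspaceI)
      show "0 \<in> ?S" by (auto intro!: bexI[of _ 0] simp: cbracket_real_linear casimir_space_closed)
      show "x + x' \<in> ?S" if x: "x \<in> ?S" "x' \<in> ?S" for x x'
      proof -
        obtain w w' where "w \<in> G.casimir_space r" "adE x = adE (adH w - (real_of_int c - 2) *\<^sub>R w)"
          "w' \<in> G.casimir_space r" "adE x' = adE (adH w' - (real_of_int c - 2) *\<^sub>R w')"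
          using x by blast
        then show ?thesis
          by (intro CollectI bexI[of _ "w + w'"])
            (simp_all add: cbracket_real_linear casimir_space_closed scaleR_right_distrib)
      qed
      show "cscale d x \<in> ?S" if x: "x \<in> ?S" for d x
      proof -
        obtain w where w: "w \<in> G.casimir_space r" "adE x = adE (adH w - (real_of_int c - 2) *\<^sub>R w)"
          using x by blast
        have "k *\<^sub>R cscale d p = cscale d (k *\<^sub>R p)" for k and p :: "'a \<times> 'a"
          by (simp add: cscale_def algebra_simps)
        then have "adE (cscale d x) = adE (adH (cscale d w) - (real_of_int c - 2) *\<^sub>R cscale d w)"
          unfolding cbracket_linear(3) w(2) by (simp only: cbracket_linear flip: G.scale_right_diff_distrib)
        then show ?thesis using w G.subspace_scale[OF G.subspace_casimir_space] by blast
      qed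
    qed
    fix m x assume m: "\<bar>m\<bar> \<le> int r" and x: "x \<in> G.casimir_space r" "adH x = real_of_int m *\<^sub>R x"
    show "x \<in> ?S"
    proof (cases "m = c - 2")
      case True
      have "adH (adE x) = (real_of_int m + 2) *\<^sub>R adE x"
        by (simp add: ad_H_commute x cbracket_real_linear algebra_simps)
      then have "adE x = 0"
        using high_weight_zero[OF casimir_space_closed(1)[OF x(1)], of _ "m + 2"] True c m by simp
      then show ?thesis by (intro CollectI bexI[of _ 0]) (simp_all add: cbracket_real_linear casimir_space_closed)
    next
      case False
      define d where "d = real_of_int m - (real_of_int c - 2)"
      have "d \<noteq> 0" using False unfolding d_def by linarith
      have "adH ((1 / d) *\<^sub>R x) - (real_of_int c - 2) *\<^sub>R ((1 / d) *\<^sub>R x) = (1 / d) *\<^sub>R (d *\<^sub>R x)"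
        unfolding cbracket_real_linear x(2) d_def scaleR_left_diff_distrib[of "real_of_int m"]
        by (simp only: scaleR_right_diff_distrib scaleR_left_commute)
      also have "\<dots> = x" using \<open>d \<noteq> 0\<close> by simp
      finally show ?thesis using x(1)
        by (intro CollectI bexI[of _ "(1 / d) *\<^sub>R x"]) (simp_all only: casimir_space_closed)
    qed
  qed
  then obtain w where w: "w \<in> G.casimir_space r" "adE z = adE (adH w - (real_of_int c - 2) *\<^sub>R w)" by blast
  have "adH (a - adE w) - real_of_int c *\<^sub>R (a - adE w) = 0"
    using eq unfolding w(2) by (simp add: cbracket_real_linear ad_H_commute algebra_simps)
  then have "adH (a - adE w) = real_of_int c *\<^sub>R (a - adE w)" by simp
  then have "a - adE w = 0"
    using high_weight_zero[of "a - adE w" r _ c] a w c by (simp add: casimir_space_closed)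
  then show ?thesis using that w(1) by simp
qed

text \<open>The equation exhibits (H - r - 2)(H - r - 4) a as a value of E; the two factors are
  divided out one after the other.\<close>

lemma core_values_in_image:
  assumes a: "a \<in> core_values r" shows "a \<in> range adE"
proof -
  have ag: "a \<in> G.casimir_space r" using a by (simp add: core_values_def)
  define b where "b = adH a - real_of_int (int r + 4) *\<^sub>R a"
  have bg: "b \<in> G.casimir_space r" using ag by (simp add: b_def casimir_space_closed)
  have "adH b - real_of_int (int r + 2) *\<^sub>R b =
      adH (adH a) - (2 * real r + 6) *\<^sub>R adH a + ((real r + 2) * (real r + 4)) *\<^sub>R a"
    unfolding b_def cbracket_real_linear
    by (rule vector_eqI) (simp add: inner_left_distrib inner_diff_left algebra_simps)
  also have "\<dots> = adE (4 *\<^sub>R adE (\<Theta> a))"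
    using a by (simp add: core_values_def cbracket_real_linear)
  finally obtain z where z: "z \<in> G.casimir_space r" "b = adE z"
    using image_adE_divide[OF bg, of "4 *\<^sub>R adE (\<Theta> a)" "int r + 2"] ag
    by (auto simp: casimir_space_closed Theta_casimir_space)
  have "int r + 4 \<ge> int r + 2" by simp
  from image_adE_divide[OF ag z(1) this z(2)[unfolded b_def]] show ?thesis by blast
qed

lemma adE_casimir_space_0:
  assumes "y \<in> G.casimir_space 0" shows "adE y = 0"
proof -
  have "y \<in> {y. adE y = 0}"
  proof (rule casimir_space_weight_induct[OF assms])
    show "G.subspace {y. adE y = 0}"
      by (rule G.subspaceI) (simp_all add: cbracket_real_linear cbracket_linear(3))
    fix m x assume m: "\<bar>m\<bar> \<le> int 0" "x \<in> G.casimir_space 0" "adH x = real_of_int m *\<^sub>R x"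
    have "m = 0" using m(1) by simp
    then have "adH (adE x) = 2 *\<^sub>R adE x" unfolding ad_H_commute m(3) by (simp add: cbracket_real_linear)
    then have "adE x = 0"
      by (rule high_weight_zero[OF casimir_space_closed(1)[OF m(2)], of _ 2]) simp_all
    then show "x \<in> {y. adE y = 0}" by blast
  qed
  then show ?thesis by simp
qed

text \<open>E kills weight 1 and H + 1 kills weight - 1. So the solution E (H + r) y of the general
  argument is 0 for r = 1, and no summand of D is required there.\<close>

lemma adE_casimir_space_1:
  assumes "y \<in> G.casimir_space 1" shows "adE (adH y + y) = 0"
proof -
  have "y \<in> {y. adE (adH y + y) = 0}"
  proof (rule casimir_space_weight_induct[OF assms])
    show "G.subspace {y. adE (adH y + y) = 0}"
      by (rule G.subspaceI)
        (simp_all only: mem_Collect_eq cbracket_real_linear cbracket_linear(3) add_0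
          G.scale_zero_right flip: G.scale_right_distrib, simp_all add: algebra_simps)
    fix m x assume m: "\<bar>m\<bar> \<le> int 1" "x \<in> G.casimir_space 1" "adH x = real_of_int m *\<^sub>R x"
    show "x \<in> {y. adE (adH y + y) = 0}"
    proof (cases "m = - 1")
      case True
      then show ?thesis using m(3) by (simp add: cbracket_real_linear)
    next
      case False
      have "adH (adE x) = (real_of_int m + 2) *\<^sub>R adE x"
        by (simp add: ad_H_commute m(3) cbracket_real_linear algebra_simps)
      then have "adE x = 0"
        by (rule high_weight_zero[OF casimir_space_closed(1)[OF m(2)], of _ "m + 2"]) (use False m(1) in simp_all)
      then show ?thesis by (simp add: m(3) cbracket_real_linear)
    qed
  qed
  then show ?thesis by simp
qed

section \<open>Isotypic linear maps\<close>

lemma diagonal_action_values: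
  assumes "\<Phi> \<in> Hom_s W"
  shows "diagonal_action br \<Phi>0 sl2_e \<Phi> sl2_e = adE (\<Phi> sl2_e)"
    "diagonal_action br \<Phi>0 sl2_e \<Phi> sl2_h = adE (\<Phi> sl2_h) + 2 *\<^sub>R \<Phi> sl2_e"
    "diagonal_action br \<Phi>0 sl2_e \<Phi> sl2_f = adE (\<Phi> sl2_f) - \<Phi> sl2_h"
    "diagonal_action br \<Phi>0 sl2_f \<Phi> sl2_e = adF (\<Phi> sl2_e) + \<Phi> sl2_h"
    "diagonal_action br \<Phi>0 sl2_f \<Phi> sl2_h = adF (\<Phi> sl2_h) - 2 *\<^sub>R \<Phi> sl2_f"
    "diagonal_action br \<Phi>0 sl2_f \<Phi> sl2_f = adF (\<Phi> sl2_f)"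
    "diagonal_action br \<Phi>0 sl2_h \<Phi> sl2_e = adH (\<Phi> sl2_e) - 2 *\<^sub>R \<Phi> sl2_e"
    "diagonal_action br \<Phi>0 sl2_h \<Phi> sl2_h = adH (\<Phi> sl2_h)"
    "diagonal_action br \<Phi>0 sl2_h \<Phi> sl2_f = adH (\<Phi> sl2_f) + 2 *\<^sub>R \<Phi> sl2_f"
proof -
  interpret P: Vector_Spaces.linear sl2_scale cscale \<Phi> using assms by (simp add: Hom_s_def)
  show "diagonal_action br \<Phi>0 sl2_e \<Phi> sl2_e = adE (\<Phi> sl2_e)"
    "diagonal_action br \<Phi>0 sl2_e \<Phi> sl2_h = adE (\<Phi> sl2_h) + 2 *\<^sub>R \<Phi> sl2_e"
    "diagonal_action br \<Phi>0 sl2_e \<Phi> sl2_f = adE (\<Phi> sl2_f) - \<Phi> sl2_h"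
    "diagonal_action br \<Phi>0 sl2_f \<Phi> sl2_e = adF (\<Phi> sl2_e) + \<Phi> sl2_h"
    "diagonal_action br \<Phi>0 sl2_f \<Phi> sl2_h = adF (\<Phi> sl2_h) - 2 *\<^sub>R \<Phi> sl2_f"
    "diagonal_action br \<Phi>0 sl2_f \<Phi> sl2_f = adF (\<Phi> sl2_f)"
    "diagonal_action br \<Phi>0 sl2_h \<Phi> sl2_e = adH (\<Phi> sl2_e) - 2 *\<^sub>R \<Phi> sl2_e"
    "diagonal_action br \<Phi>0 sl2_h \<Phi> sl2_h = adH (\<Phi> sl2_h)"
    "diagonal_action br \<Phi>0 sl2_h \<Phi> sl2_f = adH (\<Phi> sl2_f) + 2 *\<^sub>R \<Phi> sl2_f"
    by (simp_all add: diagonal_action_def sl2_brackets P.scale P.neg P.zero cscale_numeral)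
qed

text \<open>These equations are the Casimir equation of the diagonal action evaluated at e, h and f.
  Inserting the eigenvalue r (r + 2) of g(r) leaves the mixed term, with a common factor 4; the
  coefficient r + 2 is forced by (r - 2) r + 4 (r + 2) = r (r + 2) + 8.\<close>

lemma isotypic_Hom_iff:
  assumes r: "r \<ge> 2"
  shows "\<Phi> \<in> isotypic hom_scale (diagonal_action br \<Phi>0) (Hom_s (g_isotypic br \<Phi>0 r)) (r - 2) \<longleftrightarrow>
    \<Phi> \<in> Hom_s (G.casimir_space r) \<and>
    (real r + 2) *\<^sub>R \<Phi> sl2_e = adH (\<Phi> sl2_e) - adE (\<Phi> sl2_h) \<and>
    (real r + 2) *\<^sub>R \<Phi> sl2_h = 2 *\<^sub>R (adE (\<Phi> sl2_f) - adF (\<Phi> sl2_e)) \<and>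
    (real r + 2) *\<^sub>R \<Phi> sl2_f = adF (\<Phi> sl2_h) - adH (\<Phi> sl2_f)"
proof (cases "\<Phi> \<in> Hom_s (G.casimir_space r)")
  case True
  interpret R: sl2_module hom_scale "diagonal_action br \<Phi>0" "Hom_s (G.casimir_space r)" "r + 2"
    by (rule sl2_module_Hom_s)
  let ?C = "R.casimir \<Phi>"
  note D = diagonal_action_in_Hom_s[OF True]
  note val = diagonal_action_values[OF True] diagonal_action_values[OF D]
  have mem: "\<Phi> u \<in> G.casimir_space r" for u using True by (simp add: Hom_s_iff)
  have cas: "adH (adH (\<Phi> u)) + 2 *\<^sub>R adH (\<Phi> u) + 4 *\<^sub>R adF (adE (\<Phi> u)) = (real r * (real r + 2)) *\<^sub>R \<Phi> u" for u
    using mem[of u] by (simp only: casimir_space_iff casimir_real)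
  have C_u: "?C u = diagonal_action br \<Phi>0 sl2_h (diagonal_action br \<Phi>0 sl2_h \<Phi>) u +
      2 *\<^sub>R diagonal_action br \<Phi>0 sl2_h \<Phi> u + 4 *\<^sub>R diagonal_action br \<Phi>0 sl2_f (diagonal_action br \<Phi>0 sl2_e \<Phi>) u" for u
    by (simp add: R.casimir_def hom_scale_def cscale_numeral)
  define c where "c = (real r - 2) * real r"
  have vec: "?C sl2_e - c *\<^sub>R \<Phi> sl2_e = 4 *\<^sub>R ((real r + 2) *\<^sub>R \<Phi> sl2_e - (adH (\<Phi> sl2_e) - adE (\<Phi> sl2_h)))"
    "?C sl2_h - c *\<^sub>R \<Phi> sl2_h = 4 *\<^sub>R ((real r + 2) *\<^sub>R \<Phi> sl2_h - 2 *\<^sub>R (adE (\<Phi> sl2_f) - adF (\<Phi> sl2_e)))"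
    "?C sl2_f - c *\<^sub>R \<Phi> sl2_f = 4 *\<^sub>R ((real r + 2) *\<^sub>R \<Phi> sl2_f - (adF (\<Phi> sl2_h) - adH (\<Phi> sl2_f)))"
    unfolding C_u val c_def cbracket_real_linear
    by (rule vector_eqI; insert arg_cong[OF cas, of "\<lambda>p. p \<bullet> b" for b];
        simp add: inner_left_distrib inner_diff_left algebra_simps)+
  have "(of_nat ((r - 2) * (r - 2 + 2)) :: complex) = of_real c"
  proof -
    \<comment> \<open>The subtraction is the truncated one on naturals, so r \<ge> 2 is
      essential.\<close>
    have "r - 2 + 2 = r" using r by simp
    then show ?thesis using r by (simp only: c_def of_nat_mult of_nat_diff of_real_mult of_real_diff) simp
  qed
  then have "hom_scale (of_nat ((r - 2) * (r - 2 + 2))) \<Phi> = hom_scale (of_real c) \<Phi>" by (simp only:)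
  moreover have "?C = hom_scale (of_real c) \<Phi> \<longleftrightarrow> ?C sl2_e = c *\<^sub>R \<Phi> sl2_e \<and> ?C sl2_h = c *\<^sub>R \<Phi> sl2_h \<and> ?C sl2_f = c *\<^sub>R \<Phi> sl2_f"
  proof
    assume "?C = hom_scale (of_real c) \<Phi>"
    then show "?C sl2_e = c *\<^sub>R \<Phi> sl2_e \<and> ?C sl2_h = c *\<^sub>R \<Phi> sl2_h \<and> ?C sl2_f = c *\<^sub>R \<Phi> sl2_f"
      by (simp add: hom_scale_def cscale_of_real)
  next
    assume "?C sl2_e = c *\<^sub>R \<Phi> sl2_e \<and> ?C sl2_h = c *\<^sub>R \<Phi> sl2_h \<and> ?C sl2_f = c *\<^sub>R \<Phi> sl2_f"
    then show "?C = hom_scale (of_real c) \<Phi>"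
      by (intro Hom_s_eqI[OF R.casimir_V[OF True] R.V_closed(7)[OF True]])
        (simp_all add: hom_scale_def cscale_of_real)
  qed
  ultimately have "?C = hom_scale (of_nat ((r - 2) * (r - 2 + 2))) \<Phi> \<longleftrightarrow>
      ?C sl2_e - c *\<^sub>R \<Phi> sl2_e = 0 \<and> ?C sl2_h - c *\<^sub>R \<Phi> sl2_h = 0 \<and> ?C sl2_f - c *\<^sub>R \<Phi> sl2_f = 0"
    by (simp only: right_minus_eq)
  then have "?C = hom_scale (of_nat ((r - 2) * (r - 2 + 2))) \<Phi> \<longleftrightarrow>
    (real r + 2) *\<^sub>R \<Phi> sl2_e = adH (\<Phi> sl2_e) - adE (\<Phi> sl2_h) \<and>
    (real r + 2) *\<^sub>R \<Phi> sl2_h = 2 *\<^sub>R (adE (\<Phi> sl2_f) - adF (\<Phi> sl2_e)) \<and>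
    (real r + 2) *\<^sub>R \<Phi> sl2_f = adF (\<Phi> sl2_h) - adH (\<Phi> sl2_f)"
    unfolding vec scaleR_eq_0_iff right_minus_eq by (simp only: zero_neq_numeral[symmetric] simp_thms)
  then show ?thesis
    unfolding g_isotypic_eq R.isotypic_eq_casimir_space R.casimir_space_def
    using True by blast
next
  case False
  interpret R: sl2_module hom_scale "diagonal_action br \<Phi>0" "Hom_s (G.casimir_space r)" "r + 2"
    by (rule sl2_module_Hom_s)
  show ?thesis
    using False by (simp add: g_isotypic_eq R.isotypic_eq_casimir_space R.casimir_space_def)
qed

lemma Hom_theta_values:
  assumes "\<Phi> \<in> Hom_theta \<theta>"
  shows "\<Phi> sl2_f = - \<Theta> (\<Phi> sl2_e)" "\<Theta> (\<Phi> sl2_h) = - \<Phi> sl2_h"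
proof -
  interpret P: Vector_Spaces.linear sl2_scale cscale \<Phi> using assms by (simp add: Hom_theta_def Hom_s_def)
  have "\<Theta> (\<Phi> u) = \<Phi> (sl2_theta u)" for u using assms by (auto simp: Hom_theta_def fun_eq_iff)
  then show "\<Phi> sl2_f = - \<Theta> (\<Phi> sl2_e)" "\<Theta> (\<Phi> sl2_h) = - \<Phi> sl2_h"
    by (simp_all add: sl2_theta_triple P.neg)
qed

lemma Hom_theta_isotypicD:
  assumes r: "r \<ge> 2" and \<Phi>: "\<Phi> \<in> Hom_theta_isotypic br \<theta> \<Phi>0 r (r - 2)"
  shows "\<Phi> sl2_e \<in> core_values r" and "\<Phi> sl2_e = 0 \<Longrightarrow> \<Phi> = 0"
proof -
  have th: "\<Phi> \<in> Hom_theta \<theta>" and hs: "\<Phi> \<in> Hom_s (G.casimir_space r)"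
    and eqs: "(real r + 2) *\<^sub>R \<Phi> sl2_e = adH (\<Phi> sl2_e) - adE (\<Phi> sl2_h)"
    "(real r + 2) *\<^sub>R \<Phi> sl2_h = 2 *\<^sub>R (adE (\<Phi> sl2_f) - adF (\<Phi> sl2_e))"
    using \<Phi> unfolding Hom_theta_isotypic_def by (auto simp: isotypic_Hom_iff[OF r])
  note val = Hom_theta_values[OF th]
  define a where "a = \<Phi> sl2_e"
  have ag: "a \<in> G.casimir_space r" using hs by (simp add: Hom_s_iff a_def)
  \<comment> \<open>Multiplying the equation at e by r + 2 allows the equation at h to be inserted
    without dividing. The product EF is then removed by the Casimir relation on g(r).\<close>
  have "(real r + 2) *\<^sub>R ((real r + 2) *\<^sub>R a) = (real r + 2) *\<^sub>R adH a - adE ((real r + 2) *\<^sub>R \<Phi> sl2_h)"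
    using eqs(1) by (simp add: cbracket_real_linear scaleR_right_diff_distrib flip: a_def)
  also have "\<dots> = (real r + 2) *\<^sub>R adH a + 2 *\<^sub>R adE (adE (\<Theta> a)) + 2 *\<^sub>R adE (adF a)"
    unfolding eqs(2) val by (simp add: cbracket_real_linear scaleR_right_distrib scaleR_right_diff_distrib flip: a_def)
  finally have *: "(real r + 2) *\<^sub>R ((real r + 2) *\<^sub>R a) =
      (real r + 2) *\<^sub>R adH a + 2 *\<^sub>R adE (adE (\<Theta> a)) + 2 *\<^sub>R adE (adF a)" .
  have "adH (adH a) - (2 * real r + 6) *\<^sub>R adH a + ((real r + 2) * (real r + 4)) *\<^sub>R a = 4 *\<^sub>R adE (adE (\<Theta> a))"
  proof (rule vector_eqI)
    fix b
    show "(adH (adH a) - (2 * real r + 6) *\<^sub>R adH a + ((real r + 2) * (real r + 4)) *\<^sub>R a) \<bullet> b =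
        (4 *\<^sub>R adE (adE (\<Theta> a))) \<bullet> b"
      using arg_cong[OF *, of "\<lambda>p. p \<bullet> b"] arg_cong[OF casimir_space_EF[OF ag], of "\<lambda>p. p \<bullet> b"]
      by (simp add: inner_left_distrib inner_diff_left algebra_simps)
  qed
  then show "\<Phi> sl2_e \<in> core_values r" using ag unfolding core_values_def a_def by blast
  assume z: "\<Phi> sl2_e = 0"
  have "real r + 2 \<noteq> 0" by simp
  then have "\<Phi> sl2_h = 0" "\<Phi> sl2_f = 0"
    using eqs(2) unfolding val z by (simp_all add: Theta_linear cbracket_real_linear)
  moreover have "0 \<in> Hom_s (G.casimir_space r)"
    by (simp add: Hom_s_iff casimir_space_closed G.scale_zero_right)
  ultimately show "\<Phi> = 0" using z by (intro Hom_s_eqI[OF hs]) auto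
qed

lemma core_values_attained:
  assumes r: "r \<ge> 2" and a: "a \<in> core_values r"
  obtains \<Phi> where "\<Phi> \<in> Hom_theta_isotypic br \<theta> \<Phi>0 r (r - 2)" "\<Phi> sl2_e = a"
proof -
  have ag: "a \<in> G.casimir_space r"
    and eq: "adH (adH a) - (2 * real r + 6) *\<^sub>R adH a + ((real r + 2) * (real r + 4)) *\<^sub>R a = 4 *\<^sub>R adE (adE (\<Theta> a))"
    using a by (auto simp: core_values_def)
  define R where "R = real r + 2"
  have R: "R > 0" by (simp add: R_def)
  \<comment> \<open>With the value - \<Theta> a at f, the equation at h determines b.\<close>
  define b where "b = (- 2 / R) *\<^sub>R (adE (\<Theta> a) + adF a)"
  define c where "c = - \<Theta> a"
  define \<Phi> where "\<Phi> = hom_of_values a b c"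
  have val: "\<Phi> sl2_e = a" "\<Phi> sl2_h = b" "\<Phi> sl2_f = c" by (simp_all add: \<Phi>_def hom_of_values_triple)
  have g: "b \<in> G.casimir_space r" "c \<in> G.casimir_space r"
    using ag by (simp_all only: b_def c_def casimir_space_closed Theta_casimir_space)
  have hs: "\<Phi> \<in> Hom_s (G.casimir_space r)"
    unfolding \<Phi>_def by (rule hom_of_values_in_Hom_s[OF G.subspace_casimir_space ag g])
  have theta_b: "\<Theta> b = - b" by (simp add: b_def Theta_linear Theta_ad scaleR_right_distrib)
  have Rb: "R *\<^sub>R b = - (2 *\<^sub>R (adE (\<Theta> a) + adF a))" using R by (simp add: b_def)
  have eq_e: "R *\<^sub>R a = adH a - adE b"
  proof -
    have "R *\<^sub>R (R *\<^sub>R a) = R *\<^sub>R (adH a - adE b)"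
    proof -
      have "R *\<^sub>R (adH a - adE b) = R *\<^sub>R adH a - adE (R *\<^sub>R b)"
        by (simp add: cbracket_real_linear scaleR_right_diff_distrib)
      also have "\<dots> = R *\<^sub>R adH a + 2 *\<^sub>R adE (adE (\<Theta> a)) + 2 *\<^sub>R adE (adF a)"
        unfolding Rb by (simp add: cbracket_real_linear scaleR_right_distrib)
      also have "\<dots> = R *\<^sub>R (R *\<^sub>R a)"
      proof (rule vector_eqI)
        fix d
        show "(R *\<^sub>R adH a + 2 *\<^sub>R adE (adE (\<Theta> a)) + 2 *\<^sub>R adE (adF a)) \<bullet> d = (R *\<^sub>R R *\<^sub>R a) \<bullet> d"
          using arg_cong[OF eq, of "\<lambda>p. p \<bullet> d"] arg_cong[OF casimir_space_EF[OF ag], of "\<lambda>p. p \<bullet> d"]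
          by (simp add: R_def inner_left_distrib inner_diff_left algebra_simps)
      qed
      finally show ?thesis by simp
    qed
    then show ?thesis using R by (simp only: scaleR_cancel_left) simp
  qed
  \<comment> \<open>The equation at f is the image of the equation at e under - \<Theta>.\<close>
  have "R *\<^sub>R c = - \<Theta> (R *\<^sub>R a)" by (simp add: c_def Theta_linear)
  also have "\<dots> = adF b - adH c"
    unfolding eq_e by (simp add: Theta_linear Theta_ad theta_b c_def cbracket_real_linear)
  finally have eq_f: "R *\<^sub>R c = adF b - adH c" .
  have eq_h: "R *\<^sub>R b = 2 *\<^sub>R (adE c - adF a)"
    unfolding Rb by (simp add: c_def cbracket_real_linear scaleR_right_distrib scaleR_right_diff_distrib)
  have "\<Phi> \<in> isotypic hom_scale (diagonal_action br \<Phi>0) (Hom_s (g_isotypic br \<Phi>0 r)) (r - 2)"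
    unfolding isotypic_Hom_iff[OF r] val using hs eq_e eq_h eq_f unfolding R_def by blast
  moreover have "\<Phi> \<in> Hom_theta \<theta>"
  proof -
    have "\<Theta> (\<Phi> u) = \<Phi> (sl2_theta u)" for u
      by (simp add: \<Phi>_def hom_of_values_def Theta_linear theta_b mat_of_theta c_def algebra_simps)
    then show ?thesis using hs by (auto simp: Hom_theta_def Hom_s_def fun_eq_iff)
  qed
  ultimately show ?thesis using that val by (auto simp: Hom_theta_isotypic_def)
qed

lemma subspace_Hom_theta_isotypic: "HS.subspace (Hom_theta_isotypic br \<theta> \<Phi>0 r r')"
proof -
  have "HS.subspace (Hom_s UNIV :: (sl2 \<Rightarrow> 'a \<times> 'a) set)"
    by (rule subspace_Hom_s) simp
  then have "HS.subspace (Hom_theta \<theta>)"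
    unfolding Hom_theta_def HS.subspace_def
    by (auto simp: fun_eq_iff hom_scale_def Theta_linear)
  then show ?thesis
    unfolding Hom_theta_isotypic_def isotypic_def by (intro HS.subspace_inter) auto
qed

section \<open>The image of evaluation at e\<close>

lemma linear_evaluation: "Vector_Spaces.linear hom_scale cscale (\<lambda>\<Phi> :: sl2 \<Rightarrow> 'a \<times> 'a. \<Phi> u)"
  by (simp add: linear_vector_spaces_iff vector_space_hom_scale vector_space_cscale hom_scale_def)

lemma evaluation_d_space:
  "(\<lambda>\<Phi>. \<Phi> sl2_e) ` d_space br \<theta> \<Phi>0 = G.span (\<Union>r\<in>{2..}. core_values r)"
proof -
  interpret ev: Vector_Spaces.linear hom_scale cscale "\<lambda>\<Phi> :: sl2 \<Rightarrow> 'a \<times> 'a. \<Phi> sl2_e"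
    by (rule linear_evaluation)
  have "(\<lambda>\<Phi>. \<Phi> sl2_e) ` Hom_theta_isotypic br \<theta> \<Phi>0 r (r - 2) = core_values r" if "r \<ge> 2" for r
  proof
    show "(\<lambda>\<Phi>. \<Phi> sl2_e) ` Hom_theta_isotypic br \<theta> \<Phi>0 r (r - 2) \<subseteq> core_values r"
      using Hom_theta_isotypicD(1)[OF that] by blast
    show "core_values r \<subseteq> (\<lambda>\<Phi>. \<Phi> sl2_e) ` Hom_theta_isotypic br \<theta> \<Phi>0 r (r - 2)"
    proof
      fix a assume "a \<in> core_values r"
      with that obtain \<Phi> where "\<Phi> \<in> Hom_theta_isotypic br \<theta> \<Phi>0 r (r - 2)" "\<Phi> sl2_e = a"
        by (rule core_values_attained)
      then show "a \<in> (\<lambda>\<Phi>. \<Phi> sl2_e) ` Hom_theta_isotypic br \<theta> \<Phi>0 r (r - 2)" by blast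
    qed
  qed
  then have "(\<lambda>\<Phi>. \<Phi> sl2_e) ` (\<Union>r\<in>{2..}. Hom_theta_isotypic br \<theta> \<Phi>0 r (r - 2)) = (\<Union>r\<in>{2..}. core_values r)"
    unfolding image_UN by (intro SUP_cong) auto
  then show ?thesis unfolding d_space_def ev.span_image[symmetric] by (simp only:)
qed

lemma casimir_sum_zero:
  assumes "finite J" "\<And>r. r \<in> J \<Longrightarrow> v r \<in> G.casimir_space r" "(\<Sum>r\<in>J. v r) = 0" "r \<in> J"
  shows "v r = 0"
proof -
  have "G.casimir (v r) = cscale (of_nat (r * (r + 2))) (v r)" if "r \<in> J" for r
    using assms(2)[OF that] unfolding G.casimir_space_def by blast
  then show ?thesis
    using G.sum_eigenvectors_eq_zero[OF G.linear_casimir assms(1) inj_on_subset[OF G.inj_casimir_eigenvalue subset_UNIV], of v]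
      assms(3,4) by blast
qed

text \<open>Values at e for different r lie in different Casimir eigenspaces, and each map is
  determined by its value. Both the directness of the sum and the injectivity of evaluation follow
  from this one statement.\<close>

lemma Hom_theta_isotypic_sum_zero:
  assumes J: "finite J" "J \<subseteq> {2..}" "\<And>r. r \<in> J \<Longrightarrow> v r \<in> Hom_theta_isotypic br \<theta> \<Phi>0 r (r - 2)"
    and sum: "(\<Sum>r\<in>J. v r sl2_e) = 0" and r: "r \<in> J"
  shows "v r = 0"
proof -
  have r2: "k \<ge> 2" if "k \<in> J" for k using J(2) that by auto
  have "v r sl2_e = 0"
  proof (rule casimir_sum_zero[OF J(1) _ sum r])
    show "v k sl2_e \<in> G.casimir_space k" if "k \<in> J" for k
      using Hom_theta_isotypicD(1)[OF r2[OF that] J(3)[OF that]] by (simp add: core_values_def)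
  qed
  then show ?thesis using Hom_theta_isotypicD(2)[OF r2[OF r] J(3)[OF r]] by blast
qed

lemma sum_fun_apply: "(\<Sum>r\<in>J. v r) u = (\<Sum>r\<in>J. v r u)" for v :: "nat \<Rightarrow> sl2 \<Rightarrow> 'a \<times> 'a"
  by (induction J rule: infinite_finite_induct) auto

lemma independent_Hom_theta_isotypic:
  "independent_subspaces {2..} (\<lambda>r. Hom_theta_isotypic br \<theta> \<Phi>0 r (r - 2))"
  unfolding independent_subspaces_def
proof (intro allI impI ballI)
  fix J and v :: "nat \<Rightarrow> sl2 \<Rightarrow> 'a \<times> 'a" and r
  assume J: "finite J \<and> J \<subseteq> {2..} \<and> (\<forall>i\<in>J. v i \<in> Hom_theta_isotypic br \<theta> \<Phi>0 i (i - 2)) \<and> sum v J = 0"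
    and r: "r \<in> J"
  have "(\<Sum>r\<in>J. v r sl2_e) = 0" using J by (simp flip: sum_fun_apply)
  then show "v r = 0" using Hom_theta_isotypic_sum_zero[of J v r] J r by blast
qed

lemma inj_on_evaluation: "inj_on (\<lambda>\<Phi>. \<Phi> sl2_e) (d_space br \<theta> \<Phi>0)"
proof (rule inj_onI)
  fix \<Phi> \<Psi> assume "\<Phi> \<in> d_space br \<theta> \<Phi>0" "\<Psi> \<in> d_space br \<theta> \<Phi>0" and eq: "\<Phi> sl2_e = \<Psi> sl2_e"
  then have "\<Phi> - \<Psi> \<in> HS.span (\<Union>r\<in>{2..}. Hom_theta_isotypic br \<theta> \<Phi>0 r (r - 2))"
    unfolding d_space_def by (intro HS.span_diff)
  then obtain J v where J: "finite J" "J \<subseteq> {2..}"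
    and v: "\<And>r. r \<in> {2..} \<Longrightarrow> v r \<in> Hom_theta_isotypic br \<theta> \<Phi>0 r (r - 2)" and sum: "\<Phi> - \<Psi> = (\<Sum>r\<in>J. v r)"
    by (rule HS.span_UN_subspacesE[OF subspace_Hom_theta_isotypic]) (rule that)
  have "(\<Sum>r\<in>J. v r sl2_e) = (\<Phi> - \<Psi>) sl2_e" by (simp only: sum sum_fun_apply)
  then have "(\<Sum>r\<in>J. v r sl2_e) = 0" using eq by simp
  then have "\<forall>r\<in>J. v r = 0" using Hom_theta_isotypic_sum_zero[OF J] v J(2) by blast
  then show "\<Phi> = \<Psi>" using sum by simp
qed

text \<open>\<open>T\<close> will be an element of the isotropy group (\<open>\<sigma> = id\<close>) or complex conjugation (\<open>\<sigma> = cnj\<close>).\<close>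

lemma span_core_values_stable:
  assumes add: "\<And>p q. T (p + q) = T p + T q" and sc: "\<And>c p. T (cscale c p) = cscale (\<sigma> c) (T p)"
    and real: "\<And>c p. T (c *\<^sub>R p) = c *\<^sub>R T p"
    and comm: "\<And>p. T (adE p) = adE (T p)" "\<And>p. T (adF p) = adF (T p)" "\<And>p. T (adH p) = adH (T p)"
      "\<And>p. T (\<Theta> p) = \<Theta> (T p)"
    and a: "a \<in> G.span (\<Union>r\<in>{2..}. core_values r)"
  shows "T a \<in> G.span (\<Union>r\<in>{2..}. core_values r)"
proof -
  have zero: "T 0 = 0" using real[of 0 0] by simp
  have diff: "T (p - q) = T p - T q" for p q using add[of "p - q" q] by (simp add: algebra_simps)
  have "T a \<in> core_values r" if "a \<in> core_values r" for a r
  proof -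
    have "G.casimir (T a) = T (G.casimir a)" by (simp add: casimir_real add real comm)
    then have "T a \<in> G.casimir_space r"
      using that by (simp add: core_values_def casimir_space_iff real)
    moreover have "adH (adH (T a)) - (2 * real r + 6) *\<^sub>R adH (T a) + ((real r + 2) * (real r + 4)) *\<^sub>R T a =
        T (adH (adH a) - (2 * real r + 6) *\<^sub>R adH a + ((real r + 2) * (real r + 4)) *\<^sub>R a)"
      by (simp only: add diff real comm)
    ultimately show ?thesis using that by (simp add: core_values_def real comm)
  qed
  then have "(\<Union>r\<in>{2..}. core_values r) \<subseteq> {a. T a \<in> G.span (\<Union>r\<in>{2..}. core_values r)}"
    by (auto intro!: G.span_base)
  moreover have "G.subspace {a. T a \<in> G.span (\<Union>r\<in>{2..}. core_values r)}"
    by (rule G.subspaceI) (auto simp: zero add sc G.span_zero intro: G.span_add G.span_scale)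
  ultimately show ?thesis using G.span_minimal a by blast
qed

lemma defined_over_R_span_core_values: "defined_over_R (G.span (\<Union>r\<in>{2..}. core_values r))"
proof -
  define D where "D = G.span (\<Union>r\<in>{2..}. core_values r)"
  have sub: "G.subspace D" by (simp add: D_def)
  have conj: "(x, - y) \<in> D" if "(x, y) \<in> D" for x y
  proof -
    define T :: "'a \<times> 'a \<Rightarrow> 'a \<times> 'a" where "T p = (fst p, - snd p)" for p
    have ad: "T (cextend (br x) p) = cextend (br x) (T p)" for x p
      by (simp add: T_def cextend_def br_simps)
    have "T (x, y) \<in> D"
      unfolding D_def
    proof (rule span_core_values_stable[where T = T and \<sigma> = cnj])
      show "T (\<Theta> p) = \<Theta> (T p)" for p by (simp add: T_def cextend_def theta_simps)
      show "T (cscale c p) = cscale (cnj c) (T p)" for c p by (simp add: T_def cscale_def)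
    qed (use that D_def ad in \<open>simp_all add: Phi0_e Phi0_f' Phi0_h cbracket_of_gR, simp_all add: T_def\<close>)
    then show ?thesis by (simp add: T_def)
  qed
  have "D = complexify {x. of_gR x \<in> D}"
  proof (intro equalityI subsetI)
    fix p assume p: "p \<in> D"
    obtain x y where xy: "p = (x, y)" by (cases p)
    \<comment> \<open>Real and imaginary part are complex combinations of p and its conjugate, which
      also lies in D.\<close>
    have "cscale (1 / 2) (p + (x, - y)) \<in> D" "cscale (- \<i> / 2) (p - (x, - y)) \<in> D"
      using p conj[of x y] sub unfolding xy by (blast intro: G.subspace_add G.subspace_diff G.subspace_scale)+
    moreover have "cscale (1 / 2) (p + (x, - y)) = of_gR x" "cscale (- \<i> / 2) (p - (x, - y)) = of_gR y"
      by (simp_all add: xy cscale_def of_gR_def flip: scaleR_2)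
    ultimately show "p \<in> complexify {x. of_gR x \<in> D}" by (simp add: complexify_def xy)
  next
    fix p assume "p \<in> complexify {x. of_gR x \<in> D}"
    then have "of_gR (fst p) + cscale \<i> (of_gR (snd p)) \<in> D"
      by (auto simp: complexify_def intro!: G.subspace_add[OF sub] G.subspace_scale[OF sub])
    then show "p \<in> D" by (simp add: of_gR_def cscale_def)
  qed
  then show ?thesis by (simp add: defined_over_R_def D_def)
qed

lemma casimir_decomposition:
  obtains J v where "finite J" "\<And>r. v r \<in> G.casimir_space r" "\<And>r. r \<notin> J \<Longrightarrow> v r = 0" "y = (\<Sum>r\<in>J. v r)"
proof -
  have "y \<in> G.span (\<Union>r\<in>UNIV. G.casimir_space r)" using G.V_eq_span_casimir_spaces by blast
  then show ?thesis
    using that G.span_UN_subspacesE[of UNIV G.casimir_space y] G.subspace_casimir_space by (metis UNIV_I)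
qed

text \<open>Reduction to a single r: \<Theta> and E preserve the Casimir eigenspaces, so over a
  common index set each component of \<kappa> is fixed by \<Theta> and is sent by E to the
  corresponding component of a.\<close>

lemma span_core_values_inter:
  assumes a: "a \<in> G.span (\<Union>r\<in>{2..}. core_values r)" and eq: "a = adE \<kappa>" and k: "\<Theta> \<kappa> = \<kappa>"
  shows "a = 0"
proof -
  obtain I v where I: "finite I" "I \<subseteq> {2..}" "\<And>r. r \<in> {2..} \<Longrightarrow> v r \<in> core_values r"
    "\<And>r. r \<notin> I \<Longrightarrow> v r = 0" "a = (\<Sum>r\<in>I. v r)"
    by (rule G.span_UN_subspacesE[OF subspace_core_values a]) (rule that)
  obtain J w where J: "finite J" "\<And>r. w r \<in> G.casimir_space r" "\<And>r. r \<notin> J \<Longrightarrow> w r = 0"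
    "\<kappa> = (\<Sum>r\<in>J. w r)" using casimir_decomposition[of \<kappa>] by metis
  have sums: "a = (\<Sum>r\<in>I \<union> J. v r)" "\<kappa> = (\<Sum>r\<in>I \<union> J. w r)"
    using I J by (auto intro!: sum.mono_neutral_left)
  have Theta_sum: "\<Theta> (\<Sum>r\<in>S. f r) = (\<Sum>r\<in>S. \<Theta> (f r))" for S :: "nat set" and f
    by (induction S rule: infinite_finite_induct) (auto simp: Theta_linear)
  have v_mem: "v r \<in> G.casimir_space r" for r
    using I(2-4) casimir_space_closed(8) by (cases "r \<in> I") (auto simp: core_values_def)
  have "(\<Sum>r\<in>I \<union> J. \<Theta> (w r) - w r) = 0"
    using k unfolding sums(2) Theta_sum sum_subtractf by simp
  then have fixed: "\<Theta> (w r) = w r" if "r \<in> I \<union> J" for r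
    using casimir_sum_zero[of "I \<union> J" "\<lambda>r. \<Theta> (w r) - w r" r] that I(1) J(1,2)
    by (simp add: casimir_space_closed Theta_casimir_space)
  have "(\<Sum>r\<in>I \<union> J. v r - adE (w r)) = 0"
    using eq unfolding sums sum_subtractf G.E.sum by simp
  then have vE: "v r = adE (w r)" if "r \<in> I \<union> J" for r
    using casimir_sum_zero[of "I \<union> J" "\<lambda>r. v r - adE (w r)" r] that I(1) J(1,2) v_mem
    by (simp add: casimir_space_closed)
  have "v r = 0" if r: "r \<in> I" for r
  proof -
    have "r \<ge> 2" using I(2) r by auto
    then have "adE (w r) \<in> core_values r" "r \<noteq> 0" using I(3)[of r] vE[of r] r by auto
    then show ?thesis using core_values_inter[OF J(2) fixed] vE[of r] r by simp
  qed
  then show ?thesis using I(5) by simp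
qed

text \<open>A fixed y serves as its own \<kappa>. For an anti-fixed y in g(r) with r > 0, \<kappa> =
  - (1/r) H y works; it is fixed because both H and y change sign under \<Theta>. In general y is
  split into its Casimir components and these into fixed and anti-fixed parts.\<close>

lemma adE_decomposition:
  "\<exists>a \<in> G.span (\<Union>r\<in>{2..}. core_values r). \<exists>\<kappa>. \<Theta> \<kappa> = \<kappa> \<and> adE y = a + adE \<kappa>"
proof -
  let ?D = "G.span (\<Union>r\<in>{2..}. core_values r)"
  let ?P = "\<lambda>y. \<exists>a \<in> ?D. \<exists>\<kappa>. \<Theta> \<kappa> = \<kappa> \<and> adE y = a + adE \<kappa>"
  have add: "?P (x + y)" if x: "?P x" and y: "?P y" for x y
  proof -
    obtain a \<kappa> b \<mu> where "a \<in> ?D" "\<Theta> \<kappa> = \<kappa>" "adE x = a + adE \<kappa>" "b \<in> ?D" "\<Theta> \<mu> = \<mu>" "adE y = b + adE \<mu>"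
      using x y by blast
    then show ?thesis
      by (intro bexI[of _ "a + b"] exI[of _ "\<kappa> + \<mu>"])
        (auto simp: cbracket_real_linear Theta_linear intro: G.span_add)
  qed
  have fixed: "?P \<kappa>" if "\<Theta> \<kappa> = \<kappa>" for \<kappa>
    using that by (intro bexI[of _ 0] exI[of _ \<kappa>]) (simp_all add: G.span_zero)
  have anti: "?P y" if y: "y \<in> G.casimir_space r" "\<Theta> y = - y" for y r
  proof (cases "r = 0")
    case True
    then have "adE y = 0" using adE_casimir_space_0 y by simp
    then show ?thesis by (intro bexI[of _ 0] exI[of _ 0]) (auto simp: G.span_zero Theta_linear cbracket_real_linear)
  next
    case False
    define b where "b = adE (adH y + real r *\<^sub>R y)"
    have "b \<in> ?D"
    proof (cases "r = 1")
      case True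
      then show ?thesis using adE_casimir_space_1 y by (simp add: b_def G.span_zero)
    next
      case False
      with \<open>r \<noteq> 0\<close> have "r \<ge> 2" by simp
      then show ?thesis using core_values_surj[OF y] by (auto simp: b_def intro!: G.span_base)
    qed
    then have "(1 / real r) *\<^sub>R b \<in> ?D" by (simp add: G.span_scale flip: cscale_of_real)
    moreover have "\<Theta> ((- 1 / real r) *\<^sub>R adH y) = (- 1 / real r) *\<^sub>R adH y"
      by (simp add: Theta_linear Theta_ad y cbracket_real_linear)
    moreover have "adE y = (1 / real r) *\<^sub>R b + adE ((- 1 / real r) *\<^sub>R adH y)"
      using False by (simp add: b_def cbracket_real_linear scaleR_right_distrib)
    ultimately show ?thesis by blast
  qed
  have homog: "?P y" if y: "y \<in> G.casimir_space r" for y r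
  proof -
    have "?P ((1 / 2) *\<^sub>R (y + \<Theta> y) + (1 / 2) *\<^sub>R (y - \<Theta> y))"
      using y by (intro add fixed anti[of _ r])
        (simp_all add: casimir_space_closed Theta_casimir_space Theta_linear algebra_simps)
    moreover have "(1 / 2) *\<^sub>R (y + \<Theta> y) + (1 / 2) *\<^sub>R (y - \<Theta> y) = y"
      by (simp add: algebra_simps flip: scaleR_left_distrib)
    ultimately show ?thesis by simp
  qed
  have sum: "?P (\<Sum>r\<in>J. v r)" if "finite J" "\<And>r. v r \<in> G.casimir_space r" for J v
    using that(1)
  proof (induction J rule: finite_induct)
    case empty
    show ?case using fixed[of 0] by (simp add: Theta_linear)
  next
    case (insert r J)
    then show ?case using add[OF homog[OF that(2)] insert.IH] by simp
  qed
  obtain J v where "finite J" "\<And>r. v r \<in> G.casimir_space r" "y = (\<Sum>r\<in>J. v r)"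
    using casimir_decomposition[of y] by metis
  then show ?thesis using sum by simp
qed

lemma linear_complement_span_core_values:
  "linear_complement (G.span (\<Union>r\<in>{2..}. core_values r)) (adE ` {p. \<Theta> p = p}) (range adE)"
  unfolding linear_complement_def
proof (intro conjI)
  let ?D = "G.span (\<Union>r\<in>{2..}. core_values r)"
  show "G.subspace ?D" by simp
  have "0 \<in> adE ` {p. \<Theta> p = p}"
    by (rule image_eqI[of _ _ 0]) (simp_all add: cbracket_real_linear Theta_linear)
  then show "?D \<inter> adE ` {p. \<Theta> p = p} = {0}"
    using span_core_values_inter G.span_zero by blast
  have "G.subspace (range adE)" using G.E.subspace_image[OF G.subspace_UNIV] .
  then have "?D \<subseteq> range adE" by (intro G.span_minimal) (auto dest: core_values_in_image)
  then have "d + adE p \<in> range adE" if "d \<in> ?D" for d p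
    using that \<open>G.subspace (range adE)\<close> by (blast intro: G.subspace_add)
  then show "range adE = {d + u |d u. d \<in> ?D \<and> u \<in> adE ` {p. \<Theta> p = p}}"
    using adE_decomposition by blast
qed

lemma isotropy_stable:
  assumes K: "subgroup K (Aut_group br)" and F: "F \<in> isotropy K \<zeta>"
    and k: "{x. \<theta> x = x} = lie_algebra_of br K" and a: "a \<in> G.span (\<Union>r\<in>{2..}. core_values r)"
  shows "cextend (blinfun_apply F) a \<in> G.span (\<Union>r\<in>{2..}. core_values r)"
proof -
  have FK: "F \<in> K" and Fz: "F \<zeta> = \<zeta>" using F by (auto simp: isotropy_def)
  have theta_F: "\<theta> (F x) = F (\<theta> x)" for x by (rule compact_group_commutes_theta[OF K FK k])
  have hom: "F (br x y) = br (F x) (F y)" for x y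
    using FK subgroup.subset[OF K] by (auto simp: Aut_group_def lie_automorphisms_def)
  have Ff: "F T.f = T.f"
    using theta_F[of \<zeta>] by (simp add: T.f_def Fz blinfun.minus_right)
  have Fh: "F h = h" using hom[of \<zeta> T.f] by (simp add: T.ef' Fz Ff)
  show ?thesis
  proof (rule span_core_values_stable[where \<sigma> = id, OF _ _ _ _ _ _ _ a])
    show "cextend F (adE p) = adE (cextend F p)" "cextend F (adF p) = adF (cextend F p)"
      "cextend F (adH p) = adH (cextend F p)" for p
      unfolding Phi0_e Phi0_f' Phi0_h cbracket_of_gR by (simp_all add: cextend_def hom Fz Ff Fh prod_eq_iff)
    show "cextend F (\<Theta> p) = \<Theta> (cextend F p)" for p by (simp add: cextend_def theta_F prod_eq_iff)
  qed (simp_all add: cextend_def cscale_def blinfun.add_right blinfun.diff_right blinfun.scaleR_right prod_eq_iff)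
qed

end

text \<open>An automorphism carrying x to z conjugates ad x into ad z, so nilpotency is constant
  along the orbit.\<close>

lemma nilpotent_orbit_nilpotent:
  assumes "nonzero_nilpotent_orbit br Orb" "z \<in> Orb"
  shows "nilpotent_element br z"
proof -
  obtain x F where x: "nilpotent_element br x" "F \<in> adjoint_group br" "z = blinfun_apply F x"
    using assms unfolding nonzero_nilpotent_orbit_def by blast
  have "F \<in> lie_automorphisms br"
    using x(2) connected_component_subset unfolding adjoint_group_def by blast
  then have bij: "bij (blinfun_apply F)" and hom: "\<And>x y. F (br x y) = br (F x) (F y)"
    by (auto simp: lie_automorphisms_def)
  obtain n where n: "\<And>v. (br x ^^ n) v = 0" using x(1) by (auto simp: nilpotent_element_def)
  have pow: "(br z ^^ k) (F v) = F ((br x ^^ k) v)" for k v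
    by (induction k) (simp_all add: hom x(3))
  have "(br z ^^ n) v = 0" for v
  proof -
    obtain w where "v = F w" using bij_is_surj[OF bij] by blast
    then show ?thesis by (simp add: pow n blinfun.zero_right)
  qed
  then show ?thesis by (auto simp: nilpotent_element_def)
qed

theorem proposition4p9:
  fixes br :: "'a::euclidean_space \<Rightarrow> 'a \<Rightarrow> 'a"
    and K :: "('a \<Rightarrow>\<^sub>L 'a) set"
    and \<theta> :: "'a \<Rightarrow> 'a"
    and Orb :: "'a set"
    and \<zeta> :: 'a
    and \<Phi>0 :: "sl2 \<Rightarrow> 'a \<times> 'a"
  assumes "semisimple_lie_algebra br"
    and "maximal_compact_subgroup br K"
    and "cartan_involution br \<theta>"
    and "{x. \<theta> x = x} = lie_algebra_of br K"
    and "nonzero_nilpotent_orbit br Orb"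
    and "\<zeta> \<in> core br \<theta> Orb"
    and "\<Phi>0 \<in> Mor_real_theta br \<theta>"
    and "\<Phi>0 sl2_e = of_gR \<zeta>"
  shows "let D = (\<lambda>\<Phi>. \<Phi> sl2_e) ` d_space br \<theta> \<Phi>0;
             \<kk> = complexify (lie_algebra_of br K)
         in independent_subspaces {2..} (\<lambda>r. Hom_theta_isotypic br \<theta> \<Phi>0 r (r - 2)) \<and>
            inj_on (\<lambda>\<Phi>. \<Phi> sl2_e) (d_space br \<theta> \<Phi>0) \<and>
            (\<forall>F\<in>isotropy K \<zeta>. cextend (blinfun_apply F) ` D \<subseteq> D) \<and>
            linear_complement D (cbracket br (of_gR \<zeta>) ` \<kk>) (range (cbracket br (of_gR \<zeta>))) \<and>
            defined_over_R D"
proof -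
  have "nilpotent_element br \<zeta>"
    using nilpotent_orbit_nilpotent[OF assms(5)] assms(6) by (simp add: core_def)
  then interpret real_sl2_morphism br \<theta> \<Phi>0 \<zeta>
    using assms by unfold_locales (auto simp: semisimple_lie_algebra_def)
  have K: "subgroup K (Aut_group br)"
    using assms(2) by (simp add: maximal_compact_subgroup_def compact_subgroup_def)
  \<comment> \<open>A pair is fixed by the extended involution exactly when its real and imaginary
    parts are fixed, so the complexification of the Lie algebra of K is the fixed space of
    \<Theta>.\<close>
  have k: "complexify (lie_algebra_of br K) = {p. cextend \<theta> p = p}"
    unfolding assms(4)[symmetric] by (auto simp: complexify_def cextend_def prod_eq_iff)
  show ?thesis
    unfolding Let_def evaluation_d_space k assms(8)[symmetric]
    using independent_Hom_theta_isotypic inj_on_evaluation isotropy_stable[OF K _ assms(4)]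
      linear_complement_span_core_values defined_over_R_span_core_values by blast
qed

end
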